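(* Let $X$ be a normal space and $K$ be a $CW$-complex. Suppose that for every locally finite open cover $\omega$ of $X$ there exists an $\omega$-map from $X$ into a paracompact space $Y$ with $Y\in\alpha(K)$. Then $X\in\alpha(K)$.
   Context: All spaces are assumed to be normal and all maps are continuous. For a space $K$, $\alpha(K)$ denotes the class of all normal spaces $X$ with the following property: whenever $A\subset X$ is closed and $f\colon A\to K$ is a continuous map for which there exist a neighborhood $U$ of $A$ in $X$ and a continuous map $g\colon U\to K$ extending $f$, then $f$ can be extended to a continuous map from $X$ into $K$. For an open cover $\omega$ of $X$, a continuous map $f\colon X\to Y$ is called an $\omega$-map if there is an open cover $\gamma$ of $Y$ such that $f^{-1}(\gamma)=\{f^{-1}(G):G\in\gamma\}$ refines $\omega$. (The space $Y$ may depend on $\omega$.) *)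

theory Defs
  imports "HOL-Analysis.Analysis"
begin

definition open_cover :: "'a topology \<Rightarrow> 'a set set \<Rightarrow> bool" where
  "open_cover X \<U> \<longleftrightarrow> (\<forall>U\<in>\<U>. openin X U) \<and> \<Union>\<U> = topspace X"

definition refines :: "'a set set \<Rightarrow> 'a set set \<Rightarrow> bool" where
  "refines \<V> \<U> \<longleftrightarrow> (\<forall>V\<in>\<V>. \<exists>U\<in>\<U>. V \<subseteq> U)"

(* No separation axiom is built in.  Below, paracompactness is only ever required of spaces
   that are also normal; normality is normal_space, which does not include T1. *)
definition paracompact_space :: "'a topology \<Rightarrow> bool" where
  "paracompact_space X \<longleftrightarrow>
     (\<forall>\<U>. open_cover X \<U> \<longrightarrow>
        (\<exists>\<V>. open_cover X \<V> \<and> refines \<V> \<U> \<and> locally_finite_in X \<V>))"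

definition omega_map :: "'a set set \<Rightarrow> 'a topology \<Rightarrow> 'b topology \<Rightarrow> ('a \<Rightarrow> 'b) \<Rightarrow> bool" where
  "omega_map \<omega> X Y f \<longleftrightarrow> continuous_map X Y f \<and>
     (\<exists>\<gamma>. open_cover Y \<gamma> \<and> refines ((\<lambda>G. {x \<in> topspace X. f x \<in> G}) ` \<gamma>) \<omega>)"

(* Neighbourhoods of A are not required to be open: U is one if A lies in its interior. *)
definition alpha :: "'k topology \<Rightarrow> 'a topology set" where
  "alpha K = {X. normal_space X \<and>
     (\<forall>A f. closedin X A \<and> continuous_map (subtopology X A) K f \<and>
        (\<exists>U g. U \<subseteq> topspace X \<and> A \<subseteq> X interior_of U \<and>
           continuous_map (subtopology X U) K g \<and> (\<forall>x\<in>A. g x = f x))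
        \<longrightarrow> (\<exists>h. continuous_map X K h \<and> (\<forall>x\<in>A. h x = f x)))}"

definition unit_disc :: "nat \<Rightarrow> (nat \<Rightarrow> real) set" where
  "unit_disc n = {x \<in> topspace (Euclidean_space n). (\<Sum>i<n. (x i)\<^sup>2) \<le> 1}"

(* For n = 0 the open disc is a point and the sphere is empty, as they should be. *)
definition open_unit_disc :: "nat \<Rightarrow> (nat \<Rightarrow> real) set" where
  "open_unit_disc n = {x \<in> topspace (Euclidean_space n). (\<Sum>i<n. (x i)\<^sup>2) < 1}"

definition unit_sphere :: "nat \<Rightarrow> (nat \<Rightarrow> real) set" where
  "unit_sphere n = {x \<in> topspace (Euclidean_space n). (\<Sum>i<n. (x i)\<^sup>2) = 1}"

(* Whitehead's definition: E is the set of open cells, d e the dimension of the cell e and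
   \<Phi> e its characteristic map.  The last two conjuncts are closure-finiteness (C) and the
   weak topology (W). *)
definition CW_structure ::
  "'k topology \<Rightarrow> 'k set set \<Rightarrow> ('k set \<Rightarrow> nat) \<Rightarrow> ('k set \<Rightarrow> (nat \<Rightarrow> real) \<Rightarrow> 'k) \<Rightarrow> bool" where
  "CW_structure K E d \<Phi> \<longleftrightarrow>
     Hausdorff_space K \<and>
     pairwise disjnt E \<and> \<Union>E = topspace K \<and>
     (\<forall>e\<in>E.
        continuous_map (subtopology (Euclidean_space (d e)) (unit_disc (d e))) K (\<Phi> e) \<and>
        homeomorphic_map (subtopology (Euclidean_space (d e)) (open_unit_disc (d e)))
          (subtopology K e) (\<Phi> e) \<and>
        \<Phi> e ` unit_sphere (d e) \<subseteq> \<Union>{e' \<in> E. d e' < d e}) \<and>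
     (\<forall>e\<in>E. finite {e' \<in> E. e' \<inter> (K closure_of e) \<noteq> {}}) \<and>
     (\<forall>C. C \<subseteq> topspace K \<longrightarrow>
        (\<forall>e\<in>E. closedin K (C \<inter> (K closure_of e))) \<longrightarrow> closedin K C)"

definition CW_complex :: "'k topology \<Rightarrow> bool" where
  "CW_complex K \<longleftrightarrow> (\<exists>E d \<Phi>. CW_structure K E d \<Phi>)"

end

theory Submission
  imports Defs
begin

text \<open>A flow that pushes every cell of \<open>K\<close> radially outwards, and continues in the cells of lower
  dimension once a boundary has been reached, retracts a neighbourhood of every skeleton onto that
  skeleton. Reading off the coordinates of the retracted points yields a locally finite open cover of
  \<open>K\<close> by pieces such that points lying in the same pieces can be joined: go along the flow into a
  cell, then along a straight segment, cell after cell in decreasing dimension. If the pieces are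
  small enough, the coordinates in all lower cells change so little on the way that the process can
  be continued.

  Pulling this cover back along the given map \<open>g\<close> near \<open>A\<close> gives an open cover of \<open>X\<close>. For a map
  \<open>\<phi> : X \<rightarrow> Y\<close> subordinate to it, weights on \<open>Y\<close> define a map \<open>\<psi>\<close> into \<open>K\<close> on a neighbourhood of
  the closed image of a neighbourhood of \<open>A\<close>, and \<open>\<psi> \<circ> \<phi>\<close> is homotopic to \<open>g\<close>. The hypothesis on
  \<open>Y\<close> extends \<open>\<psi>\<close> from that closed set to all of \<open>Y\<close>, and a Urysohn function on \<open>X\<close> runs through
  the homotopy from \<open>g\<close> on \<open>A\<close> to the extension of \<open>\<psi> \<circ> \<phi>\<close> away from \<open>A\<close>.\<close>

section \<open>Discs and continuity\<close>

text \<open>The obstacle is the weak topology: \<open>K\<close> need not be metrizable or locally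
  compact, and a point may lie in the closures of infinitely many cells, so no uniform smallness is
  available. Smallness is therefore measured inside single cells: where a flow line enters an open
  \<open>n\<close>-cell, its coordinates lie in a Euclidean disc, in which segments and weighted
  means make sense. Each cell gets its own tolerance, chosen by recursion on the dimension because
  it has to respect those of the lower cells; it can be positive because only a compact part of the
  open cell matters. All deviations are measured from one reference point \<open>k\<close>, never
  from the preceding position, so errors do not add up along the descent. The weights on
  \<open>Y\<close> are not a partition of unity: at every point one of them equals 1. In the
  corresponding dimension the path forgets \<open>k\<close>, and this makes \<psi> a function of the
  point of \<open>Y\<close> alone. Multiplying all weights by \<open>s\<close> in [0, 1] gives the
  homotopy, which is at \<open>k\<close> for \<open>s = 0\<close>. Local finiteness on
  \<open>Y\<close> leaves only finitely many dimensions to deal with near a point.\<close>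

abbreviation disc_norm :: "nat \<Rightarrow> (nat \<Rightarrow> real) \<Rightarrow> real" where
  "disc_norm n z \<equiv> L2_set z {..<n}"

text \<open>At \<open>z = 0\<close> division by zero makes this the zero vector; the recursions
  below use it only where \<open>disc_norm n z\<close> is positive.\<close>

definition direction :: "nat \<Rightarrow> (nat \<Rightarrow> real) \<Rightarrow> nat \<Rightarrow> real" where
  "direction n z = (\<lambda>i. z i / disc_norm n z)"

lemma mem_unit_disc: "z \<in> unit_disc n \<longleftrightarrow> (\<forall>i\<ge>n. z i = 0) \<and> disc_norm n z \<le> 1"
  by (simp add: unit_disc_def topspace_Euclidean_space L2_set_def)

lemma mem_open_unit_disc: "z \<in> open_unit_disc n \<longleftrightarrow> (\<forall>i\<ge>n. z i = 0) \<and> disc_norm n z < 1"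
  by (simp add: open_unit_disc_def topspace_Euclidean_space L2_set_def)

lemma mem_unit_sphere: "z \<in> unit_sphere n \<longleftrightarrow> (\<forall>i\<ge>n. z i = 0) \<and> disc_norm n z = 1"
  by (simp add: unit_sphere_def topspace_Euclidean_space L2_set_def)

lemmas disc_mem = mem_unit_disc mem_open_unit_disc mem_unit_sphere

lemma unit_disc_eq: "unit_disc n = open_unit_disc n \<union> unit_sphere n"
  by (auto simp: disc_mem)

lemma disc_norm_scale: "0 \<le> c \<Longrightarrow> disc_norm n (\<lambda>i. c * z i) = c * disc_norm n z"
  by (simp add: L2_set_right_distrib)

lemma continuous_on_disc_norm: "continuous_on S (disc_norm n)"
  unfolding L2_set_def
  by (intro continuous_intros) (rule continuous_on_subset[OF continuous_on_product_coordinates], simp)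

lemma direction_in_sphere:
  assumes "\<forall>i\<ge>n. z i = 0" "disc_norm n z \<noteq> 0"
  shows "direction n z \<in> unit_sphere n"
proof -
  have eq: "direction n z = (\<lambda>i. (1 / disc_norm n z) * z i)"
    by (auto simp: direction_def)
  have "disc_norm n (direction n z) = 1"
    unfolding eq by (subst disc_norm_scale) (use assms in auto)
  then show ?thesis
    using assms by (simp add: mem_unit_sphere direction_def)
qed

lemma direction_sphere: "z \<in> unit_sphere n \<Longrightarrow> direction n z = z"
  by (auto simp: direction_def mem_unit_sphere)

lemma direction_scale: "0 < c \<Longrightarrow> direction n (\<lambda>i. c * z i) = direction n z"
  by (auto simp: direction_def disc_norm_scale)

text \<open>Links the abstract product topology with the type-class topology on functions, so that
  discs can be treated with \<open>top_of_set\<close>, \<open>compact\<close> and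
  \<open>closure\<close>.\<close>

lemma Euclidean_space_eq: "Euclidean_space n = top_of_set {x. \<forall>i\<ge>n. x i = 0}"
  by (simp add: Euclidean_space_def euclidean_product_topology)

lemma subtopology_Euclidean_disc:
  "subtopology (Euclidean_space n) (unit_disc n) = top_of_set (unit_disc n)"
  "subtopology (Euclidean_space n) (open_unit_disc n) = top_of_set (open_unit_disc n)"
  unfolding Euclidean_space_eq subtopology_subtopology
  by (rule arg_cong[where f = top_of_set], auto simp: disc_mem)+

lemma disc_norm_coord_le:
  assumes "\<forall>i\<ge>n. z i = 0"
  shows "\<bar>z i\<bar> \<le> disc_norm n z"
proof (cases "i < n")
  case True
  have "(z i)\<^sup>2 \<le> (\<Sum>i<n. (z i)\<^sup>2)"
    by (rule member_le_sum) (use True in auto)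
  then show ?thesis
    unfolding L2_set_def by (metis real_sqrt_abs real_sqrt_le_iff)
qed (use assms in auto)

lemma compact_unit_disc: "compact (unit_disc n)"
proof -
  \<comment> \<open>Tychonoff: the disc is a closed subset of a product of intervals, every
    coordinate being bounded by the norm.\<close>
  define B where "B = (\<Pi>\<^sub>E i\<in>(UNIV::nat set). {-1..1::real})"
  have "compactin (powertop_real UNIV) B"
    unfolding B_def by (subst compactin_PiE) auto
  then have B: "compact B"
    by (simp add: euclidean_product_topology)
  have "closed {z. disc_norm n z \<le> 1}"
    using closed_Collect_le[OF continuous_on_disc_norm continuous_on_const] by blast
  moreover have "closed {z::nat\<Rightarrow>real. \<forall>i\<ge>n. z i = 0}"
    using closedin_Euclidean_space[of n]
    by (simp add: euclidean_product_topology topspace_Euclidean_space)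
  moreover have "unit_disc n = {z. \<forall>i\<ge>n. z i = 0} \<inter> {z. disc_norm n z \<le> 1}"
    by (auto simp: disc_mem)
  ultimately have "closed (unit_disc n)"
    by auto
  moreover have "z i \<in> {-1..1}" if "z \<in> unit_disc n" for z i
    using disc_norm_coord_le[of n z i] that by (auto simp: disc_mem abs_le_iff)
  then have "unit_disc n \<subseteq> B"
    by (auto simp: B_def PiE_def)
  ultimately show ?thesis
    using B compact_Int_closed[of B "unit_disc n"] by (metis inf.absorb2)
qed

lemma closure_open_unit_disc: "unit_disc n \<subseteq> closure (open_unit_disc n)"
proof
  fix z assume z: "z \<in> unit_disc n"
  \<comment> \<open>Radial contraction factors below 1 that tend to 1; they move the closed disc
    into the open one.\<close>
  let ?c = "\<lambda>k::nat. 1 - 1 / real (Suc k)"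
  have "?c \<longlonglongrightarrow> 1"
    by (rule LIMSEQ_inverse_real_of_nat_add_minus[of 1, unfolded inverse_eq_divide, simplified add_uminus_conv_diff])
  then have "(\<lambda>k. ?c k * z i) \<longlonglongrightarrow> z i" for i
    using tendsto_mult_right[of ?c 1 sequentially "z i"] by simp
  then have "limitin (powertop_real UNIV) (\<lambda>k i. ?c k * z i) z sequentially"
    by (simp add: limitin_componentwise)
  then have "(\<lambda>k i. ?c k * z i) \<longlonglongrightarrow> z"
    by (simp add: euclidean_product_topology)
  moreover have "(\<lambda>i. ?c k * z i) \<in> open_unit_disc n" for k
  proof -
    have "?c k * disc_norm n z \<le> ?c k * 1"
      using z by (intro mult_left_mono) (auto simp: disc_mem)
    also have "\<dots> < 1" by simp
    finally show ?thesis
      using z disc_norm_scale[where c = "?c k" and n = n and z = z] by (simp add: disc_mem)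
  qed
  ultimately show "z \<in> closure (open_unit_disc n)"
    unfolding closure_sequential by (intro exI[of _ "\<lambda>k i. ?c k * z i"]) auto
qed

lemma continuous_map_scale:
  assumes "continuous_map X euclideanreal c" "continuous_map X (top_of_set S) z"
    and "\<And>x. x \<in> topspace X \<Longrightarrow> (\<lambda>i. c x * z x i) \<in> T"
  shows "continuous_map X (top_of_set T) (\<lambda>x i. c x * z x i)"
proof -
  have "continuous_map X (powertop_real UNIV) z"
    using assms(2) by (simp add: euclidean_product_topology continuous_map_in_subtopology)
  then have "continuous_map X euclideanreal (\<lambda>x. z x i)" for i
    by (simp add: continuous_map_componentwise_UNIV)
  then have "continuous_map X (powertop_real UNIV) (\<lambda>x i. c x * z x i)"
    unfolding continuous_map_componentwise_UNIV
    by (intro allI continuous_map_real_mult assms)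
  then show ?thesis
    using assms(3) by (auto simp: euclidean_product_topology continuous_map_in_subtopology)
qed

lemma continuous_map_coord:
  fixes z :: "'a \<Rightarrow> nat \<Rightarrow> real"
  assumes "continuous_map X (top_of_set S) z"
  shows "continuous_map X euclideanreal (\<lambda>x. z x i)"
  using assms by (simp add: euclidean_product_topology[symmetric] continuous_map_in_subtopology
      continuous_map_componentwise_UNIV)

lemma continuous_map_disc_intro:
  fixes z :: "'a \<Rightarrow> nat \<Rightarrow> real"
  assumes "\<And>i. continuous_map X euclideanreal (\<lambda>x. z x i)"
    and "\<And>x. x \<in> topspace X \<Longrightarrow> z x \<in> S"
  shows "continuous_map X (top_of_set S) z"
  using assms by (auto simp: euclidean_product_topology[symmetric] continuous_map_in_subtopology
      continuous_map_componentwise_UNIV)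

lemma continuous_map_disc_norm:
  assumes "continuous_map X (top_of_set S) z"
  shows "continuous_map X euclideanreal (\<lambda>x. disc_norm n (z x))"
  using continuous_map_compose[OF assms, of euclidean "disc_norm n"] continuous_on_disc_norm
  by (simp add: o_def)

lemma direction_sphere_of_disc: "z \<in> unit_disc n \<Longrightarrow> 0 < disc_norm n z \<Longrightarrow> direction n z \<in> unit_sphere n"
  by (rule direction_in_sphere) (auto simp: mem_unit_disc)

lemma scale_in_disc:
  assumes "z \<in> unit_disc n" "0 \<le> t" "t * disc_norm n z \<le> 1"
  shows "(\<lambda>i. t * z i) \<in> unit_disc n"
  using assms by (auto simp: mem_unit_disc disc_norm_scale)

lemma continuous_map_direction:
  assumes "continuous_map X (top_of_set (unit_disc n)) z" "\<And>x. x \<in> topspace X \<Longrightarrow> 0 < disc_norm n (z x)"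
  shows "continuous_map X (top_of_set (unit_disc n)) (\<lambda>x. direction n (z x))"
proof (rule continuous_map_disc_intro)
  fix i
  show "continuous_map X euclideanreal (\<lambda>x. direction n (z x) i)"
    unfolding direction_def
    by (intro continuous_map_real_divide continuous_map_coord[OF assms(1)] continuous_map_disc_norm[OF assms(1)])
      (use assms(2) in force)
next
  fix x assume x: "x \<in> topspace X"
  then have "z x \<in> unit_disc n"
    using continuous_map_image_subset_topspace[OF assms(1)] by auto
  then show "direction n (z x) \<in> unit_disc n"
    using direction_sphere_of_disc assms(2)[OF x] by (auto simp: unit_disc_eq)
qed

lemma continuous_map_locally:
  assumes "\<And>x. x \<in> topspace X \<Longrightarrow> \<exists>U. openin X U \<and> x \<in> U \<and> continuous_map (subtopology X U) Y f"
  shows "continuous_map X Y f"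
proof -
  obtain U where U: "\<And>x. x \<in> topspace X \<Longrightarrow>
      openin X (U x) \<and> x \<in> U x \<and> continuous_map (subtopology X (U x)) Y f"
    using assms by metis
  show ?thesis
    by (rule pasting_lemma[of "topspace X" X U _ "\<lambda>_. f"]) (use U in auto)
qed

section \<open>The radial flow of a CW complex\<close>

locale CW =
  fixes K :: "'k topology" and E :: "'k set set" and d :: "'k set \<Rightarrow> nat"
    and \<Phi> :: "'k set \<Rightarrow> (nat \<Rightarrow> real) \<Rightarrow> 'k"
  assumes CW: "CW_structure K E d \<Phi>"
begin

section \<open>Cells, skeleta and the coordinates of a point\<close>

definition skel :: "nat \<Rightarrow> 'k set" where
  "skel m = \<Union>{e \<in> E. d e < m}"

definition cell :: "'k \<Rightarrow> 'k set" where
  "cell x = (THE e. e \<in> E \<and> x \<in> e)"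

definition crd :: "'k \<Rightarrow> nat \<Rightarrow> real" where
  "crd x = inv_into (open_unit_disc (d (cell x))) (\<Phi> (cell x)) x"

lemma Hausdorff: "Hausdorff_space K"
  and disjoint: "pairwise disjnt E"
  and Union_cells: "\<Union>E = topspace K"
  using CW by (auto simp: CW_structure_def)

lemma Phi_cont: "e \<in> E \<Longrightarrow> continuous_map (top_of_set (unit_disc (d e))) K (\<Phi> e)"
  and Phi_homeo: "e \<in> E \<Longrightarrow> homeomorphic_map (top_of_set (open_unit_disc (d e))) (subtopology K e) (\<Phi> e)"
  using CW by (auto simp: CW_structure_def subtopology_Euclidean_disc)

lemma Phi_sphere:
  assumes "e \<in> E" "z \<in> unit_sphere (d e)"
  shows "\<Phi> e z \<in> skel (d e)"
proof -
  have "\<Phi> e ` unit_sphere (d e) \<subseteq> skel (d e)"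
    using CW assms(1) unfolding CW_structure_def skel_def by blast
  then show ?thesis
    using assms(2) by blast
qed

lemma cell_subset: "e \<in> E \<Longrightarrow> e \<subseteq> topspace K"
  using Union_cells by auto

lemma skel_mono: "m \<le> n \<Longrightarrow> skel m \<subseteq> skel n"
  by (auto simp: skel_def)

lemma skel_subset: "skel m \<subseteq> topspace K"
  using Union_cells by (auto simp: skel_def)

lemma Phi_open: "e \<in> E \<Longrightarrow> \<Phi> e ` open_unit_disc (d e) = e"
  using homeomorphic_imp_surjective_map[OF Phi_homeo[of e]] cell_subset[of e] by auto

lemma Phi_inj: "e \<in> E \<Longrightarrow> inj_on (\<Phi> e) (open_unit_disc (d e))"
  using homeomorphic_imp_injective_map[OF Phi_homeo[of e]] by simp

lemma Phi_space: "e \<in> E \<Longrightarrow> z \<in> unit_disc (d e) \<Longrightarrow> \<Phi> e z \<in> topspace K"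
  using continuous_map_image_subset_topspace[OF Phi_cont[of e]] by auto

lemma cell_eq: "e \<in> E \<Longrightarrow> x \<in> e \<Longrightarrow> cell x = e"
  unfolding cell_def by (rule the_equality) (use disjoint in \<open>auto simp: pairwise_def disjnt_iff\<close>)

lemma
  assumes "x \<in> topspace K"
  shows cell_in: "cell x \<in> E" and in_cell: "x \<in> cell x"
proof -
  obtain e where "e \<in> E" "x \<in> e"
    using assms Union_cells by blast
  then show "cell x \<in> E" "x \<in> cell x"
    using cell_eq[of e x] by simp_all
qed

lemma Phi_cell: "e \<in> E \<Longrightarrow> z \<in> open_unit_disc (d e) \<Longrightarrow> cell (\<Phi> e z) = e"
  using Phi_open cell_eq by blast

lemma Phi_crd_open: "e \<in> E \<Longrightarrow> z \<in> open_unit_disc (d e) \<Longrightarrow> crd (\<Phi> e z) = z"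
  using Phi_inj[of e] by (simp add: crd_def Phi_cell inv_into_f_f)

lemma
  assumes "x \<in> topspace K"
  shows Phi_crd: "\<Phi> (cell x) (crd x) = x" and crd_in: "crd x \<in> open_unit_disc (d (cell x))"
proof -
  have "x \<in> \<Phi> (cell x) ` open_unit_disc (d (cell x))"
    using Phi_open[OF cell_in[OF assms]] in_cell[OF assms] by simp
  then show "\<Phi> (cell x) (crd x) = x" "crd x \<in> open_unit_disc (d (cell x))"
    unfolding crd_def by (rule f_inv_into_f, rule inv_into_into)
qed

lemma crd_cont:
  assumes "e \<in> E"
  shows "continuous_map (subtopology K e) (top_of_set (open_unit_disc (d e))) crd"
proof -
  obtain g where g: "homeomorphic_maps (top_of_set (open_unit_disc (d e))) (subtopology K e) (\<Phi> e) g"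
    using Phi_homeo[OF assms] homeomorphic_map_maps by blast
  have eq: "g x = crd x" if "x \<in> e" for x
  proof -
    have x: "x \<in> topspace K"
      using that cell_subset[OF assms] by blast
    have "crd x \<in> open_unit_disc (d e)" "\<Phi> e (crd x) = x"
      using cell_eq[OF assms that] crd_in[OF x] Phi_crd[OF x] by simp_all
    moreover have "\<forall>z \<in> open_unit_disc (d e). g (\<Phi> e z) = z"
      using g by (simp add: homeomorphic_maps_def)
    ultimately show ?thesis
      by metis
  qed
  show ?thesis
    by (rule continuous_map_eq[of _ _ g]) (use g eq in \<open>auto simp: homeomorphic_maps_def\<close>)
qed

lemma dim_less: "x \<in> skel m \<Longrightarrow> d (cell x) < m"
  unfolding skel_def using cell_eq by blast

lemma skel_iff: "x \<in> topspace K \<Longrightarrow> x \<in> skel m \<longleftrightarrow> d (cell x) < m"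
  using dim_less[of x m] cell_in[of x] in_cell[of x] unfolding skel_def by blast

lemma Phi_dim_le: "e \<in> E \<Longrightarrow> z \<in> unit_disc (d e) \<Longrightarrow> d (cell (\<Phi> e z)) \<le> d e"
  unfolding unit_disc_eq using Phi_cell[of e z] dim_less[OF Phi_sphere[of e z]] by fastforce

lemma Phi_compact:
  assumes "e \<in> E" "closedin (top_of_set (unit_disc (d e))) S"
  shows "closedin K (\<Phi> e ` S)"
proof -
  have "compact_space (top_of_set (unit_disc (d e)))"
    using compact_unit_disc[of "d e"] by (simp add: compact_space_subtopology)
  then have "compactin (top_of_set (unit_disc (d e))) S"
    by (rule closedin_compact_space) (rule assms(2))
  then have "compactin K (\<Phi> e ` S)"
    by (rule image_compactin) (rule Phi_cont[OF assms(1)])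
  then show ?thesis
    by (rule compactin_imp_closedin[OF Hausdorff])
qed

lemma closure_cell:
  assumes "e \<in> E"
  shows "K closure_of e = \<Phi> e ` unit_disc (d e)"
proof
  have "closedin K (\<Phi> e ` unit_disc (d e))"
    using Phi_compact[OF assms, of "unit_disc (d e)"] by simp
  moreover have "e \<subseteq> \<Phi> e ` unit_disc (d e)"
    using Phi_open[OF assms] by (auto simp: unit_disc_eq)
  ultimately show "K closure_of e \<subseteq> \<Phi> e ` unit_disc (d e)"
    by (rule closure_of_minimal[rotated])
  have sub: "open_unit_disc (d e) \<subseteq> unit_disc (d e)"
    by (auto simp: unit_disc_eq)
  have "unit_disc (d e) = top_of_set (unit_disc (d e)) closure_of (open_unit_disc (d e))"
    using closure_open_unit_disc[of "d e"] sub by (auto simp: closure_of_subtopology Int_absorb1)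
  then have "\<Phi> e ` unit_disc (d e) = \<Phi> e ` (top_of_set (unit_disc (d e)) closure_of (open_unit_disc (d e)))"
    by simp
  also have "\<dots> \<subseteq> K closure_of (\<Phi> e ` open_unit_disc (d e))"
    using Phi_cont[OF assms] by (auto simp: continuous_map_eq_image_closure_subset)
  finally show "\<Phi> e ` unit_disc (d e) \<subseteq> K closure_of e"
    using Phi_open[OF assms] by simp
qed

section \<open>The weak topology tested on discs\<close>

text \<open>For any cell \<open>e\<close>, closure-finiteness cuts the part of \<open>S\<close> in
  the closure of \<open>e\<close> into finitely many sets, each lying in the closure of a member of
  \<open>E'\<close>. These are compact images of the preimages assumed closed, so cells outside
  \<open>E'\<close> need no check.\<close>

lemma closed_criterion:
  assumes "E' \<subseteq> E" "S \<subseteq> \<Union>E'"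
    and "\<And>e. e \<in> E' \<Longrightarrow> closedin (top_of_set (unit_disc (d e))) {z \<in> unit_disc (d e). \<Phi> e z \<in> S}"
  shows "closedin K S"
proof -
  have weak: "(\<forall>e\<in>E. closedin K (C \<inter> (K closure_of e))) \<Longrightarrow> closedin K C" if "C \<subseteq> topspace K" for C
    using CW that by (auto simp: CW_structure_def)
  have fin: "finite {e' \<in> E. e' \<inter> (K closure_of e) \<noteq> {}}" if "e \<in> E" for e
    using CW that by (auto simp: CW_structure_def)
  have S: "S \<subseteq> topspace K"
    using assms(1,2) Union_cells by blast
  have cl: "closedin K (S \<inter> (K closure_of e))" if "e \<in> E'" for e
  proof -
    have "S \<inter> (K closure_of e) = \<Phi> e ` {z \<in> unit_disc (d e). \<Phi> e z \<in> S}"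
      using that assms(1) by (subst closure_cell) auto
    then show ?thesis
      using Phi_compact assms(1,3) that by auto
  qed
  show ?thesis
  proof (rule weak[OF S], rule ballI)
    fix e assume e: "e \<in> E"
    let ?F = "{e' \<in> E'. e' \<inter> (K closure_of e) \<noteq> {}}"
    have "S \<inter> (K closure_of e) = (\<Union>e'\<in>?F. S \<inter> (K closure_of e')) \<inter> (K closure_of e)"
    proof -
      have "x \<in> (\<Union>e'\<in>?F. S \<inter> (K closure_of e'))" if x: "x \<in> S" "x \<in> K closure_of e" for x
      proof -
        obtain e' where "e' \<in> E'" "x \<in> e'"
          using assms(2) x(1) by blast
        moreover have "e' \<subseteq> K closure_of e'"
          by (rule closure_of_subset) (use \<open>e' \<in> E'\<close> assms(1) cell_subset in auto)
        ultimately show ?thesis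
          using x by blast
      qed
      then show ?thesis by blast
    qed
    moreover have "finite ?F"
      by (rule finite_subset[OF _ fin[OF e]]) (use assms(1) in auto)
    then have "closedin K (\<Union>e'\<in>?F. S \<inter> (K closure_of e'))"
      by (intro closedin_Union) (auto intro: cl)
    then have "closedin K ((\<Union>e'\<in>?F. S \<inter> (K closure_of e')) \<inter> (K closure_of e))"
      by (rule closedin_Int) (rule closedin_closure_of)
    ultimately show "closedin K (S \<inter> (K closure_of e))"
      by (simp only:)
  qed
qed

text \<open>This makes every union of open \<open>n\<close>-cells open relative to
  \<open>skel (Suc n)\<close>. Pulled back to a disc, the remaining set is the boundary sphere for a
  cell in \<open>A\<close> and the whole disc for any other cell of dimension at most
  \<open>n\<close>, since boundaries only meet cells of smaller dimension.\<close>

lemma cells_of_dim_closed: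
  assumes "A \<subseteq> {e \<in> E. d e = n}"
  shows "closedin K (skel (Suc n) - \<Union>A)"
proof (rule closed_criterion[of "{e \<in> E. d e \<le> n}"])
  fix e assume e: "e \<in> {e \<in> E. d e \<le> n}"
  show "closedin (top_of_set (unit_disc (d e))) {z \<in> unit_disc (d e). \<Phi> e z \<in> skel (Suc n) - \<Union>A}"
  proof (cases "e \<in> A")
    case True
    then have de: "d e = n" using assms by auto
    have "\<Phi> e z \<in> skel (Suc n) - \<Union>A \<longleftrightarrow> z \<in> unit_sphere (d e)" if z: "z \<in> unit_disc (d e)" for z
    proof (cases "z \<in> unit_sphere (d e)")
      case True
      then have "\<Phi> e z \<in> skel n" using Phi_sphere e de by auto
      then show ?thesis
        using True skel_mono[of n "Suc n"] assms dim_less[of "\<Phi> e z" n] cell_eq by fastforce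
    next
      case False
      then have "z \<in> open_unit_disc (d e)" using z by (auto simp: unit_disc_eq)
      then have "\<Phi> e z \<in> e" using Phi_open[of e] e by auto
      then show ?thesis using False \<open>e \<in> A\<close> by auto
    qed
    then have "{z \<in> unit_disc (d e). \<Phi> e z \<in> skel (Suc n) - \<Union>A} = {z \<in> unit_disc (d e). disc_norm (d e) z = 1}"
      by (auto simp: disc_mem)
    moreover have "closedin (top_of_set (unit_disc (d e))) {z \<in> unit_disc (d e). disc_norm (d e) z = 1}"
      using continuous_closedin_preimage_constant[OF continuous_on_disc_norm] by blast
    ultimately show ?thesis by simp
  next
    case False
    have "\<Phi> e z \<in> skel (Suc n) - \<Union>A" if z: "z \<in> unit_disc (d e)" for z
    proof -
      have "d (cell (\<Phi> e z)) \<le> n" "\<Phi> e z \<in> topspace K"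
        using Phi_dim_le[of e z] Phi_space[of e z] e z by auto
      moreover have "\<Phi> e z \<notin> \<Union>A"
      proof
        assume "\<Phi> e z \<in> \<Union>A"
        then obtain a where a: "a \<in> A" "\<Phi> e z \<in> a" by auto
        then have c: "cell (\<Phi> e z) = a" "d a = n" using assms cell_eq by auto
        then have "z \<notin> open_unit_disc (d e)"
          using Phi_cell[of e z] e False a by auto
        then have "d a < d e"
          using dim_less[OF Phi_sphere[of e z]] e z c by (auto simp: unit_disc_eq)
        then show False using c e by auto
      qed
      ultimately show ?thesis by (auto simp: skel_iff)
    qed
    then have "{z \<in> unit_disc (d e). \<Phi> e z \<in> skel (Suc n) - \<Union>A} = unit_disc (d e)"
      by auto
    then show ?thesis by simp
  qed
qed (auto simp: skel_def)

text \<open>The second assumption makes \<open>E'\<close> a subcomplex. Its union is closed, so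
  relatively closed sets are closed in \<open>K\<close>, and \<open>closed_criterion\<close> decides
  closedness disc by disc.\<close>

lemma quotient:
  assumes "E' \<subseteq> E" and sub: "\<And>e. e \<in> E' \<Longrightarrow> \<Phi> e ` unit_disc (d e) \<subseteq> \<Union>E'"
  shows "quotient_map (sum_topology (\<lambda>e. top_of_set (unit_disc (d e))) E') (subtopology K (\<Union>E'))
    (\<lambda>(e, z). \<Phi> e z)"
  unfolding quotient_map_closedin
proof (intro conjI allI impI)
  have E': "\<Union>E' \<subseteq> topspace K"
    using assms(1) Union_cells by auto
  have "x \<in> (\<lambda>(e, z). \<Phi> e z) ` (SIGMA e:E'. unit_disc (d e))" if x: "x \<in> \<Union>E'" for x
  proof -
    obtain e where e: "e \<in> E'" "x \<in> e" using x by auto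
    then obtain z where "z \<in> open_unit_disc (d e)" "x = \<Phi> e z"
      using Phi_open[of e] assms(1) by blast
    then show ?thesis
      using e by (auto simp: unit_disc_eq image_iff)
  qed
  moreover have "\<Phi> e z \<in> \<Union>E'" if "e \<in> E'" "z \<in> unit_disc (d e)" for e z
    using sub that by blast
  ultimately have im: "(\<lambda>(e, z). \<Phi> e z) ` (SIGMA e:E'. unit_disc (d e)) = \<Union>E'"
    by auto
  then show "(\<lambda>(e, z). \<Phi> e z) ` topspace (sum_topology (\<lambda>e. top_of_set (unit_disc (d e))) E')
      = topspace (subtopology K (\<Union>E'))"
    using E' by (auto simp: o_def)
  have clE': "closedin K (\<Union>E')"
  proof (rule closed_criterion[OF assms(1)])
    fix e assume "e \<in> E'"
    then have "{z \<in> unit_disc (d e). \<Phi> e z \<in> \<Union>E'} = unit_disc (d e)"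
      using sub by auto
    then show "closedin (top_of_set (unit_disc (d e))) {z \<in> unit_disc (d e). \<Phi> e z \<in> \<Union>E'}"
      by simp
  qed simp
  fix U assume U: "U \<subseteq> topspace (subtopology K (\<Union>E'))"
  have eq: "{x. (e, x) \<in> {x \<in> topspace (sum_topology (\<lambda>e. top_of_set (unit_disc (d e))) E').
      (\<lambda>(e, z). \<Phi> e z) x \<in> U}} = {z \<in> unit_disc (d e). \<Phi> e z \<in> U}" if "e \<in> E'" for e
    using that by auto
  show "closedin (sum_topology (\<lambda>e. top_of_set (unit_disc (d e))) E')
      {x \<in> topspace (sum_topology (\<lambda>e. top_of_set (unit_disc (d e))) E'). (\<lambda>(e, z). \<Phi> e z) x \<in> U} \<longleftrightarrow>
    closedin (subtopology K (\<Union>E')) U" (is "?L \<longleftrightarrow> ?R")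
  proof -
    have "?L \<longleftrightarrow> (\<forall>e\<in>E'. closedin (top_of_set (unit_disc (d e))) {z \<in> unit_disc (d e). \<Phi> e z \<in> U})"
      (is "_ \<longleftrightarrow> ?C")
    proof -
      have "?L \<longleftrightarrow> (\<forall>e\<in>E'. closedin (top_of_set (unit_disc (d e)))
          {x. (e, x) \<in> {x \<in> topspace (sum_topology (\<lambda>e. top_of_set (unit_disc (d e))) E').
            (\<lambda>(e, z). \<Phi> e z) x \<in> U}})"
        unfolding closedin_sum_topology by auto
      also have "\<dots> \<longleftrightarrow> ?C"
        by (rule ball_cong[OF refl]) (subst eq, assumption, rule refl)
      finally show ?thesis .
    qed
    also have "?C \<longleftrightarrow> closedin K U"
    proof
      assume ?C
      then show "closedin K U"
        using closed_criterion[OF assms(1), of U] U by simp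
    next
      assume cU: "closedin K U"
      show ?C
      proof
        fix e assume "e \<in> E'"
        then have "e \<in> E" using assms(1) by blast
        from closedin_continuous_map_preimage[OF Phi_cont[OF this] cU]
        show "closedin (top_of_set (unit_disc (d e))) {z \<in> unit_disc (d e). \<Phi> e z \<in> U}"
          by simp
      qed
    qed
    also have "closedin K U \<longleftrightarrow> ?R"
      using U by (simp add: closedin_closed_subtopology[OF clE'])
    finally show ?thesis .
  qed
qed

text \<open>Continuity on \<open>T \<times> K\<close> may be checked on one closed cell at a time, granting continuity on
  the lower skeleton, because \<open>T\<close> is locally compact and so taking the product with \<open>T\<close> preserves
  the quotient map from the disjoint union of the discs.\<close>

lemma skeletal_continuity:
  assumes T: "locally_compact_space T" "Hausdorff_space T"
    and step: "\<And>e. e \<in> E \<Longrightarrow> continuous_map (prod_topology T (subtopology K (skel (d e)))) Z h \<Longrightarrow>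
      continuous_map (prod_topology T (top_of_set (unit_disc (d e)))) Z (\<lambda>(t, z). h (t, \<Phi> e z))"
  shows "continuous_map (prod_topology T K) Z h"
proof -
  have glue: "continuous_map (prod_topology T (subtopology K (\<Union>E'))) Z h"
    if E': "E' \<subseteq> E" "\<And>e. e \<in> E' \<Longrightarrow> \<Phi> e ` unit_disc (d e) \<subseteq> \<Union>E'"
      and c: "\<And>e. e \<in> E' \<Longrightarrow> continuous_map (prod_topology T (top_of_set (unit_disc (d e)))) Z (\<lambda>(t, z). h (t, \<Phi> e z))"
    for E'
  proof (rule continuous_compose_quotient_map)
    let ?S = "sum_topology (\<lambda>e. top_of_set (unit_disc (d e))) E'"
    let ?q = "\<lambda>(t, y). (t, (\<lambda>(e, z). \<Phi> e z) y)"
    show "quotient_map (prod_topology T ?S) (prod_topology T (subtopology K (\<Union>E'))) ?q"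
      by (rule quotient_map_prod_right[OF T(1) disjI1[OF T(2)] quotient[OF E']])
    show "continuous_map (prod_topology T ?S) Z (h \<circ> ?q)"
    \<comment> \<open>The slice of a single cell \<open>e\<close> is open in the sum, and on it the
      composite is the map that assumption \<open>c\<close> speaks of.\<close>
    proof (rule continuous_map_locally)
      fix x assume x: "x \<in> topspace (prod_topology T ?S)"
      then obtain t e z where x_eq: "x = (t, e, z)" and e: "e \<in> E'"
        by auto
      define U where "U = topspace T \<times> ({e} \<times> unit_disc (d e))"
      have op: "openin ?S ({e} \<times> unit_disc (d e))"
        unfolding openin_sum_topology
      proof (intro conjI ballI)
        fix i assume "i \<in> E'"
        have "{x. (i, x) \<in> {e} \<times> unit_disc (d e)} = (if i = e then unit_disc (d i) else {})"
          by auto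
        then show "openin (top_of_set (unit_disc (d i))) {x. (i, x) \<in> {e} \<times> unit_disc (d e)}"
          by simp
      qed (use e in auto)
      have "continuous_map (subtopology (prod_topology T ?S) U) (prod_topology T (top_of_set (unit_disc (d e))))
          (\<lambda>(t, e, z). (t, z))"
      proof -
        have 1: "continuous_map (subtopology ?S ({e} \<times> unit_disc (d e))) (top_of_set (unit_disc (d e))) snd"
          unfolding continuous_map_def
        proof (intro conjI allI impI)
          fix O' assume O: "openin (top_of_set (unit_disc (d e))) O'"
          then have "O' \<subseteq> unit_disc (d e)" using openin_subset by force
          then have "{x \<in> topspace (subtopology ?S ({e} \<times> unit_disc (d e))). snd x \<in> O'} = {e} \<times> O'"
            using e by auto
          moreover have "openin ?S ({e} \<times> O')"
            unfolding openin_sum_topology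
          proof (intro conjI ballI)
            fix i assume "i \<in> E'"
            have "{x. (i, x) \<in> {e} \<times> O'} = (if i = e then O' else {})"
              by auto
            then show "openin (top_of_set (unit_disc (d i))) {x. (i, x) \<in> {e} \<times> O'}"
              using O by simp
          qed (use e \<open>O' \<subseteq> _\<close> in auto)
          ultimately show "openin (subtopology ?S ({e} \<times> unit_disc (d e)))
              {x \<in> topspace (subtopology ?S ({e} \<times> unit_disc (d e))). snd x \<in> O'}"
            using \<open>O' \<subseteq> _\<close> by (auto simp: openin_open_subtopology[OF op])
        qed auto
        have "subtopology (prod_topology T ?S) U = prod_topology T (subtopology ?S ({e} \<times> unit_disc (d e)))"
          unfolding U_def subtopology_Times by simp
        moreover have "continuous_map (prod_topology T (subtopology ?S ({e} \<times> unit_disc (d e))))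
            (prod_topology T (top_of_set (unit_disc (d e)))) (\<lambda>p. (fst p, snd (snd p)))"
          by (intro continuous_map_pairedI continuous_map_fst continuous_map_compose[OF continuous_map_snd 1, unfolded o_def])
        ultimately show ?thesis
          by (simp add: case_prod_unfold)
      qed
      from continuous_map_compose[OF this c[OF e]]
      have "continuous_map (subtopology (prod_topology T ?S) U) Z (h \<circ> ?q)"
        by (rule continuous_map_eq) (auto simp: U_def)
      moreover have "openin (prod_topology T ?S) U" "x \<in> U"
        using x op by (auto simp: U_def openin_prod_Times_iff x_eq)
      ultimately show "\<exists>U. openin (prod_topology T ?S) U \<and> x \<in> U \<and>
          continuous_map (subtopology (prod_topology T ?S) U) Z (h \<circ> ?q)"
        by blast
    qed
  qed
  have skel_ind: "continuous_map (prod_topology T (subtopology K (skel m))) Z h" for m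
  proof (induction m rule: less_induct)
    case (less m)
    have "\<Phi> e ` unit_disc (d e) \<subseteq> skel m" if "e \<in> E" "d e < m" for e
      using Phi_dim_le[of e] Phi_space[of e] that by (fastforce simp: skel_iff)
    then show ?case
      unfolding skel_def by (intro glue step) (auto intro: less[unfolded skel_def] simp: skel_def)
  qed
  have "continuous_map (prod_topology T (subtopology K (\<Union>E))) Z h"
    by (intro glue step skel_ind) (use Phi_space Union_cells in auto)
  then show ?thesis
    by (simp add: Union_cells)
qed


section \<open>Radial flow and heights of skeleta\<close>

abbreviation radius :: "'k \<Rightarrow> real" where
  "radius x \<equiv> disc_norm (d (cell x)) (crd x)"

abbreviation outward :: "'k \<Rightarrow> 'k" where
  "outward x \<equiv> \<Phi> (cell x) (direction (d (cell x)) (crd x))"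

lemma outward_skel:
  assumes "x \<in> topspace K" "radius x \<noteq> 0"
  shows "outward x \<in> skel (d (cell x))"
  using Phi_sphere[OF cell_in[OF assms(1)] direction_in_sphere] crd_in[OF assms(1)] assms(2)
  by (auto simp: mem_open_unit_disc)

text \<open>The flow multiplies the radial coordinate by \<open>t\<close>; once the boundary of a cell is reached, the
  remaining factor is spent in the cell of lower dimension that has been entered.\<close>

function flow :: "'k \<Rightarrow> real \<Rightarrow> 'k" where
  "flow x t = (if x \<in> topspace K \<and> 1 < t * radius x then flow (outward x) (t * radius x)
     else \<Phi> (cell x) (\<lambda>i. t * crd x i))"
  by pat_completeness auto
termination
proof (relation "Wellfounded.measure (\<lambda>(x, t). d (cell x))")
  fix x :: 'k and t :: real assume "x \<in> topspace K \<and> 1 < t * radius x"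
  then show "((outward x, t * radius x), (x, t)) \<in> Wellfounded.measure (\<lambda>(x, t). d (cell x))"
    using dim_less[OF outward_skel[of x]] by (cases "radius x = 0") auto
qed auto

text \<open>\<open>height m x\<close> is the reciprocal of the factor at which the flow line of \<open>x\<close> enters the
  skeleton \<open>skel m\<close>, and \<open>0\<close> if it never does.\<close>

function height :: "nat \<Rightarrow> 'k \<Rightarrow> real" where
  "height m x = (if d (cell x) < m then 1
     else if x \<in> topspace K \<and> 0 < radius x then radius x * height m (outward x) else 0)"
  by pat_completeness auto
termination
proof (relation "Wellfounded.measure (\<lambda>(m, x). d (cell x))")
  fix m :: nat and x :: 'k assume "x \<in> topspace K \<and> 0 < radius x"
  then show "((m, outward x), (m, x)) \<in> Wellfounded.measure (\<lambda>(m, x). d (cell x))"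
    using dim_less[OF outward_skel[of x]] by auto
qed auto

declare flow.simps [simp del] height.simps [simp del]

text \<open>Induction on the dimension of the cell in polar coordinates: the outward point lies in a
  cell of smaller dimension. Writing points as \<open>\<Phi> e z\<close> makes the recursion
  equations of \<open>flow\<close> and \<open>height\<close> directly applicable.\<close>

lemma radial_induct [consumes 1, case_names Phi]:
  assumes "x \<in> topspace K"
    and step: "\<And>e z. e \<in> E \<Longrightarrow> z \<in> open_unit_disc (d e) \<Longrightarrow>
      (0 < disc_norm (d e) z \<Longrightarrow> P (\<Phi> e (direction (d e) z))) \<Longrightarrow> P (\<Phi> e z)"
  shows "P x"
  using assms(1)
proof (induction "d (cell x)" arbitrary: x rule: less_induct)
  case less
  have "P (\<Phi> (cell x) (crd x))"
  proof (rule step[OF cell_in[OF less.prems] crd_in[OF less.prems]])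
    assume "0 < radius x"
    then have o: "outward x \<in> skel (d (cell x))"
      using outward_skel[OF less.prems] by auto
    show "P (outward x)"
      by (rule less.hyps[OF dim_less[OF o]]) (use o skel_subset in auto)
  qed
  then show ?case
    using Phi_crd[OF less.prems] by simp
qed

lemma Phi_direction_skel:
  "e \<in> E \<Longrightarrow> z \<in> unit_disc (d e) \<Longrightarrow> 0 < disc_norm (d e) z \<Longrightarrow> \<Phi> e (direction (d e) z) \<in> skel (d e)"
  by (rule Phi_sphere, assumption, rule direction_sphere_of_disc)

lemma flow_1: "x \<in> topspace K \<Longrightarrow> flow x 1 = x"
  using crd_in[of x] Phi_crd[of x] by (subst flow.simps) (auto simp: mem_open_unit_disc)

text \<open>The defining recursion uses coordinates in open discs only. On the boundary sphere the
  norm is 1 and \<open>direction\<close> is the identity, so the equation persists there trivially.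
  Continuity across the boundary needs this form on the closed disc.\<close>

lemma flow_Phi:
  assumes e: "e \<in> E" and z: "z \<in> unit_disc (d e)" and t: "1 \<le> t"
  shows "flow (\<Phi> e z) t = (if 1 < t * disc_norm (d e) z
    then flow (\<Phi> e (direction (d e) z)) (t * disc_norm (d e) z) else \<Phi> e (\<lambda>i. t * z i))"
proof (cases "z \<in> open_unit_disc (d e)")
  case True
  then show ?thesis
    using Phi_space[OF e z] by (subst flow.simps) (simp add: Phi_cell[OF e] Phi_crd_open[OF e])
next
  case False
  then have s: "z \<in> unit_sphere (d e)" using z by (auto simp: unit_disc_eq)
  then have n: "disc_norm (d e) z = 1" by (simp add: mem_unit_sphere)
  show ?thesis
  proof (cases "1 < t")
    case True
    then show ?thesis using n direction_sphere[OF s] by simp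
  next
    case False
    then have "t = 1" using t by simp
    then show ?thesis using n flow_1[OF Phi_space[OF e z]] by simp
  qed
qed

lemma height_skel: "d (cell x) < m \<Longrightarrow> height m x = 1"
  by (subst height.simps) simp

lemma height_Phi:
  assumes e: "e \<in> E" and z: "z \<in> unit_disc (d e)" and m: "m \<le> d e"
  shows "height m (\<Phi> e z) = (if 0 < disc_norm (d e) z
    then disc_norm (d e) z * height m (\<Phi> e (direction (d e) z)) else 0)"
proof (cases "z \<in> open_unit_disc (d e)")
  case True
  then show ?thesis
    using Phi_space[OF e z] m by (subst height.simps) (simp add: Phi_cell[OF e] Phi_crd_open[OF e])
next
  case False
  then have s: "z \<in> unit_sphere (d e)" using z by (auto simp: unit_disc_eq)
  then have n: "disc_norm (d e) z = 1" by (simp add: mem_unit_sphere)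
  then show ?thesis using direction_sphere[OF s] by simp
qed

lemma height_bounds:
  assumes "x \<in> topspace K"
  shows "0 \<le> height m x \<and> height m x \<le> 1"
  using assms
proof (induction rule: radial_induct)
  case (Phi e z)
  then have z: "z \<in> unit_disc (d e)" "disc_norm (d e) z \<le> 1" by (auto simp: disc_mem)
  show ?case
  proof (cases "m \<le> d e")
    case True
    show ?thesis
      unfolding height_Phi[OF Phi(1) z(1) True]
      using Phi(3) z(2) by (auto intro: mult_le_one)
  next
    case False
    then have "height m (\<Phi> e z) = 1"
      using Phi_cell[OF Phi(1,2)] by (intro height_skel) simp
    then show ?thesis by simp
  qed
qed

lemma height_less_1:
  assumes "x \<in> topspace K" "m \<le> d (cell x)"
  shows "height m x < 1"
proof -
  have z: "crd x \<in> unit_disc (d (cell x))" "radius x < 1"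
    using crd_in[OF assms(1)] by (auto simp: disc_mem)
  have "radius x * height m (outward x) < 1" if "0 < radius x"
  proof -
    have "outward x \<in> topspace K"
      using outward_skel[OF assms(1)] skel_subset that by auto
    then have "radius x * height m (outward x) \<le> radius x * 1"
      using height_bounds by (intro mult_left_mono) auto
    then show ?thesis using z by simp
  qed
  then show ?thesis
    using height_Phi[OF cell_in[OF assms(1)] z(1) assms(2)] Phi_crd[OF assms(1)] by auto
qed

lemma height_eq_1_iff: "x \<in> topspace K \<Longrightarrow> height m x = 1 \<longleftrightarrow> d (cell x) < m"
  using height_less_1[of x m] height_skel[of x m] by (cases "m \<le> d (cell x)") auto

lemma height_mono:
  assumes "x \<in> topspace K" "m \<le> n"
  shows "height m x \<le> height n x"
  using assms(1)
proof (induction rule: radial_induct)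
  case (Phi e z)
  then have z: "z \<in> unit_disc (d e)" by (auto simp: disc_mem)
  show ?case
  proof (cases "n \<le> d e")
    case True
    then have m: "m \<le> d e" using assms(2) by simp
    show ?thesis
      unfolding height_Phi[OF Phi(1) z True] height_Phi[OF Phi(1) z m]
      using Phi(3) by (auto intro: mult_left_mono)
  next
    case False
    then have "height n (\<Phi> e z) = 1"
      using Phi_cell[OF Phi(1,2)] by (intro height_skel) simp
    then show ?thesis using height_bounds[OF Phi_space[OF Phi(1) z]] by simp
  qed
qed

lemma flow_space:
  assumes "x \<in> topspace K" "1 \<le> t"
  shows "flow x t \<in> topspace K"
  using assms
proof (induction arbitrary: t rule: radial_induct)
  case (Phi e z)
  then have z: "z \<in> unit_disc (d e)" by (auto simp: disc_mem)
  show ?case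
  proof (cases "1 < t * disc_norm (d e) z")
    case True
    then have "0 < disc_norm (d e) z"
      using Phi.prems by (metis L2_set_nonneg less_eq_real_def mult_zero_right not_one_less_zero)
    then show ?thesis
      using Phi True by (simp add: flow_Phi[OF Phi(1) z])
  next
    case False
    then show ?thesis
      using scale_in_disc[OF z, of t] Phi.prems Phi_space[OF Phi(1)]
      by (simp add: flow_Phi[OF Phi(1) z])
  qed
qed

text \<open>A flow line enters \<open>skel m\<close> at the factor \<open>1 / height m x\<close>;
  once \<open>t\<close> has been spent, the factor still missing is smaller by \<open>t\<close>. The
  value stays at 1 afterwards because the flow never leaves a skeleton.\<close>

lemma height_flow:
  assumes "x \<in> topspace K" "1 \<le> t"
  shows "height m (flow x t) = min 1 (t * height m x)"
  using assms
proof (induction arbitrary: t rule: radial_induct)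
  case (Phi e z)
  let ?r = "disc_norm (d e) z"
  have z: "z \<in> unit_disc (d e)" using Phi by (auto simp: disc_mem)
  have x: "\<Phi> e z \<in> topspace K" using Phi_space[OF Phi(1) z] .
  show ?case
  proof (cases "1 < t * ?r")
    case True
    then have r: "0 < ?r"
      using Phi.prems by (metis L2_set_nonneg less_eq_real_def mult_zero_right not_one_less_zero)
    have fl: "flow (\<Phi> e z) t = flow (\<Phi> e (direction (d e) z)) (t * ?r)"
      using True by (simp add: flow_Phi[OF Phi(1) z Phi.prems])
    have IH: "height m (flow (\<Phi> e z) t) = min 1 (t * ?r * height m (\<Phi> e (direction (d e) z)))"
      unfolding fl using Phi.IH[OF r] True by simp
    show ?thesis
    proof (cases "m \<le> d e")
      case True
      then show ?thesis
        unfolding IH using height_Phi[OF Phi(1) z True] r by (simp add: mult.assoc)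
    next
      case False
      have "\<Phi> e (direction (d e) z) \<in> skel (d e)"
        by (rule Phi_direction_skel[OF Phi(1) z r])
      then have "height m (\<Phi> e (direction (d e) z)) = 1" "height m (\<Phi> e z) = 1"
        using False dim_less[of "\<Phi> e (direction (d e) z)" "d e"] Phi_cell[OF Phi(1,2)]
        by (auto intro!: height_skel)
      then show ?thesis
        unfolding IH using True Phi.prems by simp
    qed
  next
    case False
    have fl: "flow (\<Phi> e z) t = \<Phi> e (\<lambda>i. t * z i)"
      using False by (simp add: flow_Phi[OF Phi(1) z Phi.prems])
    have tz: "(\<lambda>i. t * z i) \<in> unit_disc (d e)"
      using scale_in_disc[OF z, of t] Phi.prems False by simp
    have n: "disc_norm (d e) (\<lambda>i. t * z i) = t * ?r"
      using Phi.prems by (simp add: disc_norm_scale)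
    show ?thesis
    proof (cases "m \<le> d e")
      case True
      have "height m (flow (\<Phi> e z) t) = t * height m (\<Phi> e z)"
        unfolding fl height_Phi[OF Phi(1) tz True] height_Phi[OF Phi(1) z True] n
        using Phi.prems direction_scale[of t] by (auto simp: zero_less_mult_iff)
      moreover have "height m (flow (\<Phi> e z) t) \<le> 1"
        using height_bounds[OF flow_space[OF x Phi.prems]] by simp
      ultimately show ?thesis by simp
    next
      case False
      have "height m (flow (\<Phi> e z) t) = 1" "height m (\<Phi> e z) = 1"
        unfolding fl using False Phi_dim_le[OF Phi(1) tz] Phi_dim_le[OF Phi(1) z]
        by (auto intro!: height_skel)
      then show ?thesis using Phi.prems by simp
    qed
  qed
qed

text \<open>Passing through a boundary hands on exactly the unspent factor, so factors spent one
  after the other multiply.\<close>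

lemma flow_flow:
  assumes "x \<in> topspace K" "1 \<le> s" "1 \<le> t"
  shows "flow (flow x s) t = flow x (s * t)"
  using assms
proof (induction arbitrary: s rule: radial_induct)
  case (Phi e z)
  let ?r = "disc_norm (d e) z"
  have z: "z \<in> unit_disc (d e)" using Phi by (auto simp: disc_mem)
  have st: "1 \<le> s * t" "0 \<le> s" "0 < s"
    using Phi.prems mult_mono[of 1 s 1 t] by auto
  show ?case
  proof (cases "1 < s * ?r")
    case True
    then have r: "0 < ?r"
      using Phi.prems by (metis L2_set_nonneg less_eq_real_def mult_zero_right not_one_less_zero)
    have "s * ?r * 1 \<le> s * ?r * t"
      using True Phi.prems by (intro mult_left_mono) auto
    then have "1 < s * t * ?r"
      using True by (simp add: mult_ac)
    then show ?thesis
      using True Phi.IH[OF r, of "s * ?r"] Phi.prems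
      by (simp add: flow_Phi[OF Phi(1) z] st mult_ac)
  next
    case False
    have sz: "(\<lambda>i. s * z i) \<in> unit_disc (d e)"
      using scale_in_disc[OF z, of s] Phi.prems False by simp
    have n: "disc_norm (d e) (\<lambda>i. s * z i) = s * ?r"
      using Phi.prems by (simp add: disc_norm_scale)
    show ?thesis
      using False Phi.prems direction_scale[of s "d e" z]
      by (simp add: flow_Phi[OF Phi(1) z] flow_Phi[OF Phi(1) sz] n st mult_ac)
  qed
qed

text \<open>The truncation \<open>max 1 t\<close> lets the parameter range over the whole line. On a
  disc, \<open>flow_Phi\<close> has two closed cases which meet where the scaled norm is 1; the
  outer case is continuous by the assumption on the lower skeleton.\<close>

lemma flow_cont: "continuous_map (prod_topology euclideanreal K) K (\<lambda>(t, x). flow x (max 1 t))"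
proof (rule skeletal_continuity)
  fix e assume e: "e \<in> E"
  let ?h = "\<lambda>(t, x). flow x (max 1 t)"
  let ?X = "prod_topology euclideanreal (top_of_set (unit_disc (d e)))"
  let ?p = "\<lambda>y. max 1 (fst y) * disc_norm (d e) (snd y)"
  assume h: "continuous_map (prod_topology euclideanreal (subtopology K (skel (d e)))) K ?h"
  have t: "continuous_map ?X euclideanreal (\<lambda>y. max 1 (fst y))"
    by (intro continuous_map_real_max continuous_map_fst continuous_map_const[THEN iffD2]) auto
  have p: "continuous_map ?X euclideanreal ?p"
    by (intro continuous_map_real_mult t continuous_map_disc_norm[OF continuous_map_snd])
  let ?A = "subtopology ?X {y \<in> topspace ?X. ?p y \<le> 1}"
  let ?B = "subtopology ?X {y \<in> topspace ?X. 1 \<le> ?p y}"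
  have "continuous_map ?A K (\<Phi> e \<circ> (\<lambda>y i. max 1 (fst y) * snd y i))"
    by (rule continuous_map_compose[OF continuous_map_scale Phi_cont[OF e]])
      (auto intro: continuous_map_from_subtopology[OF t] continuous_map_from_subtopology[OF continuous_map_snd]
        intro!: scale_in_disc)
  then have A: "continuous_map ?A K (\<lambda>y. \<Phi> e (\<lambda>i. max 1 (fst y) * snd y i))"
    by (simp add: o_def)
  have pos: "0 < disc_norm (d e) (snd y)" if "y \<in> topspace ?B" for y
  proof -
    have "disc_norm (d e) (snd y) \<noteq> 0" using that by auto
    then show ?thesis by (simp add: less_le)
  qed
  have "continuous_map ?B (top_of_set (unit_disc (d e))) (\<lambda>y. direction (d e) (snd y))"
    by (rule continuous_map_direction[OF continuous_map_from_subtopology[OF continuous_map_snd] pos])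
  from continuous_map_compose[OF this Phi_cont[OF e]]
  have "continuous_map ?B (subtopology K (skel (d e))) (\<lambda>y. \<Phi> e (direction (d e) (snd y)))"
    unfolding continuous_map_in_subtopology
    using pos Phi_direction_skel[OF e] by (auto simp: o_def)
  then have "continuous_map ?B (prod_topology euclideanreal (subtopology K (skel (d e))))
      (\<lambda>y. (?p y, \<Phi> e (direction (d e) (snd y))))"
    by (intro continuous_map_pairedI continuous_map_from_subtopology[OF p])
  from continuous_map_compose[OF this h]
  have B: "continuous_map ?B K (\<lambda>y. flow (\<Phi> e (direction (d e) (snd y))) (?p y))"
    by (rule continuous_map_eq) (auto simp: max_def)
  have "continuous_map ?X K (\<lambda>y. if ?p y \<le> 1 then \<Phi> e (\<lambda>i. max 1 (fst y) * snd y i)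
      else flow (\<Phi> e (direction (d e) (snd y))) (?p y))"
  proof (rule continuous_map_cases_le[OF p _ A B])
    fix y assume y: "y \<in> topspace ?X" "?p y = 1"
    then have z: "snd y \<in> unit_disc (d e)" by auto
    have n: "disc_norm (d e) (snd y) \<noteq> 0" using y by auto
    then have "max 1 (fst y) = 1 / disc_norm (d e) (snd y)"
      using y by (simp add: field_simps)
    then have "(\<lambda>i. max 1 (fst y) * snd y i) = direction (d e) (snd y)"
      by (auto simp: direction_def)
    moreover have "\<Phi> e (direction (d e) (snd y)) \<in> topspace K"
      using Phi_direction_skel[OF e z] n skel_subset by (auto simp: less_le)
    ultimately show "\<Phi> e (\<lambda>i. max 1 (fst y) * snd y i) = flow (\<Phi> e (direction (d e) (snd y))) (?p y)"
      using y(2) flow_1 by simp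
  qed simp
  then show "continuous_map ?X K (\<lambda>(t, z). ?h (t, \<Phi> e z))"
    by (rule continuous_map_eq) (auto simp: flow_Phi[OF e])
qed (auto simp: locally_compact_space_euclidean)

lemma continuous_map_flow:
  assumes "continuous_map X K f" "continuous_map X euclideanreal t" "\<And>x. x \<in> topspace X \<Longrightarrow> 1 \<le> t x"
  shows "continuous_map X K (\<lambda>x. flow (f x) (t x))"
  using continuous_map_compose[OF continuous_map_pairedI[OF assms(2,1)] flow_cont]
  by (rule continuous_map_eq) (use assms(3) in \<open>auto simp: max_def dest: antisym\<close>)

text \<open>The real parameter is a dummy that fits \<open>skeletal_continuity\<close>. On a disc
  the height is the norm times a continuous function of the direction; at the centre, where there is
  no direction, continuity follows from the bound by the norm.\<close>

lemma height_cont: "continuous_map K euclideanreal (height m)"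
proof -
  have "continuous_map (prod_topology euclideanreal K) euclideanreal (\<lambda>(t, x). height m x)"
  proof (rule skeletal_continuity)
    fix e assume e: "e \<in> E"
    let ?h = "\<lambda>(t::real, x). height m x"
    let ?X = "prod_topology euclideanreal (top_of_set (unit_disc (d e)))"
    let ?r = "\<lambda>y. disc_norm (d e) (snd y)"
    assume h: "continuous_map (prod_topology euclideanreal (subtopology K (skel (d e)))) euclideanreal ?h"
    show "continuous_map ?X euclideanreal (\<lambda>(t, z). ?h (t, \<Phi> e z))"
    proof (cases "d e < m")
      case True
      have "continuous_map ?X euclideanreal (\<lambda>y. 1)" by simp
      then show ?thesis
      proof (rule continuous_map_eq)
        fix y assume "y \<in> topspace ?X"
        then have "d (cell (\<Phi> e (snd y))) < m"
          using Phi_dim_le[OF e, of "snd y"] True by auto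
        then show "1 = (\<lambda>(t, z). ?h (t, \<Phi> e z)) y"
          by (auto simp: case_prod_unfold height_skel)
      qed
    next
      case False
      then have m: "m \<le> d e" by simp
      have r: "continuous_map ?X euclideanreal ?r"
        by (rule continuous_map_disc_norm[OF continuous_map_snd])
      let ?Q = "{y \<in> topspace ?X. ?r y \<in> {0<..}}"
      let ?g = "\<lambda>y. height m (\<Phi> e (snd y))"
      have Q: "openin ?X ?Q"
        by (rule openin_continuous_map_preimage[OF r]) auto
      have "continuous_map (subtopology ?X ?Q) (top_of_set (unit_disc (d e))) (\<lambda>y. direction (d e) (snd y))"
        by (rule continuous_map_direction[OF continuous_map_from_subtopology[OF continuous_map_snd]]) auto
      from continuous_map_compose[OF this Phi_cont[OF e]]
      have "continuous_map (subtopology ?X ?Q) (subtopology K (skel (d e))) (\<lambda>y. \<Phi> e (direction (d e) (snd y)))"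
        unfolding continuous_map_in_subtopology using Phi_direction_skel[OF e] by (auto simp: o_def)
      then have "continuous_map (subtopology ?X ?Q) (prod_topology euclideanreal (subtopology K (skel (d e))))
          (\<lambda>y. (0, \<Phi> e (direction (d e) (snd y))))"
        by (intro continuous_map_pairedI) auto
      from continuous_map_compose[OF this h]
      have "continuous_map (subtopology ?X ?Q) euclideanreal (\<lambda>y. height m (\<Phi> e (direction (d e) (snd y))))"
        by (simp add: o_def)
      then have "continuous_map (subtopology ?X ?Q) euclideanreal
          (\<lambda>y. ?r y * height m (\<Phi> e (direction (d e) (snd y))))"
        by (intro continuous_map_real_mult continuous_map_from_subtopology[OF r])
      then have gQ: "continuous_map (subtopology ?X ?Q) euclideanreal ?g"
        by (rule continuous_map_eq) (auto simp: height_Phi[OF e _ m])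
      have pre: "openin ?X {y \<in> topspace ?X. ?r y \<in> {0<..} \<and> ?g y \<in> S}" if "open S" for S
      proof -
        have "openin (subtopology ?X ?Q) {y \<in> topspace (subtopology ?X ?Q). ?g y \<in> S}"
          by (rule openin_continuous_map_preimage[OF gQ]) (use that in auto)
        then have "openin ?X {y \<in> topspace (subtopology ?X ?Q). ?g y \<in> S}"
          by (rule openin_trans_full) (rule Q)
        then show ?thesis
          by (rule back_subst[of "openin ?X"]) auto
      qed
      have g_le: "0 \<le> ?g y \<and> ?g y \<le> ?r y" if "y \<in> topspace ?X" for y
      proof -
        have z: "snd y \<in> unit_disc (d e)" using that by auto
        have "?r y * height m (\<Phi> e (direction (d e) (snd y))) \<le> ?r y * 1" if "0 < ?r y"
          using height_bounds[of "\<Phi> e (direction (d e) (snd y))" m] Phi_direction_skel[OF e z that] skel_subset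
          by (intro mult_left_mono) auto
        then have "?g y \<le> ?r y"
          using height_Phi[OF e z m] by auto
        then show ?thesis
          using height_bounds[OF Phi_space[OF e z]] by blast
      qed
      have "continuous_map ?X euclideanreal ?g"
        unfolding continuous_map_upper_lower_semicontinuous_lt
      proof (intro conjI allI)
        fix a
        show "openin ?X {y \<in> topspace ?X. a < ?g y}"
        proof (cases "a < 0")
          case True
          then have "{y \<in> topspace ?X. a < ?g y} = topspace ?X"
            using g_le by force
          then show ?thesis by (simp only: openin_topspace)
        next
          case False
          then have "{y \<in> topspace ?X. a < ?g y} = {y \<in> topspace ?X. ?r y \<in> {0<..} \<and> ?g y \<in> {a<..}}"
            using g_le by force
          then show ?thesis using pre[of "{a<..}"] by simp
        qed
        show "openin ?X {y \<in> topspace ?X. ?g y < a}"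
        proof (cases "a \<le> 0")
          case True
          then have "{y \<in> topspace ?X. ?g y < a} = {}"
            using g_le by force
          then show ?thesis by (simp only: openin_empty)
        next
          case False
          \<comment> \<open>Near the centre, \<open>?g y \<le> ?r y\<close> alone puts the value
            below \<open>a\<close>.\<close>
          then have "{y \<in> topspace ?X. ?g y < a} =
              {y \<in> topspace ?X. ?r y \<in> {..<a}} \<union> {y \<in> topspace ?X. ?r y \<in> {0<..} \<and> ?g y \<in> {..<a}}"
            using g_le by force
          moreover have "openin ?X {y \<in> topspace ?X. ?r y \<in> {..<a}}"
            by (rule openin_continuous_map_preimage[OF r]) auto
          ultimately show ?thesis using pre[of "{..<a}"] by auto
        qed
      qed
      then show ?thesis
        by (simp add: case_prod_unfold)
    qed
  qed (auto simp: locally_compact_space_euclidean)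
  moreover have "continuous_map K (prod_topology euclideanreal K) (\<lambda>x. (0, x))"
    by (intro continuous_map_pairedI) auto
  ultimately have "continuous_map K euclideanreal ((\<lambda>(t, x). height m x) \<circ> (\<lambda>x. (0::real, x)))"
    using continuous_map_compose by blast
  then show ?thesis
    by (simp add: o_def)
qed

end

section \<open>Boxes in Euclidean discs and the threshold constants\<close>

text \<open>All vectors concerned vanish from index \<open>n\<close> on, so only the first
  \<open>n\<close> factors of a basic neighbourhood matter, and the least of their radii
  works.\<close>

lemma open_box:
  assumes "open U" "w0 \<in> U" "\<forall>i\<ge>n. w0 i = 0"
  shows "\<exists>\<epsilon>>0. \<forall>w::nat \<Rightarrow> real. (\<forall>i\<ge>n. w i = 0) \<and> (\<forall>i<n. \<bar>w0 i - w i\<bar> < \<epsilon>) \<longrightarrow> w \<in> U"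
proof -
  have "openin (powertop_real UNIV) U"
    using assms(1) by (simp add: euclidean_product_topology)
  then obtain B where B: "w0 \<in> (\<Pi>\<^sub>E i\<in>UNIV. B i)" "\<And>i. openin euclideanreal (B i)" "(\<Pi>\<^sub>E i\<in>UNIV. B i) \<subseteq> U"
    using product_topology_open_contains_basis[OF _ assms(2)] by blast
  have "\<exists>\<epsilon>>0. \<forall>y. \<bar>w0 i - y\<bar> < \<epsilon> \<longrightarrow> y \<in> B i" for i
  proof -
    have "open (B i)" "w0 i \<in> B i" using B by auto
    then obtain \<epsilon> where "\<epsilon> > 0" "\<And>y. \<bar>y - w0 i\<bar> < \<epsilon> \<Longrightarrow> y \<in> B i"
      unfolding open_real by blast
    then show ?thesis by (auto intro!: exI[of _ \<epsilon>] simp: abs_minus_commute)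
  qed
  then obtain \<epsilon> where \<epsilon>: "\<And>i. \<epsilon> i > 0" "\<And>i y. \<bar>w0 i - y\<bar> < \<epsilon> i \<Longrightarrow> y \<in> B i"
    by metis
  define \<delta> where "\<delta> = Min (insert 1 (\<epsilon> ` {..<n}))"
  have "\<delta> > 0"
    unfolding \<delta>_def using \<epsilon>(1) by (subst Min_gr_iff) auto
  moreover have "w \<in> U" if w: "\<forall>i\<ge>n. w i = 0" "\<forall>i<n. \<bar>w0 i - w i\<bar> < \<delta>" for w
  proof -
    have "w i \<in> B i" for i
    proof (cases "i < n")
      case True
      then have "\<delta> \<le> \<epsilon> i" unfolding \<delta>_def by (intro Min_le) auto
      then show ?thesis using \<epsilon>(2)[of i "w i"] w(2) True by force
    next
      case False
      then show ?thesis using w(1) assms(3) \<epsilon>(2)[of i "w i"] \<epsilon>(1)[of i] by simp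
    qed
    then show ?thesis using B(3) by (auto simp: PiE_def)
  qed
  ultimately show ?thesis by blast
qed

text \<open>Boxes instead of balls: weighted means can then be estimated one coordinate at a time.
  For \<open>n = 0\<close> the relation always holds.\<close>

definition close :: "nat \<Rightarrow> real \<Rightarrow> (nat \<Rightarrow> real) \<Rightarrow> (nat \<Rightarrow> real) \<Rightarrow> bool" where
  "close n \<epsilon> w w' \<longleftrightarrow> (\<forall>i<n. \<bar>w i - w' i\<bar> < \<epsilon>)"

lemma close_sym: "close n \<epsilon> w w' \<longleftrightarrow> close n \<epsilon> w' w"
  by (auto simp: close_def abs_minus_commute)

lemma close_refl: "0 < \<epsilon> \<Longrightarrow> close n \<epsilon> w w"
  by (auto simp: close_def)

lemma close_trans:
  assumes "close n \<epsilon> u v" "close n \<delta> v w"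
  shows "close n (\<epsilon> + \<delta>) u w"
  unfolding close_def
proof (intro allI impI)
  fix i assume "i < n"
  then have "\<bar>u i - v i\<bar> < \<epsilon>" "\<bar>v i - w i\<bar> < \<delta>"
    using assms by (auto simp: close_def)
  then show "\<bar>u i - w i\<bar> < \<epsilon> + \<delta>" by linarith
qed

lemma close_mono: "close n \<epsilon> u v \<Longrightarrow> \<epsilon> \<le> \<delta> \<Longrightarrow> close n \<delta> u v"
  by (force simp: close_def)

lemma close_convex:
  assumes "close n \<epsilon> w u" "close n \<epsilon> w v" "0 \<le> a" "0 \<le> b" "a + b = 1"
  shows "close n \<epsilon> w (\<lambda>i. a * u i + b * v i)"
  unfolding close_def
proof (intro allI impI)
  fix i assume "i < n"
  then have "\<bar>w i - u i\<bar> < \<epsilon>" "\<bar>w i - v i\<bar> < \<epsilon>"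
    using assms by (auto simp: close_def)
  then have "\<bar>a * (w i - u i) + b * (w i - v i)\<bar> < \<epsilon>"
    using assms(3-5) convex_bound_lt[of "\<bar>w i - u i\<bar>" \<epsilon> "\<bar>w i - v i\<bar>" a b]
      abs_triangle_ineq[of "a * (w i - u i)" "b * (w i - v i)"] by (simp add: abs_mult)
  moreover have "w i - (a * u i + b * v i) = a * (w i - u i) + b * (w i - v i)"
  proof -
    have "w i = a * w i + b * w i"
      using assms(5) by (metis distrib_right mult_1)
    then show ?thesis by (simp add: algebra_simps)
  qed
  ultimately show "\<bar>w i - (a * u i + b * v i)\<bar> < \<epsilon>" by simp
qed

lemma open_close: "open {w. close n \<epsilon> z w}"
proof -
  have "{w. close n \<epsilon> z w} = (\<Inter>i<n. {w. \<bar>z i - w i\<bar> < \<epsilon>})"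
    by (auto simp: close_def)
  moreover have "open {w::nat \<Rightarrow> real. \<bar>z i - w i\<bar> < \<epsilon>}" for i
    by (intro open_Collect_less continuous_intros) simp
  ultimately show ?thesis by auto
qed

text \<open>Lower and upper thresholds interleave as 1/2 < 2/3 < 3/4 < 4/5 < ... . The gap between
  the two of index \<open>n\<close> lets the open zones overlap and cover; the gap between the upper
  one of index \<open>m\<close> and the lower one of index \<open>Suc m\<close> puts
  \<open>ratio (Suc m)\<close> below 1.\<close>

definition lower_threshold :: "nat \<Rightarrow> real" where
  "lower_threshold n = 1 - 1 / real (2 * n + 2)"

definition upper_threshold :: "nat \<Rightarrow> real" where
  "upper_threshold n = 1 - 1 / real (2 * n + 3)"

text \<open>Bounds \<open>height n x / height (Suc n) x\<close> on \<open>zone n\<close>: numerator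
  below the upper threshold of the preceding index, denominator above the lower threshold of
  \<open>n\<close>. In dimension 0 the quotient is 0, as \<open>skel 0\<close> is empty.\<close>

definition ratio :: "nat \<Rightarrow> real" where
  "ratio n = (case n of 0 \<Rightarrow> 0 | Suc m \<Rightarrow> upper_threshold m / lower_threshold (Suc m))"

lemma threshold_order:
  "0 < lower_threshold n" "lower_threshold n < upper_threshold n"
  "upper_threshold n < lower_threshold (Suc n)" "lower_threshold n < 1" "upper_threshold n < 1"
  by (auto simp: lower_threshold_def upper_threshold_def field_simps)

lemma ratio_bounds: "0 \<le> ratio n" "ratio n < 1"
  using threshold_order[of "n - 1"] threshold_order[of n]
  by (auto simp: ratio_def split: nat.split)

context CW
begin

section \<open>Arrival data of flow lines in the cells of dimension \<open>n\<close>\<close>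

text \<open>The strict inequality says that the flow line enters \<open>skel (Suc n)\<close> before
  it reaches \<open>skel n\<close>, hence in the interior of an \<open>n\<close>-cell. Only then are
  \<open>base n\<close> and \<open>loc n\<close> meaningful.\<close>

definition active :: "nat \<Rightarrow> 'k set" where
  "active n = {x \<in> topspace K. height n x < height (Suc n) x}"

definition proj :: "nat \<Rightarrow> 'k \<Rightarrow> 'k" where
  "proj n x = flow x (1 / height (Suc n) x)"

definition base :: "nat \<Rightarrow> 'k \<Rightarrow> 'k set" where
  "base n x = cell (proj n x)"

definition loc :: "nat \<Rightarrow> 'k \<Rightarrow> nat \<Rightarrow> real" where
  "loc n x = crd (proj n x)"

lemma active_space: "x \<in> active n \<Longrightarrow> x \<in> topspace K"
  by (simp add: active_def)

lemma active_pos: "x \<in> active n \<Longrightarrow> 0 < height (Suc n) x"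
  using height_bounds[of x n] by (auto simp: active_def)

lemma inverse_height_ge_1: "x \<in> topspace K \<Longrightarrow> 0 < height m x \<Longrightarrow> 1 \<le> 1 / height m x"
  using height_bounds[of x m] by simp

lemma height_0: "x \<in> topspace K \<Longrightarrow> height 0 x = 0"
proof (induction rule: radial_induct)
  case (Phi e z)
  then have z: "z \<in> unit_disc (d e)" by (auto simp: disc_mem)
  show ?case
    using height_Phi[OF Phi(1) z, of 0] Phi(3) by auto
qed

lemma proj_space: "x \<in> topspace K \<Longrightarrow> 0 < height (Suc n) x \<Longrightarrow> proj n x \<in> topspace K"
  unfolding proj_def by (intro flow_space inverse_height_ge_1)

lemma height_proj:
  assumes "x \<in> topspace K" "0 < height (Suc n) x"
  shows "height m (proj n x) = min 1 (height m x / height (Suc n) x)"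
  unfolding proj_def by (subst height_flow) (use assms inverse_height_ge_1 in auto)

lemma height_proj_le:
  assumes "x \<in> topspace K" "0 < height (Suc n) x" "m \<le> Suc n"
  shows "height m (proj n x) = height m x / height (Suc n) x"
  using height_proj[OF assms(1,2), of m] height_mono[OF assms(1,3)] assms(2) by simp

lemma proj_skel:
  assumes "x \<in> topspace K" "0 < height (Suc n) x"
  shows "proj n x \<in> skel (Suc n)"
  using height_proj_le[OF assms, of "Suc n"] assms(2) height_eq_1_iff[OF proj_space[OF assms]]
    skel_iff[OF proj_space[OF assms]] by simp

lemma base_in: "x \<in> active n \<Longrightarrow> base n x \<in> E"
  unfolding base_def by (intro cell_in proj_space active_space active_pos)

lemma dim_base:
  assumes "x \<in> active n"
  shows "d (base n x) = n"
proof -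
  note x = active_space[OF assms] active_pos[OF assms]
  have "d (base n x) < Suc n"
    using dim_less[OF proj_skel[OF x]] by (simp add: base_def)
  moreover have "height n (proj n x) < 1"
    using height_proj_le[OF x, of n] x(2) assms by (simp add: active_def)
  then have "\<not> d (base n x) < n"
    using height_skel[of "proj n x" n] by (auto simp: base_def)
  ultimately show ?thesis by simp
qed

lemma loc_in: "x \<in> active n \<Longrightarrow> loc n x \<in> open_unit_disc n"
  using crd_in[of "proj n x"] proj_space[of x n] active_space active_pos dim_base[of x n]
  by (simp add: loc_def base_def)

lemma Phi_loc: "x \<in> active n \<Longrightarrow> \<Phi> (base n x) (loc n x) = proj n x"
  unfolding base_def loc_def by (intro Phi_crd proj_space active_space active_pos)

lemma proj_flow:
  assumes "x \<in> topspace K" "0 < height (Suc n) x" "1 \<le> t" "t * height (Suc n) x \<le> 1"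
  shows "proj n (flow x t) = proj n x"
proof -
  have h: "height (Suc n) (flow x t) = t * height (Suc n) x"
    using height_flow[OF assms(1,3)] assms(4) by simp
  have "1 \<le> 1 / (t * height (Suc n) x)"
    using assms by simp
  then show ?thesis
    unfolding proj_def h using flow_flow[OF assms(1,3)] assms(3) by simp
qed

lemma active_flow:
  assumes "x \<in> active n" "1 \<le> t" "t * height (Suc n) x \<le> 1"
  shows "flow x t \<in> active n"
proof -
  have "t * height n x < t * height (Suc n) x"
    using assms by (simp add: active_def)
  then show ?thesis
    using height_flow[OF active_space[OF assms(1)] assms(2)] flow_space[OF active_space[OF assms(1)] assms(2)]
      assms(3) by (simp add: active_def)
qed

lemma base_loc_flow:
  assumes "x \<in> active n" "1 \<le> t" "t * height (Suc n) x \<le> 1"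
  shows "base n (flow x t) = base n x" "loc n (flow x t) = loc n x"
  using proj_flow[OF active_space[OF assms(1)] active_pos[OF assms(1)] assms(2,3)]
  by (simp_all add: base_def loc_def)

text \<open>The flow line enters \<open>skel (Suc n)\<close> no later than
  \<open>skel (Suc j)\<close>, so at its arrival in the former the arrival in dimension
  \<open>j\<close> is still ahead and unchanged.\<close>

lemma active_proj:
  assumes "x \<in> active j" "j \<le> n"
  shows "proj n x \<in> active j" "base j (proj n x) = base j x" "loc j (proj n x) = loc j x"
proof -
  note x = active_space[OF assms(1)] active_pos[OF assms(1)]
  have le: "height (Suc j) x \<le> height (Suc n) x"
    using height_mono[OF x(1)] assms(2) by simp
  then have pos: "0 < height (Suc n) x" using x(2) by simp
  then have t: "1 \<le> 1 / height (Suc n) x" "1 / height (Suc n) x * height (Suc j) x \<le> 1"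
    using inverse_height_ge_1[OF x(1)] le by simp_all
  show "proj n x \<in> active j" "base j (proj n x) = base j x" "loc j (proj n x) = loc j x"
    unfolding proj_def[of n] using active_flow[OF assms(1) t] base_loc_flow[OF assms(1) t] by auto
qed

lemma active_open: "openin K (active n)"
proof -
  have "continuous_map K euclideanreal (\<lambda>x. height (Suc n) x - height n x)"
    by (intro continuous_map_diff height_cont)
  then have "openin K {x \<in> topspace K. height (Suc n) x - height n x \<in> {0<..}}"
    by (rule openin_continuous_map_preimage) auto
  then show ?thesis
    by (simp add: active_def)
qed

lemma proj_cont: "continuous_map (subtopology K (active n)) K (proj n)"
  unfolding proj_def
proof (rule continuous_map_flow)
  have pos: "0 < height (Suc n) x" if "x \<in> topspace (subtopology K (active n))" for x
    using that active_pos by simp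
  then have "height (Suc n) x \<noteq> 0" if "x \<in> topspace (subtopology K (active n))" for x
    using that by force
  then show "continuous_map (subtopology K (active n)) euclideanreal (\<lambda>x. 1 / height (Suc n) x)"
    by (intro continuous_map_real_divide continuous_map_from_subtopology[OF height_cont]) simp_all
  show "1 \<le> 1 / height (Suc n) x" if "x \<in> topspace (subtopology K (active n))" for x
    by (rule inverse_height_ge_1) (use pos that in auto)
qed (simp add: continuous_map_from_subtopology)

text \<open>The cell of arrival is locally constant on \<open>active n\<close>, because
  \<open>proj n\<close> is continuous into \<open>skel (Suc n)\<close> and each
  \<open>n\<close>-cell is open there.\<close>

lemma base_open: "openin K {x \<in> active n. base n x = e}"
proof (cases "e \<in> E \<and> d e = n")
  case True
  have "closedin K (skel (Suc n) - \<Union>{e})"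
    by (rule cells_of_dim_closed) (use True in auto)
  then have "openin (subtopology K (active n))
      {x \<in> topspace (subtopology K (active n)). proj n x \<in> topspace K - (skel (Suc n) - \<Union>{e})}"
    by (intro openin_continuous_map_preimage[OF proj_cont]) auto
  then have "openin K {x \<in> topspace (subtopology K (active n)). proj n x \<in> topspace K - (skel (Suc n) - \<Union>{e})}"
    by (rule openin_trans_full) (rule active_open)
  moreover have "proj n x \<in> topspace K - (skel (Suc n) - \<Union>{e}) \<longleftrightarrow> base n x = e" if "x \<in> active n" for x
  proof -
    have p: "proj n x \<in> topspace K" "proj n x \<in> skel (Suc n)"
      using proj_space proj_skel active_space[OF that] active_pos[OF that] by auto
    then have "proj n x \<in> topspace K - (skel (Suc n) - \<Union>{e}) \<longleftrightarrow> proj n x \<in> e"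
      by auto
    also have "\<dots> \<longleftrightarrow> base n x = e"
      unfolding base_def using in_cell[OF p(1)] cell_eq[of e "proj n x"] True by auto
    finally show ?thesis .
  qed
  then have "{x \<in> topspace (subtopology K (active n)). proj n x \<in> topspace K - (skel (Suc n) - \<Union>{e})}
      = {x \<in> active n. base n x = e}"
    using active_space by auto
  ultimately show ?thesis by simp
next
  case False
  then have "{x \<in> active n. base n x = e} = {}"
    using base_in dim_base by auto
  then show ?thesis by (simp only: openin_empty)
qed

lemma loc_cont: "continuous_map (subtopology K {x \<in> active n. base n x = e}) (top_of_set (open_unit_disc n)) (loc n)"
proof (cases "e \<in> E \<and> d e = n")
  case True
  have "proj n x \<in> e" if "x \<in> active n" "base n x = e" for x
    using in_cell[OF proj_space[OF active_space active_pos]] that by (auto simp: base_def)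
  then have "continuous_map (subtopology K {x \<in> active n. base n x = e}) (subtopology K e) (proj n)"
    using continuous_map_from_subtopology_mono[OF proj_cont, of "{x \<in> active n. base n x = e}" n]
    by (auto simp: continuous_map_in_subtopology)
  moreover have "continuous_map (subtopology K e) (top_of_set (open_unit_disc n)) crd"
    using crd_cont[of e] True by simp
  ultimately have "continuous_map (subtopology K {x \<in> active n. base n x = e}) (top_of_set (open_unit_disc n)) (crd \<circ> proj n)"
    by (rule continuous_map_compose)
  then show ?thesis
    by (rule continuous_map_eq) (simp add: loc_def)
next
  case False
  then have *: "{x \<in> active n. base n x = e} = {}"
    using base_in dim_base by auto
  show ?thesis
    unfolding * by (simp add: continuous_map_def)
qed

lemma near_open: "openin K {x \<in> active n. base n x = e \<and> close n \<epsilon> z (loc n x)}"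
proof -
  let ?B = "{x \<in> active n. base n x = e}"
  have "openin (top_of_set (open_unit_disc n)) (open_unit_disc n \<inter> {w. close n \<epsilon> z w})"
    using open_close by (auto intro: openin_open_Int)
  from openin_continuous_map_preimage[OF loc_cont this]
  have "openin (subtopology K ?B) {x \<in> topspace (subtopology K ?B). loc n x \<in> open_unit_disc n \<inter> {w. close n \<epsilon> z w}}" .
  then have "openin K {x \<in> topspace (subtopology K ?B). loc n x \<in> open_unit_disc n \<inter> {w. close n \<epsilon> z w}}"
    by (rule openin_trans_full) (rule base_open)
  then show ?thesis
    by (rule back_subst[of "openin K"]) (use active_space loc_in in auto)
qed

text \<open>The thresholds increase with \<open>n\<close>, which keeps the retraction of \<open>tame n\<close> to the cells of
  dimension \<open>n\<close> away from their boundaries.\<close>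

definition zone :: "nat \<Rightarrow> 'k set" where
  "zone n = {x \<in> topspace K. lower_threshold n < height (Suc n) x \<and>
    (\<forall>j<n. height (Suc j) x < upper_threshold j)}"

definition tame :: "nat \<Rightarrow> 'k set" where
  "tame n = {x \<in> topspace K. lower_threshold n \<le> height (Suc n) x \<and>
    height n x \<le> ratio n * height (Suc n) x}"

lemma zone_tame: "zone n \<subseteq> tame n"
proof
  fix x assume x: "x \<in> zone n"
  then have K: "x \<in> topspace K" and lo: "lower_threshold n < height (Suc n) x"
    by (auto simp: zone_def)
  have "height n x \<le> ratio n * height (Suc n) x"
  proof (cases n)
    case 0
    then show ?thesis using height_0[OF K] by (simp add: ratio_def)
  next
    case (Suc m)
    then have "height n x < upper_threshold m"
      using x by (auto simp: zone_def)
    also have "\<dots> = ratio n * lower_threshold n"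
      using Suc threshold_order(1)[of n] by (simp add: ratio_def)
    also have "\<dots> \<le> ratio n * height (Suc n) x"
      using lo ratio_bounds by (intro mult_left_mono) auto
    finally show ?thesis by simp
  qed
  then show "x \<in> tame n"
    using K lo by (auto simp: tame_def)
qed

lemma tame_active: "tame n \<subseteq> active n"
proof
  fix x assume x: "x \<in> tame n"
  then have "0 < height (Suc n) x"
    using threshold_order(1)[of n] by (auto simp: tame_def)
  then have "ratio n * height (Suc n) x < 1 * height (Suc n) x"
    using ratio_bounds by (intro mult_strict_right_mono) auto
  then show "x \<in> active n"
    using x by (auto simp: tame_def active_def)
qed

lemma tame_closed: "closedin K (tame n)"
proof -
  have "closedin K {x \<in> topspace K. height (Suc n) x \<in> {lower_threshold n..}}"
    by (rule closedin_continuous_map_preimage[OF height_cont]) auto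
  moreover have "closedin K {x \<in> topspace K. height n x - ratio n * height (Suc n) x \<in> {..0}}"
    by (rule closedin_continuous_map_preimage[where Y = euclideanreal],
      intro continuous_map_diff continuous_map_real_mult height_cont) auto
  ultimately have "closedin K ({x \<in> topspace K. height (Suc n) x \<in> {lower_threshold n..}} \<inter>
      {x \<in> topspace K. height n x - ratio n * height (Suc n) x \<in> {..0}})"
    by (rule closedin_Int)
  then show ?thesis
    by (rule back_subst[of "closedin K"]) (auto simp: tame_def)
qed

lemma zone_open: "openin K (zone n)"
proof -
  have "openin K {x \<in> topspace K. height (Suc n) x \<in> {lower_threshold n<..}}"
    by (rule openin_continuous_map_preimage[OF height_cont]) auto
  moreover have "openin K {x \<in> topspace K. height (Suc j) x \<in> {..<upper_threshold j}}" for j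
    by (rule openin_continuous_map_preimage[OF height_cont]) auto
  then have "openin K (topspace K \<inter> (\<Inter>j<n. {x \<in> topspace K. height (Suc j) x \<in> {..<upper_threshold j}}))"
    by (intro openin_Int_Inter[of "(\<lambda>j. {x \<in> topspace K. height (Suc j) x \<in> {..<upper_threshold j}}) ` {..<n}"])
      blast+
  ultimately have "openin K ({x \<in> topspace K. height (Suc n) x \<in> {lower_threshold n<..}} \<inter>
     (topspace K \<inter> (\<Inter>j<n. {x \<in> topspace K. height (Suc j) x \<in> {..<upper_threshold j}})))"
    by (rule openin_Int)
  then show ?thesis
    by (rule back_subst[of "openin K"]) (auto simp: zone_def)
qed

lemma zone_cover:
  assumes "x \<in> topspace K"
  obtains n where "x \<in> zone n"
proof -
  \<comment> \<open>The least dimension whose lower threshold is exceeded; for smaller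
    \<open>j\<close> the height is at most the lower threshold and so below the upper one.\<close>
  define n where "n = (LEAST n. lower_threshold n < height (Suc n) x)"
  have "height (Suc (d (cell x))) x = 1"
    by (rule height_skel) simp
  then have "lower_threshold (d (cell x)) < height (Suc (d (cell x))) x"
    using threshold_order(4) by simp
  then have "lower_threshold n < height (Suc n) x"
    unfolding n_def by (rule LeastI)
  moreover have "height (Suc j) x < upper_threshold j" if "j < n" for j
    using not_less_Least[of j "\<lambda>n. lower_threshold n < height (Suc n) x"] that threshold_order(2)[of j]
    by (simp add: n_def)
  ultimately show ?thesis
    using that assms by (auto simp: zone_def)
qed

text \<open>With \<open>N\<close> the dimension of the cell of \<open>x\<close>, the height for
  \<open>Suc N\<close> is 1 at \<open>x\<close>, hence above \<open>upper_threshold N\<close>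
  nearby, while every zone of larger index demands the opposite.\<close>

lemma zone_locally_finite:
  assumes "x \<in> topspace K"
  obtains O' N where "openin K O'" "x \<in> O'" "\<And>n. N < n \<Longrightarrow> O' \<inter> zone n = {}"
proof
  let ?N = "d (cell x)"
  let ?O = "{y \<in> topspace K. height (Suc ?N) y \<in> {upper_threshold ?N<..}}"
  show "openin K ?O"
    by (rule openin_continuous_map_preimage[OF height_cont]) auto
  have "height (Suc ?N) x = 1"
    by (rule height_skel) simp
  then show "x \<in> ?O"
    using threshold_order(5)[of ?N] assms by simp
  fix n assume "?N < n"
  then show "?O \<inter> zone n = {}"
    by (force simp: zone_def)
qed

section \<open>Compact cores, tolerances and the cover by pieces\<close>

text \<open>The region that contains the arrival coordinates of tame points. It is closed in the
  disc and avoids the boundary sphere, where the height is 1; its compactness yields positive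
  tolerances and finite nets.\<close>

definition core :: "'k set \<Rightarrow> (nat \<Rightarrow> real) set" where
  "core e = {w \<in> unit_disc (d e). height (d e) (\<Phi> e w) \<le> ratio (d e)}"

lemma core_open_disc:
  assumes "e \<in> E" "w \<in> core e"
  shows "w \<in> open_unit_disc (d e)"
proof (rule ccontr)
  assume "w \<notin> open_unit_disc (d e)"
  then have "w \<in> unit_sphere (d e)" using assms(2) by (auto simp: core_def unit_disc_eq)
  then have "height (d e) (\<Phi> e w) = 1"
    by (intro height_skel dim_less Phi_sphere assms(1))
  then show False
    using assms(2) ratio_bounds[of "d e"] by (simp add: core_def)
qed

lemma compact_core:
  assumes "e \<in> E"
  shows "compact (core e)"
proof -
  have "continuous_map (top_of_set (unit_disc (d e))) euclideanreal (height (d e) \<circ> \<Phi> e)"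
    by (rule continuous_map_compose[OF Phi_cont[OF assms] height_cont])
  then have "closedin (top_of_set (unit_disc (d e)))
      {w \<in> topspace (top_of_set (unit_disc (d e))). (height (d e) \<circ> \<Phi> e) w \<in> {..ratio (d e)}}"
    by (rule closedin_continuous_map_preimage) auto
  then have "closedin (top_of_set (unit_disc (d e))) (core e)"
    by (simp add: core_def)
  then show ?thesis
    using closedin_compact_eq[OF compact_unit_disc] by blast
qed

lemma loc_core:
  assumes "x \<in> tame n"
  shows "loc n x \<in> core (base n x)"
proof -
  have a: "x \<in> active n" using assms tame_active by auto
  note x = active_space[OF a] active_pos[OF a]
  have "height n (proj n x) \<le> ratio n"
    unfolding height_proj_le[OF x le_SucI[OF order_refl]]
    using assms x(2) by (simp add: tame_def pos_divide_le_eq)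
  then show ?thesis
    using loc_in[OF a] Phi_loc[OF a] dim_base[OF a] by (simp add: core_def unit_disc_eq)
qed

text \<open>Both heights get divided by \<open>height (Suc n) x \<le> 1\<close>: the lower bound
  becomes easier to meet, and the comparison of the two is homogeneous.\<close>

lemma tame_proj:
  assumes "x \<in> tame j" "j \<le> n"
  shows "proj n x \<in> tame j"
proof -
  have a: "x \<in> active j" using assms tame_active by auto
  note x = active_space[OF a] active_pos[OF a]
  have le: "height (Suc j) x \<le> height (Suc n) x"
    using height_mono[OF x(1)] assms(2) by simp
  then have pos: "0 < height (Suc n) x" using x(2) by simp
  have 1: "height (Suc n) x \<le> 1" using height_bounds[OF x(1)] by simp
  have "lower_threshold j \<le> height (Suc j) x" using assms by (simp add: tame_def)
  also have "\<dots> \<le> height (Suc j) x / height (Suc n) x"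
    using 1 pos x(2) by (simp add: field_simps)
  finally have "lower_threshold j \<le> height (Suc j) x / height (Suc n) x" .
  moreover have "height j x / height (Suc n) x \<le> ratio j * (height (Suc j) x / height (Suc n) x)"
    using assms pos by (simp add: tame_def field_simps)
  ultimately show ?thesis
    using height_proj_le[OF x(1) pos, of j] height_proj_le[OF x(1) pos, of "Suc j"] assms(2)
      proj_space[OF x(1) pos] by (simp add: tame_def)
qed

text \<open>Moving by less than \<open>\<epsilon>\<close> inside the cell \<open>e\<close> moves the coordinates in every relevant lower
  cell \<open>e'\<close> by less than the tolerance \<open>\<delta> e'\<close> already chosen there.\<close>

definition tolerance :: "('k set \<Rightarrow> real) \<Rightarrow> 'k set \<Rightarrow> real \<Rightarrow> bool" where
  "tolerance \<delta> e \<epsilon> \<longleftrightarrow> 0 < \<epsilon> \<and>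
    (\<forall>w w'. w \<in> core e \<and> (\<forall>i\<ge>d e. w' i = 0) \<and> close (d e) \<epsilon> w w' \<longrightarrow>
      w' \<in> open_unit_disc (d e) \<and>
      (\<forall>j<d e. \<Phi> e w \<in> tame j \<longrightarrow> \<Phi> e w' \<in> active j \<and> base j (\<Phi> e w') = base j (\<Phi> e w) \<and>
        close j (\<delta> (base j (\<Phi> e w))) (loc j (\<Phi> e w)) (loc j (\<Phi> e w'))))"

lemma tolerance_local:
  assumes e: "e \<in> E" and pos: "\<And>e'. e' \<in> E \<Longrightarrow> d e' < d e \<Longrightarrow> 0 < \<delta> e'" and w0: "w0 \<in> core e"
  shows "\<exists>\<epsilon>>0. \<forall>w w'. w \<in> core e \<and> (\<forall>i\<ge>d e. w' i = 0) \<and> close (d e) \<epsilon> w0 w \<and> close (d e) \<epsilon> w0 w' \<longrightarrow>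
      w' \<in> open_unit_disc (d e) \<and>
      (\<forall>j<d e. \<Phi> e w \<in> tame j \<longrightarrow> \<Phi> e w' \<in> active j \<and> base j (\<Phi> e w') = base j (\<Phi> e w) \<and>
        close j (\<delta> (base j (\<Phi> e w))) (loc j (\<Phi> e w)) (loc j (\<Phi> e w')))"
proof -
  let ?n = "d e"
  define B where "B j = base j (\<Phi> e w0)" for j
  \<comment> \<open>Half the tolerance, because \<open>w\<close> and \<open>w'\<close> are compared
    through \<open>w0\<close>. If the point of \<open>w0\<close> is not in the closed set
    \<open>tame j\<close>, neither are the points nearby, and the condition in dimension
    \<open>j\<close> is vacuous.\<close>
  define Q where "Q j = (if \<Phi> e w0 \<in> tame j
    then {y \<in> active j. base j y = B j \<and> close j (\<delta> (B j) / 2) (loc j (\<Phi> e w0)) (loc j y)}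
    else topspace K - tame j)" for j
  have w0o: "w0 \<in> open_unit_disc ?n" using core_open_disc[OF e w0] .
  then have w0d: "w0 \<in> unit_disc ?n" by (simp add: unit_disc_eq)
  have QK: "openin K (Q j)" for j
    unfolding Q_def using near_open tame_closed by auto
  have "\<Phi> e w0 \<in> Q j" if "j < ?n" for j
  proof (cases "\<Phi> e w0 \<in> tame j")
    case True
    then have a: "\<Phi> e w0 \<in> active j" using tame_active by auto
    then have "0 < \<delta> (B j)"
      using pos base_in dim_base that by (simp add: B_def)
    then show ?thesis
      using True a by (simp add: Q_def B_def close_refl)
  next
    case False
    then show ?thesis using Phi_space[OF e w0d] by (simp add: Q_def)
  qed
  then have mem: "w0 \<in> {w \<in> unit_disc ?n. \<Phi> e w \<in> Q j}" if "j < ?n" for j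
    using that w0d by simp
  have "openin (top_of_set (unit_disc ?n)) {w \<in> unit_disc ?n. \<Phi> e w \<in> Q j}" for j
    using openin_continuous_map_preimage[OF Phi_cont[OF e] QK] by simp
  then have "\<forall>j. \<exists>U. open U \<and> {w \<in> unit_disc ?n. \<Phi> e w \<in> Q j} = unit_disc ?n \<inter> U"
    unfolding openin_open by auto
  then obtain U where U: "\<And>j. open (U j)" "\<And>j. {w \<in> unit_disc ?n. \<Phi> e w \<in> Q j} = unit_disc ?n \<inter> U j"
    by metis
  let ?V = "{w. disc_norm ?n w < 1} \<inter> (\<Inter>j<?n. U j)"
  have "open {w::nat \<Rightarrow> real. disc_norm ?n w < 1}"
    by (intro open_Collect_less continuous_on_disc_norm continuous_on_const)
  then have "open ?V" using U by auto
  moreover have "w0 \<in> ?V"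
    using w0o mem U(2) by (auto simp: mem_open_unit_disc)
  moreover have "\<forall>i\<ge>?n. w0 i = 0"
    using w0o by (simp add: mem_open_unit_disc)
  ultimately have "\<exists>\<epsilon>>0. \<forall>w. (\<forall>i\<ge>?n. w i = 0) \<and> close ?n \<epsilon> w0 w \<longrightarrow> w \<in> ?V"
    unfolding close_def by (rule open_box)
  then obtain \<epsilon> where \<epsilon>: "\<epsilon> > 0" "\<And>w. \<forall>i\<ge>?n. w i = 0 \<Longrightarrow> close ?n \<epsilon> w0 w \<Longrightarrow> w \<in> ?V"
    by metis
  have "w' \<in> open_unit_disc ?n \<and>
      (\<forall>j<?n. \<Phi> e w \<in> tame j \<longrightarrow> \<Phi> e w' \<in> active j \<and> base j (\<Phi> e w') = base j (\<Phi> e w) \<and>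
        close j (\<delta> (base j (\<Phi> e w))) (loc j (\<Phi> e w)) (loc j (\<Phi> e w')))"
    if w: "w \<in> core e" and w': "\<forall>i\<ge>?n. w' i = 0" and c: "close ?n \<epsilon> w0 w" "close ?n \<epsilon> w0 w'" for w w'
  proof (intro conjI allI impI)
    have wd: "w \<in> unit_disc ?n" using w by (simp add: core_def)
    have wV: "w \<in> ?V" and w'V: "w' \<in> ?V"
      using \<epsilon>(2) c w' wd by (auto simp: mem_unit_disc)
    then show w'o: "w' \<in> open_unit_disc ?n" using w' by (simp add: mem_open_unit_disc)
    fix j assume j: "j < ?n" and t: "\<Phi> e w \<in> tame j"
    have "w' \<in> unit_disc ?n" using w'o by (simp add: unit_disc_eq)
    then have Qs: "\<Phi> e w \<in> Q j" "\<Phi> e w' \<in> Q j"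
      using wV w'V U(2)[of j] wd j by blast+
    then have t0: "\<Phi> e w0 \<in> tame j"
      using t by (auto simp: Q_def split: if_splits)
    have b: "base j (\<Phi> e w) = B j" and ac: "\<Phi> e w' \<in> active j" "base j (\<Phi> e w') = B j"
      using Qs t0 by (auto simp: Q_def)
    show "\<Phi> e w' \<in> active j" "base j (\<Phi> e w') = base j (\<Phi> e w)"
      using b ac by auto
    have "close j (\<delta> (B j) / 2) (loc j (\<Phi> e w)) (loc j (\<Phi> e w0))"
      "close j (\<delta> (B j) / 2) (loc j (\<Phi> e w0)) (loc j (\<Phi> e w'))"
      using Qs t0 close_sym by (auto simp: Q_def)
    from close_trans[OF this] show "close j (\<delta> (base j (\<Phi> e w))) (loc j (\<Phi> e w)) (loc j (\<Phi> e w'))"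
      using b by simp
  qed
  then show ?thesis
    using \<epsilon>(1) by blast
qed

text \<open>A Lebesgue number argument: the compact core is covered by finitely many boxes of half
  the local radius, and the smallest of the half radii serves for the whole core.\<close>

lemma tolerance_exists:
  assumes e: "e \<in> E" and pos: "\<And>e'. e' \<in> E \<Longrightarrow> d e' < d e \<Longrightarrow> 0 < \<delta> e'"
  shows "\<exists>\<epsilon>. tolerance \<delta> e \<epsilon>"
proof -
  let ?P = "\<lambda>w w'. w' \<in> open_unit_disc (d e) \<and>
      (\<forall>j<d e. \<Phi> e w \<in> tame j \<longrightarrow> \<Phi> e w' \<in> active j \<and> base j (\<Phi> e w') = base j (\<Phi> e w) \<and>
        close j (\<delta> (base j (\<Phi> e w))) (loc j (\<Phi> e w)) (loc j (\<Phi> e w')))"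
  have "\<forall>w0\<in>core e. \<exists>\<epsilon>>0. \<forall>w w'. w \<in> core e \<and> (\<forall>i\<ge>d e. w' i = 0) \<and> close (d e) \<epsilon> w0 w \<and>
      close (d e) \<epsilon> w0 w' \<longrightarrow> ?P w w'"
    by (intro ballI tolerance_local[OF e] pos)
  from bchoice[OF this] obtain r where "\<forall>w0\<in>core e. r w0 > 0 \<and> (\<forall>w w'. w \<in> core e \<and> (\<forall>i\<ge>d e. w' i = 0) \<and>
      close (d e) (r w0) w0 w \<and> close (d e) (r w0) w0 w' \<longrightarrow> ?P w w')"
    by (elim exE)
  then have r: "\<And>w0. w0 \<in> core e \<Longrightarrow> r w0 > 0"
    "\<And>w0 w w'. \<lbrakk>w0 \<in> core e; w \<in> core e; \<forall>i\<ge>d e. w' i = 0; close (d e) (r w0) w0 w; close (d e) (r w0) w0 w'\<rbrakk> \<Longrightarrow> ?P w w'"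
    by simp_all
  have "core e \<subseteq> (\<Union>w0\<in>core e. {w. close (d e) (r w0 / 2) w0 w})"
    using r(1) by (auto intro!: close_refl)
  then obtain F where F: "F \<subseteq> core e" "finite F" "core e \<subseteq> (\<Union>w0\<in>F. {w. close (d e) (r w0 / 2) w0 w})"
    by (rule compactE_image[OF compact_core[OF e] open_close])
  define \<epsilon> where "\<epsilon> = Min (insert 1 ((\<lambda>w. r w / 2) ` F))"
  have "0 < \<epsilon>"
    unfolding \<epsilon>_def using F r(1) by (subst Min_gr_iff) auto
  moreover have "?P w w'" if w: "w \<in> core e" "\<forall>i\<ge>d e. w' i = 0" "close (d e) \<epsilon> w w'" for w w'
  proof -
    obtain w0 where w0: "w0 \<in> F" "close (d e) (r w0 / 2) w0 w"
      using F(3) w(1) by blast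
    have "\<epsilon> \<le> r w0 / 2"
      unfolding \<epsilon>_def using F(2) w0(1) by (intro Min_le) auto
    then have "close (d e) (r w0) w0 w'"
      using close_trans[OF w0(2) close_mono[OF w(3), of "r w0 / 2"]] by simp
    moreover have "close (d e) (r w0) w0 w"
      by (rule close_mono[OF w0(2)]) (use r(1)[of w0] F(1) w0(1) in auto)
    ultimately show ?thesis
      using r(2) F(1) w0(1) w(1,2) by blast
  qed
  ultimately show ?thesis
    unfolding tolerance_def by blast
qed

text \<open>Well-founded recursion on the dimension is possible since
  \<open>tolerance \<delta> e\<close> evaluates \<delta> only at cells \<open>base j\<close> with
  \<open>j < d e\<close>, which have dimension \<open>j\<close> for tame points.\<close>

lemma tolerance_system: "\<exists>\<delta>. \<forall>e\<in>E. tolerance \<delta> e (\<delta> e)"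
proof -
  have "\<exists>\<delta>. \<forall>e. e \<in> E \<longrightarrow> tolerance \<delta> e (\<delta> e)"
  proof (rule dependent_wf_choice[where R = "Wellfounded.measure d"])
    fix f g :: "'k set \<Rightarrow> real" and e r
    assume eq: "\<And>z. (z, e) \<in> Wellfounded.measure d \<Longrightarrow> f z = g z"
    have "f (base j (\<Phi> e w)) = g (base j (\<Phi> e w))" if "j < d e" "\<Phi> e w \<in> tame j" for j w
    proof -
      have "d (base j (\<Phi> e w)) = j" using dim_base tame_active that(2) by blast
      then show ?thesis using eq that(1) by simp
    qed
    then show "(e \<in> E \<longrightarrow> tolerance f e r) = (e \<in> E \<longrightarrow> tolerance g e r)"
      unfolding tolerance_def by auto
  next
    fix e and f :: "'k set \<Rightarrow> real"
    assume "\<And>e'. (e', e) \<in> Wellfounded.measure d \<Longrightarrow> e' \<in> E \<longrightarrow> tolerance f e' (f e')"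
    then have "\<And>e'. e' \<in> E \<Longrightarrow> d e' < d e \<Longrightarrow> 0 < f e'"
      by (auto simp: tolerance_def)
    then show "\<exists>r. e \<in> E \<longrightarrow> tolerance f e r"
      using tolerance_exists by blast
  qed auto
  then show ?thesis by blast
qed

definition tol :: "'k set \<Rightarrow> real" where
  "tol = (SOME \<delta>. \<forall>e\<in>E. tolerance \<delta> e (\<delta> e))"

lemma tol: "e \<in> E \<Longrightarrow> tolerance tol e (tol e)"
  using someI_ex[OF tolerance_system] unfolding tol_def by blast

lemma tol_pos: "e \<in> E \<Longrightarrow> 0 < tol e"
  using tol[of e] by (simp add: tolerance_def)

text \<open>Centres of finitely many boxes of size \<open>tol e\<close> that cover the compact core;
  they index the pieces belonging to the cell \<open>e\<close>. Their finiteness keeps the cover by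
  pieces locally finite.\<close>

definition net :: "'k set \<Rightarrow> (nat \<Rightarrow> real) set" where
  "net e = (SOME F. finite F \<and> F \<subseteq> core e \<and> (\<forall>w\<in>core e. \<exists>z\<in>F. close (d e) (tol e) z w))"

lemma net:
  assumes "e \<in> E"
  shows "finite (net e)" "net e \<subseteq> core e" "\<And>w. w \<in> core e \<Longrightarrow> \<exists>z\<in>net e. close (d e) (tol e) z w"
proof -
  have "core e \<subseteq> (\<Union>w0\<in>core e. {w. close (d e) (tol e) w0 w})"
    using tol_pos[OF assms] by (auto intro!: close_refl)
  then obtain F where "F \<subseteq> core e" "finite F" "core e \<subseteq> (\<Union>w0\<in>F. {w. close (d e) (tol e) w0 w})"
    by (rule compactE_image[OF compact_core[OF assms] open_close])
  then have "finite F \<and> F \<subseteq> core e \<and> (\<forall>w\<in>core e. \<exists>z\<in>F. close (d e) (tol e) z w)"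
    by auto
  then have "finite (net e) \<and> net e \<subseteq> core e \<and> (\<forall>w\<in>core e. \<exists>z\<in>net e. close (d e) (tol e) z w)"
    unfolding net_def by (rule someI)
  then show "finite (net e)" "net e \<subseteq> core e" "\<And>w. w \<in> core e \<Longrightarrow> \<exists>z\<in>net e. close (d e) (tol e) z w"
    by simp_all
qed

definition pieces :: "('k set \<times> (nat \<Rightarrow> real)) set" where
  "pieces = Sigma E net"

definition piece :: "'k set \<times> (nat \<Rightarrow> real) \<Rightarrow> 'k set" where
  "piece p = {x \<in> zone (d (fst p)). base (d (fst p)) x = fst p \<and>
    close (d (fst p)) (tol (fst p)) (snd p) (loc (d (fst p)) x)}"

lemma piece_open: "openin K (piece p)"
proof -
  have "openin K (zone (d (fst p)) \<inter> {x \<in> active (d (fst p)). base (d (fst p)) x = fst p \<and>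
      close (d (fst p)) (tol (fst p)) (snd p) (loc (d (fst p)) x)})"
    by (intro openin_Int zone_open near_open)
  then show ?thesis
    by (rule back_subst[of "openin K"]) (use zone_tame tame_active in \<open>auto simp: piece_def\<close>)
qed

lemma piece_cover:
  assumes "x \<in> topspace K"
  shows "\<exists>p\<in>pieces. x \<in> piece p"
proof -
  obtain n where n: "x \<in> zone n" using zone_cover[OF assms] .
  then have t: "x \<in> tame n" and a: "x \<in> active n" using zone_tame tame_active by blast+
  obtain z where z: "z \<in> net (base n x)" "close (d (base n x)) (tol (base n x)) z (loc n x)"
    using net(3)[OF base_in[OF a] loc_core[OF t]] by blast
  then have "x \<in> piece (base n x, z)"
    using n dim_base[OF a] by (simp add: piece_def)
  moreover have "(base n x, z) \<in> pieces"
    using z base_in[OF a] by (simp add: pieces_def)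
  ultimately show ?thesis by blast
qed

text \<open>Near \<open>x\<close> only finitely many zones occur. In each of these dimensions either
  the cell of arrival is constant nearby or the zone is avoided, so that finitely many cells with
  their finite nets remain.\<close>

lemma piece_locally_finite:
  assumes x: "x \<in> topspace K"
  shows "\<exists>O'. openin K O' \<and> x \<in> O' \<and> finite {p \<in> pieces. piece p \<inter> O' \<noteq> {}}"
proof -
  obtain O1 N where O1: "openin K O1" "x \<in> O1" "\<And>n. N < n \<Longrightarrow> O1 \<inter> zone n = {}"
    using zone_locally_finite[OF x] by metis
  define Q where "Q n = (if x \<in> tame n then {y \<in> active n. base n y = base n x} else topspace K - tame n)" for n
  have Qo: "openin K (Q n)" for n
    unfolding Q_def using base_open tame_closed by auto
  have xQ: "x \<in> Q n" for n
    using tame_active x by (auto simp: Q_def)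
  have e: "fst p = base n x" if "p \<in> pieces" "y \<in> piece p" "y \<in> Q n" "d (fst p) = n" for p y n
  proof -
    have "y \<in> zone n" "base n y = fst p" using that by (auto simp: piece_def)
    then show ?thesis using that(3) zone_tame by (auto simp: Q_def split: if_splits)
  qed
  let ?O = "O1 \<inter> (\<Inter>n\<in>{..N}. Q n)"
  have "openin K ?O"
    by (rule openin_Int[OF O1(1) openin_INT2]) (use Qo in auto)
  moreover have "x \<in> ?O" using O1 xQ by auto
  moreover have "finite {p \<in> pieces. piece p \<inter> ?O \<noteq> {}}"
  proof (rule finite_subset)
    show "{p \<in> pieces. piece p \<inter> ?O \<noteq> {}} \<subseteq> Sigma ((\<lambda>n. base n x) ` {..N} \<inter> E) net"
    proof
      fix p assume p: "p \<in> {p \<in> pieces. piece p \<inter> ?O \<noteq> {}}"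
      then obtain y where y: "y \<in> piece p" "y \<in> O1" "\<And>n. n \<le> N \<Longrightarrow> y \<in> Q n" by auto
      let ?n = "d (fst p)"
      have "y \<in> zone ?n" using y by (simp add: piece_def)
      then have "?n \<le> N" using O1(3)[of ?n] y(2) by (auto simp: not_less[symmetric])
      then have "fst p = base ?n x" using e[of p y ?n] p y by auto
      then show "p \<in> Sigma ((\<lambda>n. base n x) ` {..N} \<inter> E) net"
        using p \<open>?n \<le> N\<close> unfolding pieces_def by (cases p) force
    qed
    show "finite (Sigma ((\<lambda>n. base n x) ` {..N} \<inter> E) net)"
      by (intro finite_SigmaI) (auto intro: net)
  qed
  ultimately show ?thesis by blast
qed


text \<open>For \<open>t \<le> 1/2\<close> the point \<open>p\<close> is moved along the flow towards \<open>proj n p\<close>, for \<open>t \<ge> 1/2\<close> from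
  there along a straight segment of the cell to the point with coordinates \<open>z\<close>.\<close>

definition blend :: "nat \<Rightarrow> (nat \<Rightarrow> real) \<Rightarrow> real \<Rightarrow> 'k \<Rightarrow> nat \<Rightarrow> real" where
  "blend n z t p = (\<lambda>i. (2 - 2 * t) * loc n p i + (2 * t - 1) * z i)"

definition step :: "nat \<Rightarrow> (nat \<Rightarrow> real) \<Rightarrow> real \<Rightarrow> 'k \<Rightarrow> 'k" where
  "step n z t p = (if t \<le> 1 / 2 then flow p ((1 - 2 * t) + 2 * t / height (Suc n) p)
    else \<Phi> (base n p) (blend n z t p))"

section \<open>Descent through the dimensions\<close>

primrec descend :: "(nat \<Rightarrow> real) \<Rightarrow> (nat \<Rightarrow> nat \<Rightarrow> real) \<Rightarrow> nat \<Rightarrow> 'k \<Rightarrow> 'k" where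
  "descend t z 0 p = p"
| "descend t z (Suc m) p = descend t z m (step m (z m) (t m) p)"

text \<open>\<open>J\<close> holds the dimensions in which a move is allowed, \<open>t n\<close>
  tells how far it goes, and \<open>z n\<close> is its target in the coordinates of the cell
  \<open>base n k\<close>. Targets are constrained only where \<open>t n\<close> is positive, as the
  weighted means used later make no sense where the mass vanishes.\<close>

definition compatible :: "nat set \<Rightarrow> (nat \<Rightarrow> real) \<Rightarrow> (nat \<Rightarrow> nat \<Rightarrow> real) \<Rightarrow> 'k \<Rightarrow> bool" where
  "compatible J t z k \<longleftrightarrow> k \<in> topspace K \<and> (\<forall>n\<in>J. k \<in> zone n) \<and>
    (\<forall>n. 0 \<le> t n \<and> t n \<le> 1 \<and> (0 < t n \<longrightarrow> n \<in> J \<and> (\<forall>i\<ge>n. z n i = 0) \<and>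
      close n (tol (base n k)) (loc n k) (z n)))"

text \<open>Invariant of the descent when only dimensions below \<open>m\<close> remain. The
  position \<open>q\<close> is compared with the reference point \<open>k\<close>, not with the
  preceding position.\<close>

definition follows :: "nat set \<Rightarrow> nat \<Rightarrow> 'k \<Rightarrow> 'k \<Rightarrow> bool" where
  "follows J m k q \<longleftrightarrow> q \<in> topspace K \<and> (\<forall>j\<in>J. j < m \<longrightarrow> q \<in> active j \<and> base j q = base j k \<and>
    close j (tol (base j k)) (loc j k) (loc j q))"

lemma zone_active: "x \<in> zone n \<Longrightarrow> x \<in> active n"
  using zone_tame tame_active by blast

lemma follows_refl: "compatible J t z k \<Longrightarrow> follows J m k k"
  by (simp add: compatible_def follows_def zone_active close_refl tol_pos base_in)

lemma step_0: "p \<in> topspace K \<Longrightarrow> step n z 0 p = p"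
  by (simp add: step_def flow_1)

lemma step_flow_factor:
  assumes "q \<in> active m" "0 \<le> t" "t \<le> 1 / 2"
  shows "1 \<le> (1 - 2 * t) + 2 * t / height (Suc m) q"
    "((1 - 2 * t) + 2 * t / height (Suc m) q) * height (Suc m) q \<le> 1"
proof -
  let ?h = "height (Suc m) q"
  have h: "0 < ?h" "?h \<le> 1"
    using active_pos[OF assms(1)] height_bounds[OF active_space[OF assms(1)]] by auto
  have "2 * t * 1 \<le> 2 * t * (1 / ?h)"
    using h assms(2) by (intro mult_left_mono) auto
  then show "1 \<le> (1 - 2 * t) + 2 * t / ?h" by simp
  have "((1 - 2 * t) + 2 * t / ?h) * ?h = (1 - 2 * t) * ?h + 2 * t"
    using h by (simp add: field_simps)
  also have "(1 - 2 * t) * ?h \<le> (1 - 2 * t) * 1"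
    using h assms(3) by (intro mult_left_mono) auto
  finally show "((1 - 2 * t) + 2 * t / ?h) * ?h \<le> 1" by simp
qed

text \<open>Both ends of the segment lie in the box of size \<open>tol (base m k)\<close> about
  \<open>loc m k\<close>, and boxes are convex.\<close>

lemma blend_close:
  assumes c: "compatible J t z k" and f: "follows J (Suc m) k q" and t: "1 / 2 \<le> t m"
  shows "m \<in> J" "q \<in> active m" "base m q = base m k" "\<forall>i\<ge>m. blend m (z m) (t m) q i = 0"
    "close m (tol (base m k)) (loc m k) (blend m (z m) (t m) q)"
proof -
  have t': "0 < t m" "t m \<le> 1" using t c by (auto simp: compatible_def)
  then show J: "m \<in> J" using c by (auto simp: compatible_def)
  then show a: "q \<in> active m" and "base m q = base m k" using f by (auto simp: follows_def)
  have z: "\<forall>i\<ge>m. z m i = 0" "close m (tol (base m k)) (loc m k) (z m)"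
    using c t' by (auto simp: compatible_def)
  show "\<forall>i\<ge>m. blend m (z m) (t m) q i = 0"
    using z(1) loc_in[OF a] by (simp add: blend_def mem_open_unit_disc)
  show "close m (tol (base m k)) (loc m k) (blend m (z m) (t m) q)"
    unfolding blend_def
    by (rule close_convex) (use z(2) f J t t' in \<open>auto simp: follows_def\<close>)
qed

text \<open>Here the tolerances do their work, with \<open>loc m k\<close> as the point of the core:
  it represents \<open>proj m k\<close>, whose data in the lower dimensions are those of
  \<open>k\<close>. The new lower coordinates are thus within the full original tolerance of
  \<open>k\<close>, with no loss from earlier steps.\<close>

lemma blend_disc:
  assumes c: "compatible J t z k" and f: "follows J (Suc m) k q" and t: "1 / 2 \<le> t m"
  shows "blend m (z m) (t m) q \<in> open_unit_disc m"
    "\<And>j. j < m \<Longrightarrow> j \<in> J \<Longrightarrow> let p = \<Phi> (base m k) (blend m (z m) (t m) q) in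
      p \<in> active j \<and> base j p = base j k \<and> close j (tol (base j k)) (loc j k) (loc j p)"
proof -
  note b = blend_close[OF c f t]
  have zone: "k \<in> zone j" if "j \<in> J" for j using c that by (auto simp: compatible_def)
  have k: "k \<in> active m" using zone_active zone b(1) by blast
  let ?e = "base m k"
  have e: "?e \<in> E" "d ?e = m" using base_in[OF k] dim_base[OF k] .
  have "loc m k \<in> core ?e"
    using loc_core zone[OF b(1)] zone_tame by blast
  then have T: "blend m (z m) (t m) q \<in> open_unit_disc m \<and>
      (\<forall>j<m. \<Phi> ?e (loc m k) \<in> tame j \<longrightarrow> \<Phi> ?e (blend m (z m) (t m) q) \<in> active j \<and>
        base j (\<Phi> ?e (blend m (z m) (t m) q)) = base j (\<Phi> ?e (loc m k)) \<and>
        close j (tol (base j (\<Phi> ?e (loc m k)))) (loc j (\<Phi> ?e (loc m k))) (loc j (\<Phi> ?e (blend m (z m) (t m) q))))"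
    using tol[OF e(1)] b(4,5) unfolding tolerance_def e(2) by blast
  then show "blend m (z m) (t m) q \<in> open_unit_disc m" by blast
  fix j assume j: "j < m" "j \<in> J"
  have kj: "k \<in> tame j" "k \<in> active j" using zone[OF j(2)] zone_tame tame_active by auto
  have "proj m k \<in> tame j" using tame_proj[OF kj(1)] j(1) by simp
  then show "let p = \<Phi> (base m k) (blend m (z m) (t m) q) in
      p \<in> active j \<and> base j p = base j k \<and> close j (tol (base j k)) (loc j k) (loc j p)"
    using T[unfolded Phi_loc[OF k], THEN conjunct2, rule_format, OF j(1)] active_proj(2,3)[OF kj(2), of m] j(1)
    by (simp add: Let_def)
qed

text \<open>The flow half leaves the data below dimension \<open>m\<close> unchanged, since it does
  not pass beyond the arrival in \<open>skel (Suc m)\<close>; the straight half is controlled by the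
  tolerances.\<close>

lemma step_follows:
  assumes c: "compatible J t z k" and f: "follows J (Suc m) k q"
  shows "follows J m k (step m (z m) (t m) q)"
proof -
  have q: "q \<in> topspace K" using f by (simp add: follows_def)
  have t: "0 \<le> t m" "t m \<le> 1" using c by (auto simp: compatible_def)
  consider "t m = 0" | "0 < t m" "t m \<le> 1 / 2" | "1 / 2 < t m" using t by linarith
  then show ?thesis
  proof cases
    case 1
    then show ?thesis using f step_0[OF q] by (simp add: follows_def)
  next
    case 2
    then have "m \<in> J" using c by (auto simp: compatible_def)
    then have a: "q \<in> active m" using f by (auto simp: follows_def)
    let ?t = "(1 - 2 * t m) + 2 * t m / height (Suc m) q"
    note T = step_flow_factor[OF a t(1) 2(2)]
    have s: "step m (z m) (t m) q = flow q ?t" using 2 by (simp add: step_def)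
    have "flow q ?t \<in> active j \<and> base j (flow q ?t) = base j k \<and> close j (tol (base j k)) (loc j k) (loc j (flow q ?t))"
      if j: "j \<in> J" "j < m" for j
    proof -
      have qj: "q \<in> active j" "base j q = base j k" "close j (tol (base j k)) (loc j k) (loc j q)"
        using f j by (auto simp: follows_def)
      have "?t * height (Suc j) q \<le> ?t * height (Suc m) q"
        using height_mono[OF q, of "Suc j" "Suc m"] j T(1) by (intro mult_left_mono) auto
      then have "?t * height (Suc j) q \<le> 1" using T(2) by simp
      from active_flow[OF qj(1) T(1) this] base_loc_flow[OF qj(1) T(1) this]
      show ?thesis using qj by simp
    qed
    then show ?thesis
      unfolding s using flow_space[OF q T(1)] by (simp add: follows_def)
  next
    case 3
    then have t2: "1 / 2 \<le> t m" by simp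
    note b = blend_close[OF c f t2] and bd = blend_disc[OF c f t2]
    have s: "step m (z m) (t m) q = \<Phi> (base m k) (blend m (z m) (t m) q)"
      using 3 b(3) by (simp add: step_def)
    have "\<Phi> (base m k) (blend m (z m) (t m) q) \<in> topspace K"
      using Phi_space[OF base_in[OF b(2)], of "blend m (z m) (t m) q"] bd(1) dim_base[OF b(2)] b(3)
      by (simp add: unit_disc_eq)
    then show ?thesis
      unfolding s follows_def using bd(2) by (simp add: Let_def)
  qed
qed

lemma descend_stable:
  assumes "\<And>n. N \<le> n \<Longrightarrow> t n = 0" "N \<le> M" "p \<in> topspace K"
  shows "descend t z M p = descend t z N p"
  using assms(2)
proof (induction M rule: dec_induct)
  case (step m)
  then show ?case
    using assms(1)[of m] step_0[OF assms(3)] by simp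
qed simp

text \<open>Steps with \<open>t n = 0\<close> are trivial, so every start above the last nonzero
  \<open>t n\<close> gives the same point; the least one removes the dependence on a bound.\<close>

definition blended :: "(nat \<Rightarrow> real) \<Rightarrow> (nat \<Rightarrow> nat \<Rightarrow> real) \<Rightarrow> 'k \<Rightarrow> 'k" where
  "blended t z p = descend t z (LEAST N. \<forall>n\<ge>N. t n = 0) p"

lemma blended_eq:
  assumes "\<And>n. M \<le> n \<Longrightarrow> t n = 0" "p \<in> topspace K"
  shows "blended t z p = descend t z M p"
proof -
  let ?N = "LEAST N. \<forall>n\<ge>N. t n = 0"
  have M: "\<forall>n\<ge>M. t n = 0" using assms(1) by blast
  have "\<forall>n\<ge>?N. t n = 0" by (rule LeastI[of "\<lambda>N. \<forall>n\<ge>N. t n = 0", OF M])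
  then have "\<And>n. ?N \<le> n \<Longrightarrow> t n = 0" by blast
  moreover have "?N \<le> M" by (rule Least_le[of "\<lambda>N. \<forall>n\<ge>N. t n = 0", OF M])
  ultimately have "descend t z M p = descend t z ?N p"
    by (rule descend_stable[OF _ _ assms(2)])
  then show ?thesis
    unfolding blended_def by (rule sym)
qed

lemma blended_zero: "k \<in> topspace K \<Longrightarrow> blended (\<lambda>n. 0) z k = k"
  by (subst blended_eq[of 0]) auto

text \<open>A weight equal to \<open>1\<close> makes the construction forget its starting point.\<close>

lemma descend_independent:
  assumes c: "compatible J t z k" "compatible J' t z k'" and n: "t n = 1" "base n k = base n k'"
    and "follows J M k q" "follows J' M k' q'" "n < M"
  shows "descend t z M q = descend t z M q'"
  using assms(5-7)
proof (induction M arbitrary: q q')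
  case (Suc m)
  show ?case
  proof (cases "m = n")
    case True
    have h: "1 / 2 \<le> t m" using n True by simp
    have "base m q = base m q'"
      using blend_close(3)[OF c(1) Suc.prems(1) h] blend_close(3)[OF c(2) Suc.prems(2) h] n True by simp
    \<comment> \<open>For \<open>t m = 1\<close> the coefficient of \<open>loc\<close> in
      \<open>blend\<close> is 0: both points land at the target in their common cell, and the rest
      of the descent is the same.\<close>
    then have "step m (z m) (t m) q = step m (z m) (t m) q'"
      using n True by (simp add: step_def blend_def)
    then show ?thesis by simp
  next
    case False
    then show ?thesis
      using Suc.IH[OF step_follows[OF c(1) Suc.prems(1)] step_follows[OF c(2) Suc.prems(2)]] Suc.prems(3)
      by simp
  qed
qed simp

lemma blended_independent:
  assumes c: "compatible J t z k" "compatible J' t z k'" and n: "t n = 1" "base n k = base n k'"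
    and M: "\<And>n. M \<le> n \<Longrightarrow> t n = 0"
  shows "blended t z k = blended t z k'"
proof -
  have "k \<in> topspace K" "k' \<in> topspace K" using c by (auto simp: compatible_def)
  moreover have "n < M" using M[of n] n(1) by (cases "n < M") auto
  ultimately show ?thesis
    using blended_eq[OF M] descend_independent[OF c n follows_refl[OF c(1)] follows_refl[OF c(2)], of M]
    by simp
qed

text \<open>Locally the cell of arrival is fixed, so one characteristic map suffices, and the halves
  agree at 1/2, where the flow has reached \<open>proj m\<close>. The targets enter only in the
  second half, hence their continuity is demanded only there.\<close>

lemma step_cont:
  assumes p: "continuous_map X K p" and a: "\<And>x. x \<in> topspace X \<Longrightarrow> p x \<in> active m"
    and t: "continuous_map X euclideanreal t" "\<And>x. x \<in> topspace X \<Longrightarrow> 0 \<le> t x \<and> t x \<le> 1"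
    and z: "\<And>i. continuous_map (subtopology X {x \<in> topspace X. 1 / 2 \<le> t x}) euclideanreal (\<lambda>x. z x i)"
    and disc: "\<And>x. x \<in> topspace X \<Longrightarrow> 1 / 2 \<le> t x \<Longrightarrow> blend m (z x) (t x) (p x) \<in> unit_disc m"
  shows "continuous_map X K (\<lambda>x. step m (z x) (t x) (p x))"
proof (rule continuous_map_locally)
  fix x0 assume x0: "x0 \<in> topspace X"
  let ?e = "base m (p x0)"
  let ?B = "{y \<in> active m. base m y = ?e}"
  let ?U = "{x \<in> topspace X. p x \<in> ?B}"
  have U: "openin X ?U" "x0 \<in> ?U"
    using openin_continuous_map_preimage[OF p base_open] a x0 by auto
  let ?X = "subtopology X ?U"
  have e: "?e \<in> E" "d ?e = m" using base_in dim_base a[OF x0] by auto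
  have tX: "continuous_map ?X euclideanreal t" and pX: "continuous_map ?X K p"
    using t(1) p by (auto intro: continuous_map_from_subtopology)
  have hX: "continuous_map ?X euclideanreal (\<lambda>x. height (Suc m) (p x))"
    using continuous_map_compose[OF pX height_cont] by (simp add: o_def)
  have "continuous_map ?X (subtopology K ?B) p"
    using pX by (auto simp: continuous_map_in_subtopology)
  from continuous_map_compose[OF this loc_cont]
  have lX: "continuous_map ?X (top_of_set (open_unit_disc m)) (\<lambda>x. loc m (p x))"
    by (simp add: o_def)
  have ne: "height (Suc m) (p x) \<noteq> 0" if "x \<in> topspace X" for x
    using active_pos[OF a[OF that]] by simp
  have "continuous_map ?X K (\<lambda>x. if t x \<le> 1 / 2
      then flow (p x) ((1 - 2 * t x) + 2 * t x / height (Suc m) (p x))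
      else \<Phi> ?e (blend m (z x) (t x) (p x)))"
  proof (rule continuous_map_cases_le[OF tX])
    let ?L = "subtopology ?X {x \<in> topspace ?X. t x \<le> 1 / 2}"
    let ?R = "subtopology ?X {x \<in> topspace ?X. 1 / 2 \<le> t x}"
    show "continuous_map ?L K (\<lambda>x. flow (p x) ((1 - 2 * t x) + 2 * t x / height (Suc m) (p x)))"
    proof (rule continuous_map_flow)
      show "continuous_map ?L K p" by (rule continuous_map_from_subtopology[OF pX])
      have "continuous_map ?L euclideanreal t" "continuous_map ?L euclideanreal (\<lambda>x. height (Suc m) (p x))"
        by (rule continuous_map_from_subtopology, fact)+
      then show "continuous_map ?L euclideanreal (\<lambda>x. (1 - 2 * t x) + 2 * t x / height (Suc m) (p x))"
        by (intro continuous_map_add continuous_map_diff continuous_map_real_mult continuous_map_real_divide)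
          (use ne in auto)
      show "1 \<le> (1 - 2 * t x) + 2 * t x / height (Suc m) (p x)" if "x \<in> topspace ?L" for x
        by (rule step_flow_factor(1)[OF a]) (use that t(2) in auto)
    qed
    have zR: "continuous_map ?R euclideanreal (\<lambda>x. z x i)" for i
    proof -
      have "?R = subtopology (subtopology X {x \<in> topspace X. 1 / 2 \<le> t x}) ?U"
        unfolding subtopology_subtopology by (rule arg_cong[where f = "subtopology X"]) auto
      then show ?thesis
        using continuous_map_from_subtopology[OF z] by simp
    qed
    have tR: "continuous_map ?R euclideanreal t"
      by (rule continuous_map_from_subtopology[OF tX])
    have lR: "continuous_map ?R euclideanreal (\<lambda>x. loc m (p x) i)" for i
      by (rule continuous_map_coord[OF continuous_map_from_subtopology[OF lX]])
    have "continuous_map ?R (top_of_set (unit_disc m)) (\<lambda>x. blend m (z x) (t x) (p x))"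
    proof (rule continuous_map_disc_intro)
      show "continuous_map ?R euclideanreal (\<lambda>x. blend m (z x) (t x) (p x) i)" for i
        unfolding blend_def
        by (intro continuous_map_add continuous_map_diff continuous_map_real_mult tR lR zR) auto
      show "blend m (z x) (t x) (p x) \<in> unit_disc m" if "x \<in> topspace ?R" for x
        by (rule disc) (use that in auto)
    qed
    from continuous_map_compose[OF this] Phi_cont[OF e(1)] e(2)
    show "continuous_map ?R K (\<lambda>x. \<Phi> ?e (blend m (z x) (t x) (p x)))"
      by (simp add: o_def)
    fix x assume x: "x \<in> topspace ?X" "t x = 1 / 2"
    have "p x \<in> active m" "base m (p x) = ?e" using x by auto
    then show "flow (p x) ((1 - 2 * t x) + 2 * t x / height (Suc m) (p x)) = \<Phi> ?e (blend m (z x) (t x) (p x))"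
      unfolding blend_def x(2) using Phi_loc[of "p x" m] by (simp add: proj_def)
  qed simp
  then have "continuous_map ?X K (\<lambda>x. step m (z x) (t x) (p x))"
    by (rule continuous_map_eq) (auto simp: step_def)
  then show "\<exists>U. openin X U \<and> x0 \<in> U \<and> continuous_map (subtopology X U) K (\<lambda>x. step m (z x) (t x) (p x))"
    using U by blast
qed

lemma descend_cont:
  assumes c: "\<And>x. x \<in> topspace X \<Longrightarrow> compatible J (\<lambda>n. t n x) (\<lambda>n. z n x) (k x)"
    and t: "\<And>n. continuous_map X euclideanreal (t n)"
    and z: "\<And>n i. continuous_map (subtopology X {x \<in> topspace X. 1 / 2 \<le> t n x}) euclideanreal (\<lambda>x. z n x i)"
    and "continuous_map X K q" "\<And>x. x \<in> topspace X \<Longrightarrow> follows J M (k x) (q x)"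
  shows "continuous_map X K (\<lambda>x. descend (\<lambda>n. t n x) (\<lambda>n. z n x) M (q x))"
  using assms(4,5)
proof (induction M arbitrary: q)
  case (Suc m)
  have tb: "0 \<le> t m x \<and> t m x \<le> 1" if "x \<in> topspace X" for x
    using c[OF that] by (auto simp: compatible_def)
  have "continuous_map X K (\<lambda>x. step m (z m x) (t m x) (q x))"
  proof (cases "m \<in> J")
    case True
    show ?thesis
    proof (rule step_cont[OF Suc.prems(1) _ t tb z])
      fix x assume x: "x \<in> topspace X"
      show "q x \<in> active m"
        using Suc.prems(2)[OF x] True by (auto simp: follows_def)
      show "blend m (z m x) (t m x) (q x) \<in> unit_disc m" if "1 / 2 \<le> t m x"
        using blend_disc(1)[OF c[OF x] Suc.prems(2)[OF x]] that by (simp add: unit_disc_eq)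
    qed
  next
    case False
    have "t m x = 0" if "x \<in> topspace X" for x
      using c[OF that] tb[OF that] False by (force simp: compatible_def)
    moreover have "q x \<in> topspace K" if "x \<in> topspace X" for x
      using Suc.prems(2)[OF that] by (simp add: follows_def)
    ultimately show ?thesis
      by (intro continuous_map_eq[OF Suc.prems(1)]) (simp add: step_0)
  qed
  then have "continuous_map X K (\<lambda>x. descend (\<lambda>n. t n x) (\<lambda>n. z n x) m (step m (z m x) (t m x) (q x)))"
    by (rule Suc.IH) (rule step_follows[OF c Suc.prems(2)])
  then show ?case by simp
qed simp

lemma blended_cont:
  assumes c: "\<And>x. x \<in> topspace X \<Longrightarrow> compatible J (\<lambda>n. t n x) (\<lambda>n. z n x) (k x)"
    and t: "\<And>n. continuous_map X euclideanreal (t n)"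
    and z: "\<And>n i. continuous_map (subtopology X {x \<in> topspace X. 1 / 2 \<le> t n x}) euclideanreal (\<lambda>x. z n x i)"
    and k: "continuous_map X K k" and J: "finite J"
  shows "continuous_map X K (\<lambda>x. blended (\<lambda>n. t n x) (\<lambda>n. z n x) (k x))"
proof -
  obtain M where "\<forall>n\<in>J. n < M"
    using J unfolding finite_nat_set_iff_bounded by (elim exE)
  then have M: "\<And>n. n \<in> J \<Longrightarrow> n < M" by simp
  have "continuous_map X K (\<lambda>x. descend (\<lambda>n. t n x) (\<lambda>n. z n x) M (k x))"
    by (rule descend_cont[OF c t z k]) (assumption, rule follows_refl[OF c])
  then show ?thesis
  proof (rule continuous_map_eq)
    fix x assume x: "x \<in> topspace X"
    have "t n x = 0" if "M \<le> n" for n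
    proof -
      have "n \<notin> J" using M[of n] that by auto
      then have "\<not> 0 < t n x" "0 \<le> t n x"
        using c[OF x] by (auto simp: compatible_def)
      then show ?thesis by simp
    qed
    moreover have "k x \<in> topspace K" using c[OF x] by (simp add: compatible_def)
    ultimately show "descend (\<lambda>n. t n x) (\<lambda>n. z n x) M (k x) = blended (\<lambda>n. t n x) (\<lambda>n. z n x) (k x)"
      by (rule blended_eq[symmetric])
  qed
qed

end

section \<open>Weights on the target of an \<open>\<omega>\<close>-map\<close>

lemma normal_space_shrink:
  assumes "normal_space X" "closedin X S" "openin X U" "S \<subseteq> U"
  obtains V where "openin X V" "S \<subseteq> V" "X closure_of V \<subseteq> U"
proof -
  have "\<exists>V. openin X V \<and> S \<subseteq> V \<and> X closure_of V \<subseteq> U"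
    using assms(1)[unfolded normal_space_alt, rule_format, of S U] assms(2-4) by simp
  then show thesis
    by (elim exE conjE) (rule that)
qed

text \<open>Zorn's lemma for partial shrinkings, encoded as single-valued relations; members outside
  the domain are left as they are. Point-finiteness passes the covering property on to unions of
  chains: the finitely many members at a point are shrunk by a single relation of the chain.\<close>

lemma shrink_point_finite_cover:
  assumes "normal_space Y" "open_cover Y \<G>"
    and fin: "\<And>y. y \<in> topspace Y \<Longrightarrow> finite {G \<in> \<G>. y \<in> G}"
  obtains S where "\<And>G. G \<in> \<G> \<Longrightarrow> openin Y (S G)" "\<And>G. G \<in> \<G> \<Longrightarrow> Y closure_of S G \<subseteq> G"
    "topspace Y \<subseteq> (\<Union>G\<in>\<G>. S G)"
proof -
  have opG: "\<And>G. G \<in> \<G> \<Longrightarrow> openin Y G" and cov: "\<Union>\<G> = topspace Y"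
    using assms(2) by (auto simp: open_cover_def)
  define \<R> where "\<R> = {R. (\<forall>(G, V)\<in>R. G \<in> \<G> \<and> openin Y V \<and> Y closure_of V \<subseteq> G) \<and> single_valued R \<and>
    topspace Y \<subseteq> \<Union>(snd ` R) \<union> \<Union>{G \<in> \<G>. G \<notin> Domain R}}"
  have "\<exists>M\<in>\<R>. \<forall>R\<in>\<R>. M \<subseteq> R \<longrightarrow> R = M"
  proof (rule subset_Zorn')
    fix \<C> assume ch: "subset.chain \<R> \<C>"
    then have sub: "\<C> \<subseteq> \<R>" and lin: "\<And>R R'. R \<in> \<C> \<Longrightarrow> R' \<in> \<C> \<Longrightarrow> R \<subseteq> R' \<or> R' \<subseteq> R"
      by (auto simp: subset_chain_def)
    have "single_valued (\<Union>\<C>)"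
    proof (rule single_valuedI)
      fix G V V' assume "(G, V) \<in> \<Union>\<C>" "(G, V') \<in> \<Union>\<C>"
      then obtain R R' where R: "R \<in> \<C>" "(G, V) \<in> R" "R' \<in> \<C>" "(G, V') \<in> R'" by blast
      then obtain Q where "Q \<in> \<C>" "(G, V) \<in> Q" "(G, V') \<in> Q" using lin[of R R'] by blast
      then show "V = V'" using sub unfolding \<R>_def by (auto dest: single_valuedD)
    qed
    moreover have "y \<in> \<Union>(snd ` \<Union>\<C>) \<union> \<Union>{G \<in> \<G>. G \<notin> Domain (\<Union>\<C>)}" if y: "y \<in> topspace Y" for y
    proof (cases "\<exists>G\<in>\<G>. y \<in> G \<and> G \<notin> Domain (\<Union>\<C>)")
      case True
      then obtain G where "G \<in> {G \<in> \<G>. G \<notin> Domain (\<Union>\<C>)}" "y \<in> G" by blast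
      then show ?thesis by (intro UnI2 UnionI)
    next
      case False
      let ?F = "{G \<in> \<G>. y \<in> G}"
      have "\<forall>G\<in>?F. \<exists>V. (G, V) \<in> \<Union>\<C>" using False by blast
      then obtain V where V: "\<forall>G\<in>?F. (G, V G) \<in> \<Union>\<C>" using bchoice[of ?F "\<lambda>G V. (G, V) \<in> \<Union>\<C>"] by blast
      obtain G0 where "G0 \<in> ?F" using cov y by blast
      then have "\<C> \<noteq> {}" using V by blast
      moreover have "finite ((\<lambda>G. (G, V G)) ` ?F)" using fin[OF y] by simp
      moreover have "(\<lambda>G. (G, V G)) ` ?F \<subseteq> \<Union>\<C>" using V by blast
      ultimately obtain R where R: "R \<in> \<C>" "(\<lambda>G. (G, V G)) ` ?F \<subseteq> R"
        using finite_subset_Union_chain[OF _ _ _ ch] by metis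
      have "R \<in> \<R>" using R(1) sub by blast
      then have "y \<in> \<Union>(snd ` R) \<union> \<Union>{G \<in> \<G>. G \<notin> Domain R}" using y by (auto simp: \<R>_def)
      moreover have "y \<notin> \<Union>{G \<in> \<G>. G \<notin> Domain R}" using R(2) by blast
      ultimately show ?thesis using R(1) by blast
    qed
    moreover have "\<forall>(G, V)\<in>\<Union>\<C>. G \<in> \<G> \<and> openin Y V \<and> Y closure_of V \<subseteq> G"
      using sub unfolding \<R>_def by blast
    ultimately show "\<Union>\<C> \<in> \<R>"
      unfolding \<R>_def mem_Collect_eq by (intro conjI subsetI)
  qed
  then obtain M where M: "M \<in> \<R>" and max: "\<And>R. R \<in> \<R> \<Longrightarrow> M \<subseteq> R \<Longrightarrow> R = M" by blast
  have Mp: "\<And>G V. (G, V) \<in> M \<Longrightarrow> G \<in> \<G> \<and> openin Y V \<and> Y closure_of V \<subseteq> G" and Ms: "single_valued M"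
    and Mc: "topspace Y \<subseteq> \<Union>(snd ` M) \<union> \<Union>{G \<in> \<G>. G \<notin> Domain M}"
    using M unfolding \<R>_def by auto
  have dom: "G \<in> Domain M" if G: "G \<in> \<G>" for G
  proof (rule ccontr)
    assume nG: "G \<notin> Domain M"
    \<comment> \<open>The points outside \<open>?W\<close> form a closed set inside
      \<open>G\<close>; shrinking \<open>G\<close> around it would enlarge the maximal
      relation.\<close>
    let ?W = "\<Union>(snd ` M) \<union> \<Union>{G' \<in> \<G>. G' \<notin> Domain M \<and> G' \<noteq> G}"
    have "openin Y ?W"
      by (intro openin_Un openin_Union) (use Mp opG in auto)
    then have "closedin Y (topspace Y - ?W)" by blast
    moreover have "topspace Y - ?W \<subseteq> G" using Mc by blast
    ultimately obtain V where V: "openin Y V" "topspace Y - ?W \<subseteq> V" "Y closure_of V \<subseteq> G"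
      by (rule normal_space_shrink[OF assms(1) _ opG[OF G]])
    have "single_valued (insert (G, V) M)"
      using Ms nG by (auto simp: single_valued_def)
    moreover have "topspace Y \<subseteq> \<Union>(snd ` insert (G, V) M) \<union> \<Union>{G' \<in> \<G>. G' \<notin> Domain (insert (G, V) M)}"
      using V(2) by auto
    moreover have "\<forall>p\<in>insert (G, V) M. fst p \<in> \<G> \<and> openin Y (snd p) \<and> Y closure_of (snd p) \<subseteq> fst p"
      using Mp V(1,3) G by (metis insert_iff prod.collapse fst_conv snd_conv)
    then have "\<forall>(G, V)\<in>insert (G, V) M. G \<in> \<G> \<and> openin Y V \<and> Y closure_of V \<subseteq> G"
      by (simp add: case_prod_beta')
    ultimately have "insert (G, V) M \<in> \<R>"
      unfolding \<R>_def mem_Collect_eq by (intro conjI)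
    then have "insert (G, V) M = M" using max by blast
    then show False using nG by blast
  qed
  have "\<forall>G\<in>\<G>. \<exists>V. (G, V) \<in> M" using dom by blast
  then obtain S where S: "\<forall>G\<in>\<G>. (G, S G) \<in> M" using bchoice[of \<G> "\<lambda>G V. (G, V) \<in> M"] by blast
  show thesis
  proof
    show "openin Y (S G)" "Y closure_of S G \<subseteq> G" if "G \<in> \<G>" for G
      using S Mp that by blast+
    show "topspace Y \<subseteq> (\<Union>G\<in>\<G>. S G)"
    proof
      fix y assume "y \<in> topspace Y"
      then obtain G V where GV: "(G, V) \<in> M" "y \<in> V" using Mc dom by force
      then have "G \<in> \<G>" using Mp by blast
      then have "S G = V" using S GV(1) Ms by (auto dest: single_valuedD)
      then show "y \<in> (\<Union>G\<in>\<G>. S G)" using GV(2) \<open>G \<in> \<G>\<close> by blast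
    qed
  qed
qed

text \<open>Convexity of an interval; points of weight 0 drop out of the mean, so no bound on them
  is assumed.\<close>

lemma weighted_mean_close:
  fixes \<mu> z :: "'a \<Rightarrow> real"
  assumes "finite S" "\<And>G. G \<in> S \<Longrightarrow> 0 \<le> \<mu> G" "0 < (\<Sum>G\<in>S. \<mu> G)" "\<And>G. G \<in> S \<Longrightarrow> 0 < \<mu> G \<Longrightarrow> \<bar>a - z G\<bar> < \<epsilon>"
  shows "\<bar>a - (\<Sum>G\<in>S. \<mu> G * z G) / (\<Sum>G\<in>S. \<mu> G)\<bar> < \<epsilon>"
proof -
  let ?m = "\<Sum>G\<in>S. \<mu> G"
  have "a - (\<Sum>G\<in>S. \<mu> G * z G) / ?m = (\<Sum>G\<in>S. \<mu> G * (a - z G)) / ?m"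
    using assms(3) by (simp add: right_diff_distrib sum_subtractf flip: sum_distrib_right)
      (simp add: field_simps)
  then have "\<bar>a - (\<Sum>G\<in>S. \<mu> G * z G) / ?m\<bar> = \<bar>\<Sum>G\<in>S. \<mu> G * (a - z G)\<bar> / ?m"
    using assms(3) by (simp add: abs_divide)
  also have "\<dots> < \<epsilon>"
  proof -
    have "\<bar>\<Sum>G\<in>S. \<mu> G * (a - z G)\<bar> \<le> (\<Sum>G\<in>S. \<bar>\<mu> G * (a - z G)\<bar>)"
      by (rule sum_abs)
    also have "\<dots> < (\<Sum>G\<in>S. \<mu> G * \<epsilon>)"
    proof (rule sum_strict_mono_ex1[OF assms(1)])
      show "\<forall>G\<in>S. \<bar>\<mu> G * (a - z G)\<bar> \<le> \<mu> G * \<epsilon>"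
      proof
        fix G assume G: "G \<in> S"
        show "\<bar>\<mu> G * (a - z G)\<bar> \<le> \<mu> G * \<epsilon>"
        proof (cases "\<mu> G = 0")
          case False
          then have "0 < \<mu> G" using assms(2)[OF G] by simp
          then show ?thesis using assms(4)[OF G] by (simp add: abs_mult)
        qed simp
      qed
      have "\<exists>G\<in>S. 0 < \<mu> G"
      proof (rule ccontr)
        assume "\<not> ?thesis"
        then have "(\<Sum>G\<in>S. \<mu> G) \<le> 0" by (intro sum_nonpos) auto
        then show False using assms(3) by simp
      qed
      then obtain G where "G \<in> S" "0 < \<mu> G" by blast
      then show "\<exists>G\<in>S. \<bar>\<mu> G * (a - z G)\<bar> < \<mu> G * \<epsilon>"
        using assms(4) by (intro bexI[of _ G]) (simp_all add: abs_mult)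
    qed
    finally show ?thesis
      using assms(3) by (simp add: pos_divide_less_eq sum_distrib_left mult.commute)
  qed
  finally show ?thesis .
qed

text \<open>The sets in \<open>\<T>\<close> are those whose preimage is carried into a piece of \<open>K\<close>; \<open>\<pi>\<close> selects it.\<close>

locale CW_weights = CW K E d \<Phi>
  for K :: "'k topology" and E :: "'k set set" and d :: "'k set \<Rightarrow> nat"
    and \<Phi> :: "'k set \<Rightarrow> (nat \<Rightarrow> real) \<Rightarrow> 'k" +
  fixes Y :: "'b topology" and \<G> :: "'b set set" and C :: "'b set \<Rightarrow> 'b set"
    and \<mu> :: "'b set \<Rightarrow> 'b \<Rightarrow> real" and \<T> :: "'b set set" and \<pi> :: "'b set \<Rightarrow> 'k set \<times> (nat \<Rightarrow> real)"
  assumes C_closed: "G \<in> \<G> \<Longrightarrow> closedin Y (C G)"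
    and C_locally_finite: "y \<in> topspace Y \<Longrightarrow> \<exists>O'. openin Y O' \<and> y \<in> O' \<and> finite {G \<in> \<G>. C G \<inter> O' \<noteq> {}}"
    and mu_cont: "G \<in> \<G> \<Longrightarrow> continuous_map Y euclideanreal (\<mu> G)"
    and mu_nonneg: "G \<in> \<G> \<Longrightarrow> y \<in> topspace Y \<Longrightarrow> 0 \<le> \<mu> G y"
    and mu_support: "G \<in> \<G> \<Longrightarrow> y \<in> topspace Y \<Longrightarrow> y \<notin> C G \<Longrightarrow> \<mu> G y = 0"
    and mu_one: "y \<in> topspace Y \<Longrightarrow> \<exists>G\<in>\<G>. \<mu> G y = 1"
    and pi_pieces: "G \<in> \<T> \<Longrightarrow> \<pi> G \<in> pieces"
begin

section \<open>The map into \<open>K\<close> defined by the weights\<close>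

definition act :: "'b \<Rightarrow> 'b set set" where
  "act y = {G \<in> \<G>. y \<in> C G}"

definition level :: "'b set \<Rightarrow> nat" where
  "level G = d (fst (\<pi> G))"

definition mass :: "nat \<Rightarrow> 'b \<Rightarrow> real" where
  "mass n y = (\<Sum>G\<in>{G \<in> act y. level G = n}. \<mu> G y)"

definition weight :: "nat \<Rightarrow> 'b \<Rightarrow> real" where
  "weight n y = min 1 (2 * mass n y)"

text \<open>The mean is sensible over valid points: there all active sets of level \<open>n\<close>
  refer to the same cell \<open>base n k\<close>. Where the mass is 0 the value is a by-product of
  division by zero, and the step in dimension \<open>n\<close> is trivial.\<close>

definition center :: "nat \<Rightarrow> 'b \<Rightarrow> nat \<Rightarrow> real" where
  "center n y = (\<lambda>i. (\<Sum>G\<in>{G \<in> act y. level G = n}. \<mu> G y * snd (\<pi> G) i) / mass n y)"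

text \<open>\<open>k\<close> can serve as the start of the descent over \<open>y\<close>. The
  condition concerns active sets only, hence passes to points with fewer of them; this makes
  \<open>good\<close> open.\<close>

definition valid :: "'b \<Rightarrow> 'k \<Rightarrow> bool" where
  "valid y k \<longleftrightarrow> act y \<subseteq> \<T> \<and> k \<in> topspace K \<and> (\<forall>G\<in>act y. k \<in> piece (\<pi> G))"

definition good :: "'b set" where
  "good = {y \<in> topspace Y. \<exists>k. valid y k}"

definition \<psi> :: "'b \<Rightarrow> 'k" where
  "\<psi> y = blended (\<lambda>n. weight n y) (\<lambda>n. center n y) (SOME k. valid y k)"

text \<open>Near \<open>y\<close> only finitely many of the closed sets \<open>C G\<close> occur,
  and those that miss \<open>y\<close> can be cut away.\<close>

lemma act_upper:
  assumes "y \<in> topspace Y"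
  obtains O' where "openin Y O'" "y \<in> O'" "\<And>y'. y' \<in> O' \<Longrightarrow> act y' \<subseteq> act y"
proof -
  obtain Q where Q: "openin Y Q" "y \<in> Q" "finite {G \<in> \<G>. C G \<inter> Q \<noteq> {}}"
    using C_locally_finite[OF assms] by blast
  let ?A = "{G \<in> \<G>. C G \<inter> Q \<noteq> {} \<and> y \<notin> C G}"
  have "finite ?A" by (rule finite_subset[OF _ Q(3)]) auto
  then have "closedin Y (\<Union>G\<in>?A. C G)"
    using C_closed by (intro closedin_Union) auto
  then have "openin Y (Q - (\<Union>G\<in>?A. C G))" by (intro openin_diff Q(1))
  moreover have "y \<in> Q - (\<Union>G\<in>?A. C G)" using Q(2) by blast
  moreover have "act y' \<subseteq> act y" if "y' \<in> Q - (\<Union>G\<in>?A. C G)" for y'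
    using that unfolding act_def by blast
  ultimately show thesis by (rule that)
qed

lemma act_finite:
  assumes "y \<in> topspace Y"
  shows "finite (act y)"
proof -
  obtain Q where Q: "y \<in> Q" "finite {G \<in> \<G>. C G \<inter> Q \<noteq> {}}"
    using C_locally_finite[OF assms] by blast
  show ?thesis
    by (rule finite_subset[OF _ Q(2)]) (use Q(1) in \<open>auto simp: act_def\<close>)
qed

lemma sum_act:
  assumes "y \<in> topspace Y" "finite T" "act y \<subseteq> T" "T \<subseteq> \<G>"
  shows "(\<Sum>G\<in>{G \<in> act y. level G = n}. \<mu> G y * c G) = (\<Sum>G\<in>{G \<in> T. level G = n}. \<mu> G y * c G)"
proof (rule sum.mono_neutral_left)
  show "\<forall>G\<in>{G \<in> T. level G = n} - {G \<in> act y. level G = n}. \<mu> G y * c G = 0"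
    using assms mu_support[of _ y] by (auto simp: act_def)
qed (use assms in auto)

lemma sum_cont: "continuous_map Y euclideanreal (\<lambda>y. \<Sum>G\<in>{G \<in> act y. level G = n}. \<mu> G y * c G)"
proof (rule continuous_map_locally)
  fix y0 assume y0: "y0 \<in> topspace Y"
  obtain Q where Q: "openin Y Q" "y0 \<in> Q" "\<And>y'. y' \<in> Q \<Longrightarrow> act y' \<subseteq> act y0"
    using act_upper[OF y0] by blast
  have "finite {G \<in> act y0. level G = n}"
    using act_finite[OF y0] by simp
  then have "continuous_map Y euclideanreal (\<lambda>y. \<Sum>G\<in>{G \<in> act y0. level G = n}. \<mu> G y * c G)"
    by (intro continuous_map_sum continuous_map_real_mult mu_cont) (auto simp: act_def)
  then have "continuous_map (subtopology Y Q) euclideanreal (\<lambda>y. \<Sum>G\<in>{G \<in> act y0. level G = n}. \<mu> G y * c G)"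
    by (rule continuous_map_from_subtopology)
  then have "continuous_map (subtopology Y Q) euclideanreal (\<lambda>y. \<Sum>G\<in>{G \<in> act y. level G = n}. \<mu> G y * c G)"
  proof (rule continuous_map_eq)
    fix y assume "y \<in> topspace (subtopology Y Q)"
    then show "(\<Sum>G\<in>{G \<in> act y0. level G = n}. \<mu> G y * c G) = (\<Sum>G\<in>{G \<in> act y. level G = n}. \<mu> G y * c G)"
      by (intro sum_act[symmetric] act_finite[OF y0] Q(3)) (auto simp: act_def)
  qed
  then show "\<exists>U. openin Y U \<and> y0 \<in> U \<and> continuous_map (subtopology Y U) euclideanreal
      (\<lambda>y. \<Sum>G\<in>{G \<in> act y. level G = n}. \<mu> G y * c G)"
    using Q by blast
qed

lemma mass_cont: "continuous_map Y euclideanreal (mass n)"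
  using sum_cont[of "\<lambda>_. 1" n] by (simp add: mass_def[abs_def])

lemma mass_nonneg: "y \<in> topspace Y \<Longrightarrow> 0 \<le> mass n y"
  unfolding mass_def by (rule sum_nonneg) (auto simp: act_def intro: mu_nonneg)

lemma weight_cont: "continuous_map Y euclideanreal (weight n)"
  unfolding weight_def[abs_def] by (intro continuous_map_real_min continuous_map_real_mult mass_cont) auto

lemma weight_bounds: "y \<in> topspace Y \<Longrightarrow> 0 \<le> weight n y \<and> weight n y \<le> 1"
  using mass_nonneg[of y n] by (auto simp: weight_def)

lemma center_cont:
  assumes "continuous_map X Y f" "\<And>x. x \<in> topspace X \<Longrightarrow> 0 < mass n (f x)"
  shows "continuous_map X euclideanreal (\<lambda>x. center n (f x) i)"
proof -
  have "mass n (f x) \<noteq> 0" if "x \<in> topspace X" for x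
    using assms(2)[OF that] by simp
  then show ?thesis
    unfolding center_def
    using continuous_map_compose[OF assms(1) sum_cont[of "\<lambda>G. snd (\<pi> G) i" n]]
      continuous_map_compose[OF assms(1) mass_cont[of n]]
    by (intro continuous_map_real_divide) (simp_all add: o_def)
qed

text \<open>\<open>T\<close> may exceed the active sets of \<open>y\<close>, so that one set of
  levels serves a whole neighbourhood; \<open>s\<close> is the homotopy parameter. The centre is
  close to \<open>loc n k\<close> because \<open>k\<close> lies in all the pieces whose net points
  are averaged.\<close>

lemma compatible_weights:
  assumes y: "y \<in> topspace Y" and T: "act y \<subseteq> T" "T \<subseteq> \<T>" and k: "k \<in> topspace K" "\<And>G. G \<in> T \<Longrightarrow> k \<in> piece (\<pi> G)"
    and s: "0 \<le> s" "s \<le> 1"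
  shows "compatible (level ` T) (\<lambda>n. s * weight n y) (\<lambda>n. center n y) k"
  unfolding compatible_def
proof (intro conjI ballI allI impI)
  show "k \<in> topspace K" by fact
  show "k \<in> zone n" if "n \<in> level ` T" for n
    using that k(2) by (auto simp: piece_def level_def)
  fix n
  show "0 \<le> s * weight n y" "s * weight n y \<le> 1"
    using weight_bounds[OF y, of n] s by (auto intro: mult_le_one)
  assume "0 < s * weight n y"
  then have "weight n y \<noteq> 0" by auto
  then have pos: "0 < mass n y"
    using mass_nonneg[OF y, of n] by (auto simp: weight_def)
  let ?S = "{G \<in> act y. level G = n}"
  have S: "G \<in> T" "k \<in> piece (\<pi> G)" "G \<in> \<T>" if "G \<in> ?S" for G
    using that T k(2) by auto
  have "?S \<noteq> {}" using pos unfolding mass_def by (metis less_irrefl sum.empty)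
  then show "n \<in> level ` T" using S(1) by blast
  have z: "snd (\<pi> G) i = 0" if "G \<in> ?S" "n \<le> i" for G i
  proof -
    have "\<pi> G \<in> pieces" using pi_pieces S(3)[OF that(1)] .
    then have p: "fst (\<pi> G) \<in> E" "snd (\<pi> G) \<in> net (fst (\<pi> G))" unfolding pieces_def by auto
    then have "snd (\<pi> G) \<in> core (fst (\<pi> G))" using net(2) by blast
    then show ?thesis using that by (auto simp: core_def mem_unit_disc level_def)
  qed
  show "center n y i = 0" if "n \<le> i" for i
    unfolding center_def using z that by simp
  show "close n (tol (base n k)) (loc n k) (center n y)"
    unfolding close_def
  proof (intro allI impI)
    fix i assume i: "i < n"
    show "\<bar>loc n k i - center n y i\<bar> < tol (base n k)"
      unfolding center_def mass_def
    proof (rule weighted_mean_close)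
      show "finite ?S" using act_finite[OF y] by simp
      show "0 < sum (\<lambda>G. \<mu> G y) ?S" using pos by (simp add: mass_def)
      show "0 \<le> \<mu> G y" if "G \<in> ?S" for G
        using that y by (auto simp: act_def intro: mu_nonneg)
      show "\<bar>loc n k i - snd (\<pi> G) i\<bar> < tol (base n k)" if "G \<in> ?S" for G
        using S(2)[OF that] that i by (auto simp: piece_def level_def close_def abs_minus_commute)
    qed
  qed
qed

lemma weight_one:
  assumes "y \<in> topspace Y"
  obtains G where "G \<in> act y" "weight (level G) y = 1"
proof -
  obtain G where G: "G \<in> \<G>" "\<mu> G y = 1" using mu_one[OF assms] by blast
  then have a: "G \<in> act y" using mu_support[OF G(1) assms] by (auto simp: act_def)
  have "finite {G' \<in> act y. level G' = level G}"
    using act_finite[OF assms] by simp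
  then have "\<mu> G y \<le> mass (level G) y"
    unfolding mass_def using a assms
    by (intro member_le_sum[where f = "\<lambda>G. \<mu> G y"]) (auto simp: act_def intro: mu_nonneg)
  then have "weight (level G) y = 1" using G(2) by (simp add: weight_def)
  then show thesis using a that by blast
qed

text \<open>Some weight equals 1, and in that dimension all valid starts have the same cell of
  arrival, that of the assigned piece; so the descent forgets its start. Hence the choice in the
  definition of \<psi> is immaterial.\<close>

lemma blended_valid:
  assumes y: "y \<in> topspace Y" and "valid y k" "valid y k'"
  shows "blended (\<lambda>n. weight n y) (\<lambda>n. center n y) k = blended (\<lambda>n. weight n y) (\<lambda>n. center n y) k'"
proof -
  have c: "compatible (level ` act y) (\<lambda>n. weight n y) (\<lambda>n. center n y) k" if "valid y k" for k
    using compatible_weights[OF y order_refl, of k 1] that by (simp add: valid_def)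
  obtain G where G: "G \<in> act y" "weight (level G) y = 1" using weight_one[OF y] .
  have b: "base (level G) k = fst (\<pi> G)" if "valid y k" for k
    using that G(1) by (auto simp: valid_def piece_def level_def)
  have "finite (level ` act y)" using act_finite[OF y] by simp
  then obtain M where "\<forall>n\<in>level ` act y. n < M"
    unfolding finite_nat_set_iff_bounded by (elim exE)
  then have M: "\<And>n. n \<in> level ` act y \<Longrightarrow> n < M" by (rule bspec)
  have "weight n y = 0" if "M \<le> n" for n
  proof -
    have "n \<notin> level ` act y" using M[of n] that by auto
    then have "\<not> 0 < weight n y" using c[OF assms(2)] by (auto simp: compatible_def)
    then show ?thesis using weight_bounds[OF y, of n] by simp
  qed
  moreover have "base (level G) k = base (level G) k'"
    using b assms(2,3) by simp
  ultimately show ?thesis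
    using blended_independent[OF c[OF assms(2)] c[OF assms(3)] G(2)] by blast
qed

lemma psi_eq:
  assumes "y \<in> topspace Y" "valid y k"
  shows "\<psi> y = blended (\<lambda>n. weight n y) (\<lambda>n. center n y) k"
  unfolding \<psi>_def by (rule blended_valid[OF assms(1) someI assms(2)]) (rule assms(2))

text \<open>Serves two ends: with \<open>s = 1\<close> and constant \<open>k\<close> it gives
  continuity of \<psi>, with \<open>k\<close> the given map and variable \<open>s\<close> it gives
  the homotopy. The active sets at \<open>x0\<close> fix a finite set of levels for all points
  nearby.\<close>

lemma blended_weights_cont:
  assumes f: "continuous_map X Y f" and s: "continuous_map X euclideanreal s" "\<And>x. x \<in> topspace X \<Longrightarrow> 0 \<le> s x \<and> s x \<le> 1"
    and k: "continuous_map X K k" and v: "\<And>x. x \<in> topspace X \<Longrightarrow> valid (f x) (k x)"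
  shows "continuous_map X K (\<lambda>x. blended (\<lambda>n. s x * weight n (f x)) (\<lambda>n. center n (f x)) (k x))"
proof (rule continuous_map_locally)
  fix x0 assume x0: "x0 \<in> topspace X"
  let ?T = "act (f x0)"
  have fY: "f x \<in> topspace Y" if "x \<in> topspace X" for x
    using continuous_map_image_subset_topspace[OF f] that by auto
  obtain Q where Q: "openin Y Q" "f x0 \<in> Q" "\<And>y'. y' \<in> Q \<Longrightarrow> act y' \<subseteq> ?T"
    using act_upper[OF fY[OF x0]] by blast
  have T: "finite ?T" "?T \<subseteq> \<T>" using act_finite[OF fY[OF x0]] v[OF x0] by (auto simp: valid_def)
  let ?P = "topspace K \<inter> \<Inter>((\<lambda>G. piece (\<pi> G)) ` ?T)"
  have P: "openin K ?P"
    by (rule openin_Int_Inter) (use T(1) in \<open>auto intro: piece_open\<close>)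
  let ?U = "{x \<in> topspace X. f x \<in> Q} \<inter> {x \<in> topspace X. k x \<in> ?P}"
  have U: "openin X ?U"
    by (intro openin_Int openin_continuous_map_preimage[OF f Q(1)] openin_continuous_map_preimage[OF k P])
  have "x0 \<in> ?U" using x0 Q(2) v[OF x0] by (auto simp: valid_def)
  let ?X = "subtopology X ?U"
  have fX: "continuous_map ?X Y f" "continuous_map ?X euclideanreal s" "continuous_map ?X K k"
    using f s(1) k by (auto intro: continuous_map_from_subtopology)
  have "continuous_map ?X K (\<lambda>x. blended (\<lambda>n. s x * weight n (f x)) (\<lambda>n. center n (f x)) (k x))"
  proof (rule blended_cont)
    show "compatible (level ` ?T) (\<lambda>n. s x * weight n (f x)) (\<lambda>n. center n (f x)) (k x)" if "x \<in> topspace ?X" for x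
      by (rule compatible_weights) (use that Q(3) T(2) s(2) fY in auto)
    show w: "continuous_map ?X euclideanreal (\<lambda>x. s x * weight n (f x))" for n
      using continuous_map_compose[OF fX(1) weight_cont[of n]]
      by (intro continuous_map_real_mult fX(2)) (simp add: o_def)
    show "continuous_map (subtopology ?X {x \<in> topspace ?X. 1 / 2 \<le> s x * weight n (f x)}) euclideanreal
        (\<lambda>x. center n (f x) i)" for n i
    proof (rule center_cont)
      show "continuous_map (subtopology ?X {x \<in> topspace ?X. 1 / 2 \<le> s x * weight n (f x)}) Y f"
        by (rule continuous_map_from_subtopology[OF fX(1)])
      fix x assume "x \<in> topspace (subtopology ?X {x \<in> topspace ?X. 1 / 2 \<le> s x * weight n (f x)})"
      then have x: "x \<in> topspace X" "1 / 2 \<le> s x * weight n (f x)" by auto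
      then have "weight n (f x) \<noteq> 0" by auto
      then show "0 < mass n (f x)"
        using mass_nonneg[OF fY[OF x(1)], of n] by (auto simp: weight_def)
    qed
    show "continuous_map ?X K k" by fact
    show "finite (level ` ?T)" using T(1) by simp
  qed
  then show "\<exists>U. openin X U \<and> x0 \<in> U \<and> continuous_map (subtopology X U) K
      (\<lambda>x. blended (\<lambda>n. s x * weight n (f x)) (\<lambda>n. center n (f x)) (k x))"
    using U \<open>x0 \<in> ?U\<close> by blast
qed

lemma good_nbhd:
  assumes "y \<in> good"
  obtains Q k where "openin Y Q" "y \<in> Q" "\<And>y'. y' \<in> Q \<Longrightarrow> valid y' k"
proof -
  have y: "y \<in> topspace Y" using assms by (simp add: good_def)
  obtain k where k: "valid y k" using assms by (auto simp: good_def)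
  obtain Q where Q: "openin Y Q" "y \<in> Q" "\<And>y'. y' \<in> Q \<Longrightarrow> act y' \<subseteq> act y"
    using act_upper[OF y] by blast
  have "valid y' k" if "y' \<in> Q" for y'
    using k Q(3)[OF that] by (auto simp: valid_def)
  then show thesis using that Q(1,2) by blast
qed

lemma good_open: "openin Y good"
proof (subst openin_subopen, rule ballI)
  fix y assume "y \<in> good"
  then obtain Q k where "openin Y Q" "y \<in> Q" "\<And>y'. y' \<in> Q \<Longrightarrow> valid y' k"
    using good_nbhd by blast
  then show "\<exists>T. openin Y T \<and> y \<in> T \<and> T \<subseteq> good"
    using openin_subset[of Y Q] by (auto simp: good_def)
qed

lemma psi_cont: "continuous_map (subtopology Y good) K \<psi>"
proof (rule continuous_map_locally)
  fix y assume "y \<in> topspace (subtopology Y good)"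
  then have y: "y \<in> good" by simp
  then obtain Q k where Q: "openin Y Q" "y \<in> Q" "\<And>y'. y' \<in> Q \<Longrightarrow> valid y' k"
    using good_nbhd by blast
  have Qg: "Q \<subseteq> good" using Q(1,3) openin_subset[of Y Q] by (auto simp: good_def)
  \<comment> \<open>A single \<open>k\<close> is valid throughout \<open>Q\<close>, so \<psi> can be
    computed there from a constant start.\<close>
  have "continuous_map (subtopology Y Q) K (\<lambda>x. blended (\<lambda>n. 1 * weight n x) (\<lambda>n. center n x) k)"
    by (rule blended_weights_cont)
      (use Q(3) Q(3)[OF Q(2)] in \<open>auto simp: valid_def continuous_map_from_subtopology\<close>)
  then have "continuous_map (subtopology Y Q) K \<psi>"
    by (rule continuous_map_eq) (simp add: psi_eq[OF _ Q(3)])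
  moreover have "subtopology (subtopology Y good) Q = subtopology Y Q"
    using Qg by (simp add: subtopology_subtopology Int_absorb1)
  moreover have "openin (subtopology Y good) Q"
    using Q(1) Qg by (simp add: openin_open_subtopology[OF good_open])
  ultimately show "\<exists>U. openin (subtopology Y good) U \<and> y \<in> U \<and> continuous_map (subtopology (subtopology Y good) U) K \<psi>"
    using Q(2) by auto
qed

end

section \<open>Extension of the given map\<close>

lemma Urysohn_real:
  assumes "normal_space X" "closedin X S" "closedin X T" "S \<inter> T = {}"
  obtains f where "continuous_map X euclideanreal f" "\<And>x. x \<in> topspace X \<Longrightarrow> 0 \<le> f x \<and> f x \<le> 1"
    "\<And>x. x \<in> S \<Longrightarrow> f x = (0::real)" "\<And>x. x \<in> T \<Longrightarrow> f x = 1"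
proof -
  obtain f where f: "continuous_map X (top_of_set {0..1::real}) f" "f ` S \<subseteq> {0}" "f ` T \<subseteq> {1}"
    by (rule Urysohn_lemma[OF assms(1-3), of 0 1]) (use assms(4) in \<open>auto simp: disjnt_def\<close>)
  have "0 \<le> f x \<and> f x \<le> 1" if "x \<in> topspace X" for x
    using continuous_map_image_subset_topspace[OF f(1)] that by auto
  moreover have "continuous_map X euclideanreal f"
    using f(1) by (simp add: continuous_map_in_subtopology)
  moreover have "f x = 0" if "x \<in> S" for x using f(2) that by auto
  moreover have "f x = 1" if "x \<in> T" for x using f(3) that by auto
  ultimately show thesis
    by (intro that[of f]) auto
qed

context CW
begin

lemma extension_of_weights:
  fixes X :: "'a topology" and Y :: "'b topology"
  assumes W: "CW_weights K E d \<Phi> Y \<G> C \<mu> \<T> \<pi>"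
    and C_sub: "\<And>G. G \<in> \<G> \<Longrightarrow> C G \<subseteq> G" and G_open: "\<And>G. G \<in> \<G> \<Longrightarrow> openin Y G"
    and X: "normal_space X" and Y: "Y \<in> alpha K" and \<phi>: "continuous_map X Y \<phi>"
    and A: "closedin X A" "A \<subseteq> V" and V: "openin X V" "V \<subseteq> N" and N: "closedin X N"
    and g: "continuous_map (subtopology X N) K g"
    and piece: "\<And>G x. G \<in> \<G> \<Longrightarrow> x \<in> N \<Longrightarrow> \<phi> x \<in> G \<Longrightarrow>
      G \<in> \<T> \<and> (\<forall>x'\<in>topspace X. \<phi> x' \<in> G \<longrightarrow> x' \<in> N \<longrightarrow> g x' \<in> piece (\<pi> G))"
  shows "\<exists>h. continuous_map X K h \<and> (\<forall>x\<in>A. h x = g x)"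
proof -
  interpret W: CW_weights K E d \<Phi> Y \<G> C \<mu> \<T> \<pi> by (rule W)
  have NX: "N \<subseteq> topspace X" using closedin_subset[OF N] .
  have \<phi>Y: "\<phi> x \<in> topspace Y" if "x \<in> topspace X" for x
    using continuous_map_image_subset_topspace[OF \<phi>] that by auto
  have gK: "g x \<in> topspace K" if "x \<in> N" for x
    using continuous_map_image_subset_topspace[OF g] that NX by auto
  have act_valid: "W.valid y (g x)" if "x \<in> N" "\<And>G. G \<in> W.act y \<Longrightarrow> \<phi> x \<in> G" for x y
    unfolding W.valid_def
  proof (intro conjI ballI subsetI)
    fix G assume G: "G \<in> W.act y"
    then have "G \<in> \<G>" by (simp add: W.act_def)
    from piece[OF this that(1) that(2)[OF G]]
    show "G \<in> \<T>" "g x \<in> piece (\<pi> G)"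
      using that NX G by auto
  qed (rule gK[OF that(1)])
  have valid: "W.valid (\<phi> x) (g x)" if "x \<in> N" for x
    by (rule act_valid[OF that]) (use C_sub in \<open>auto simp: W.act_def\<close>)
  define B where "B = Y closure_of (\<phi> ` N)"
  have B_good: "B \<subseteq> W.good"
  proof
    fix y assume y: "y \<in> B"
    then have yY: "y \<in> topspace Y" by (simp add: B_def in_closure_of)
    \<comment> \<open>The open sets \<open>G\<close>, not the closed \<open>C G\<close>, are
      intersected: this gives a neighbourhood of \<open>y\<close>, which meets the image of
      \<open>N\<close>, and any \<open>x\<close> in \<open>N\<close> found in this way supplies the
      valid start \<open>g x\<close>.\<close>
    let ?Q = "topspace Y \<inter> \<Inter>(W.act y)"
    have "openin Y ?Q"
      by (rule openin_Int_Inter) (use W.act_finite[OF yY] G_open in \<open>auto simp: W.act_def\<close>)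
    moreover have "y \<in> ?Q" using yY C_sub by (auto simp: W.act_def)
    ultimately obtain y' where "y' \<in> \<phi> ` N" "y' \<in> ?Q"
      using y unfolding B_def in_closure_of by blast
    then obtain x where "x \<in> N" "\<phi> x \<in> ?Q" by blast
    then have "W.valid y (g x)" by (intro act_valid) auto
    then show "y \<in> W.good" using yY by (auto simp: W.good_def)
  qed
  have B: "closedin Y B" by (simp add: B_def)
  have "continuous_map (subtopology Y B) K W.\<psi>"
    by (rule continuous_map_from_subtopology_mono[OF W.psi_cont B_good])
  moreover have "W.good \<subseteq> topspace Y" "B \<subseteq> Y interior_of W.good"
    using openin_subset[OF W.good_open] B_good interior_of_openin[OF W.good_open] by auto
  ultimately obtain h where h: "continuous_map Y K h" "\<And>y. y \<in> B \<Longrightarrow> h y = W.\<psi> y"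
    using Y B W.psi_cont unfolding alpha_def mem_Collect_eq by metis
  have h\<phi>: "h (\<phi> x) = blended (\<lambda>n. W.weight n (\<phi> x)) (\<lambda>n. W.center n (\<phi> x)) (g x)" if "x \<in> N" for x
  proof -
    have "\<phi> x \<in> B"
      unfolding B_def using closure_of_subset[of "\<phi> ` N" Y] \<phi>Y NX that by blast
    then show ?thesis
      using h(2) W.psi_eq[OF _ valid[OF that]] \<phi>Y NX that by auto
  qed
  obtain u where u: "continuous_map X euclideanreal u" "\<And>x. x \<in> topspace X \<Longrightarrow> 0 \<le> u x \<and> u x \<le> 1"
    "\<And>x. x \<in> A \<Longrightarrow> u x = (0::real)" "\<And>x. x \<in> topspace X - V \<Longrightarrow> u x = 1"
    by (rule Urysohn_real[OF X A(1), of "topspace X - V"]) (use V(1) A(2) in auto)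
  \<comment> \<open>On \<open>A\<close> all weights are turned off and the value is
    \<open>g x\<close>; on \<open>N\<close> outside \<open>V\<close> the weights are complete and
    the value is \<open>h (\<phi> x)\<close>. The closed sets \<open>N\<close> and
    \<open>topspace X - V\<close> cover \<open>X\<close> because \<open>V\<close> lies in
    \<open>N\<close>.\<close>
  let ?r = "\<lambda>x. blended (\<lambda>n. u x * W.weight n (\<phi> x)) (\<lambda>n. W.center n (\<phi> x)) (g x)"
  have r: "continuous_map (subtopology X N) K ?r"
    by (rule W.blended_weights_cont)
      (use \<phi> u(1,2) g valid in \<open>auto intro: continuous_map_from_subtopology\<close>)
  let ?f = "\<lambda>x. if x \<in> N then ?r x else h (\<phi> x)"
  have "continuous_map X K ?f"
  proof (rule pasting_lemma_closed[where I = "{True, False}" and T = "\<lambda>b. if b then N else topspace X - V"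
        and f = "\<lambda>b. if b then ?r else (\<lambda>x. h (\<phi> x))"])
    have "continuous_map (subtopology X (topspace X - V)) K (\<lambda>x. h (\<phi> x))"
      using continuous_map_from_subtopology[OF continuous_map_compose[OF \<phi> h(1)]] by (simp add: o_def)
    then show "continuous_map (subtopology X (if b then N else topspace X - V)) K (if b then ?r else (\<lambda>x. h (\<phi> x)))" for b
      using r by simp
    have "?r x = h (\<phi> x)" if "x \<in> N" "x \<in> topspace X - V" for x
      using h\<phi>[OF that(1)] u(4)[OF that(2)] by simp
    then show "(if i then ?r else (\<lambda>x. h (\<phi> x))) x = (if j then ?r else (\<lambda>x. h (\<phi> x))) x"
      if "x \<in> topspace X \<inter> (if i then N else topspace X - V) \<inter> (if j then N else topspace X - V)" for i j x
      using that by (cases i; cases j) auto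
    show "\<exists>j. j \<in> {True, False} \<and> x \<in> (if j then N else topspace X - V) \<and>
        ?f x = (if j then ?r else (\<lambda>x. h (\<phi> x))) x" if "x \<in> topspace X" for x
      using that V(2) by (cases "x \<in> N") auto
  qed (use N V(1) in auto)
  moreover have "?f x = g x" if "x \<in> A" for x
  proof -
    have "x \<in> N" using that A(2) V(2) by blast
    then show ?thesis using u(3)[OF that] blended_zero[OF gK] by simp
  qed
  ultimately show ?thesis by blast
qed

lemma extension_from_omega_map:
  fixes X :: "'a topology"
  assumes X: "normal_space X"
    and hyp: "\<And>\<omega>. open_cover X \<omega> \<Longrightarrow> locally_finite_in X \<omega> \<Longrightarrow>
           \<exists>(Y :: 'b topology) f. paracompact_space Y \<and> Y \<in> alpha K \<and> omega_map \<omega> X Y f"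
    and A: "closedin X A" and O': "openin X O'" "A \<subseteq> O'" and g: "continuous_map (subtopology X O') K g"
  shows "\<exists>h. continuous_map X K h \<and> (\<forall>x\<in>A. h x = g x)"
proof -
  have O'X: "O' \<subseteq> topspace X" using openin_subset[OF O'(1)] .
  have gK: "g x \<in> topspace K" if "x \<in> O'" for x
    using continuous_map_image_subset_topspace[OF g] that O'X by auto
  obtain V0 where V0: "openin X V0" "A \<subseteq> V0" "X closure_of V0 \<subseteq> O'"
    by (rule normal_space_shrink[OF X A O'])
  obtain V where V: "openin X V" "A \<subseteq> V" "X closure_of V \<subseteq> V0"
    by (rule normal_space_shrink[OF X A V0(1,2)])
  let ?N = "X closure_of V"
  have V0sub: "V0 \<subseteq> X closure_of V0" "V \<subseteq> ?N"
    using V0(1) V(1) by (auto intro!: closure_of_subset dest: openin_subset)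
  have preim: "openin X {x \<in> O'. g x \<in> S}" if "openin K S" for S
  proof -
    have "openin (subtopology X O') {x \<in> topspace (subtopology X O'). g x \<in> S}"
      by (rule openin_continuous_map_preimage[OF g that])
    then have "openin X {x \<in> topspace (subtopology X O'). g x \<in> S}"
      by (rule openin_trans_full) (rule O'(1))
    then show ?thesis
      by (rule back_subst[of "openin X"]) (use O'X in auto)
  qed
  \<comment> \<open>The closure of \<open>V0\<close> still lies in the domain of \<open>g\<close>,
    so the cut by \<open>V0\<close> keeps these sets locally finite in all of \<open>X\<close>:
    points outside that closure have a neighbourhood meeting none of them.\<close>
  define P where "P p = V0 \<inter> {x \<in> O'. g x \<in> piece p}" for p
  have Pop: "openin X (P p)" for p
    unfolding P_def by (intro openin_Int V0(1) preim piece_open)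
  define \<omega> where "\<omega> = insert (topspace X - ?N) (P ` pieces)"
  have "x \<in> \<Union>\<omega>" if x: "x \<in> topspace X" for x
  proof (cases "x \<in> ?N")
    case True
    then have "x \<in> V0" "x \<in> O'" using V(3) V0sub V0(3) by auto
    moreover obtain p where "p \<in> pieces" "g x \<in> piece p"
      using piece_cover[OF gK[OF \<open>x \<in> O'\<close>]] by blast
    ultimately show ?thesis by (auto simp: \<omega>_def P_def)
  qed (use x in \<open>simp add: \<omega>_def\<close>)
  moreover have \<omega>_open: "openin X U" if "U \<in> \<omega>" for U
    using that unfolding \<omega>_def by (auto intro: Pop)
  ultimately have cov: "open_cover X \<omega>"
    unfolding open_cover_def using openin_subset[OF \<omega>_open] by blast
  have "locally_finite_in X \<omega>"
    unfolding locally_finite_in_def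
  proof (intro conjI ballI)
    show "\<Union>\<omega> \<subseteq> topspace X" using cov by (simp add: open_cover_def)
    fix x assume x: "x \<in> topspace X"
    have "\<exists>Q. openin X Q \<and> x \<in> Q \<and> finite {p \<in> pieces. P p \<inter> Q \<noteq> {}}"
    proof (cases "x \<in> X closure_of V0")
      case True
      then have xO: "x \<in> O'" using V0(3) by auto
      obtain R where R: "openin K R" "g x \<in> R" "finite {p \<in> pieces. piece p \<inter> R \<noteq> {}}"
        using piece_locally_finite[OF gK[OF xO]] by blast
      have "{p \<in> pieces. P p \<inter> {x \<in> O'. g x \<in> R} \<noteq> {}} \<subseteq> {p \<in> pieces. piece p \<inter> R \<noteq> {}}"
        by (auto simp: P_def)
      from finite_subset[OF this R(3)] show ?thesis
        using preim[OF R(1)] R(2) xO by (intro exI[of _ "{x \<in> O'. g x \<in> R}"]) simp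
    next
      case False
      have e: "{p \<in> pieces. P p \<inter> (topspace X - X closure_of V0) \<noteq> {}} = {}"
        using V0sub by (auto simp: P_def)
      show ?thesis
        using False x by (intro exI[of _ "topspace X - X closure_of V0"] conjI openin_diff
            openin_topspace closedin_closure_of) (auto simp only: e)
    qed
    then obtain Q where Q: "openin X Q" "x \<in> Q" "finite {p \<in> pieces. P p \<inter> Q \<noteq> {}}" by blast
    have "{U \<in> \<omega>. U \<inter> Q \<noteq> {}} \<subseteq> insert (topspace X - ?N) (P ` {p \<in> pieces. P p \<inter> Q \<noteq> {}})"
      by (auto simp: \<omega>_def)
    then have "finite {U \<in> \<omega>. U \<inter> Q \<noteq> {}}"
      by (rule finite_subset) (use Q(3) in simp)
    then show "\<exists>V. openin X V \<and> x \<in> V \<and> finite {U \<in> \<omega>. U \<inter> V \<noteq> {}}"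
      using Q by blast
  qed
  then obtain Y :: "'b topology" and \<phi> where Y: "paracompact_space Y" "Y \<in> alpha K" "omega_map \<omega> X Y \<phi>"
    using hyp[OF cov] by blast
  have Yn: "normal_space Y" using Y(2) by (simp add: alpha_def)
  obtain \<gamma> where \<phi>: "continuous_map X Y \<phi>" and \<gamma>: "open_cover Y \<gamma>"
    "refines ((\<lambda>G. {x \<in> topspace X. \<phi> x \<in> G}) ` \<gamma>) \<omega>"
    using Y(3) unfolding omega_map_def by blast
  obtain \<G> where \<G>: "open_cover Y \<G>" "refines \<G> \<gamma>" "locally_finite_in Y \<G>"
    using Y(1) \<gamma>(1) unfolding paracompact_space_def by blast
  have G_open: "openin Y G" if "G \<in> \<G>" for G
    using \<G>(1) that by (auto simp: open_cover_def)
  have lf: "\<exists>Q. openin Y Q \<and> y \<in> Q \<and> finite {G \<in> \<G>. G \<inter> Q \<noteq> {}}" if "y \<in> topspace Y" for y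
    using \<G>(3) that unfolding locally_finite_in_def by blast
  have pf: "finite {G \<in> \<G>. y \<in> G}" if y: "y \<in> topspace Y" for y
  proof -
    obtain Q where "y \<in> Q" "finite {G \<in> \<G>. G \<inter> Q \<noteq> {}}" using lf[OF y] by blast
    then show ?thesis by (elim finite_subset[rotated]) auto
  qed
  obtain S where S: "\<And>G. G \<in> \<G> \<Longrightarrow> openin Y (S G)" "\<And>G. G \<in> \<G> \<Longrightarrow> Y closure_of S G \<subseteq> G"
    "topspace Y \<subseteq> (\<Union>G\<in>\<G>. S G)"
    by (rule shrink_point_finite_cover[OF Yn \<G>(1)], rule pf, assumption, rule that)
  have "\<exists>R m. closedin Y R \<and> R \<subseteq> G \<and> continuous_map Y euclideanreal m \<and>
      (\<forall>y\<in>topspace Y. 0 \<le> m y \<and> m y \<le> 1) \<and> (\<forall>y\<in>topspace Y - R. m y = (0::real)) \<and> (\<forall>y\<in>S G. m y = 1)"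
    if G: "G \<in> \<G>" for G
  proof -
    \<comment> \<open>An intermediate open set: \<open>m\<close> is 1 on the closure of
      \<open>S G\<close> and vanishes off \<open>R\<close>, so the closure of \<open>R\<close> is a
      closed set inside \<open>G\<close> off which \<open>m\<close> is 0. As the sets
      \<open>S G\<close> cover \<open>Y\<close>, some function equals 1 at each point.\<close>
    obtain R where R: "openin Y R" "Y closure_of S G \<subseteq> R" "Y closure_of R \<subseteq> G"
      by (rule normal_space_shrink[OF Yn closedin_closure_of G_open[OF G] S(2)[OF G]])
    obtain m where m: "continuous_map Y euclideanreal m" "\<And>y. y \<in> topspace Y \<Longrightarrow> 0 \<le> m y \<and> m y \<le> 1"
      "\<And>y. y \<in> topspace Y - R \<Longrightarrow> m y = (0::real)" "\<And>y. y \<in> Y closure_of S G \<Longrightarrow> m y = 1"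
      by (rule Urysohn_real[OF Yn closedin_diff[OF closedin_topspace R(1)] closedin_closure_of]) (use R(2) in auto)
    have "R \<subseteq> Y closure_of R" "S G \<subseteq> Y closure_of S G"
      using R(1) S(1)[OF G] by (auto intro!: closure_of_subset dest: openin_subset)
    then have "\<forall>y\<in>topspace Y - Y closure_of R. m y = 0" "\<forall>y\<in>S G. m y = 1"
      using m(3,4) by blast+
    then show ?thesis
      using R(3) m(1,2) by (intro exI[of _ "Y closure_of R"] exI[of _ m]) simp
  qed
  then have "\<forall>G\<in>\<G>. \<exists>q. closedin Y (fst q) \<and> fst q \<subseteq> G \<and> continuous_map Y euclideanreal (snd q) \<and>
      (\<forall>y\<in>topspace Y. 0 \<le> snd q y \<and> snd q y \<le> 1) \<and> (\<forall>y\<in>topspace Y - fst q. snd q y = (0::real)) \<and>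
      (\<forall>y\<in>S G. snd q y = 1)"
    by simp
  from bchoice[OF this] obtain q where q: "\<forall>G\<in>\<G>. closedin Y (fst (q G)) \<and> fst (q G) \<subseteq> G \<and>
      continuous_map Y euclideanreal (snd (q G)) \<and> (\<forall>y\<in>topspace Y. 0 \<le> snd (q G) y \<and> snd (q G) y \<le> 1) \<and>
      (\<forall>y\<in>topspace Y - fst (q G). snd (q G) y = (0::real)) \<and> (\<forall>y\<in>S G. snd (q G) y = 1)"
    by (elim exE)
  define C where "C G = fst (q G)" for G
  define \<mu> where "\<mu> G = snd (q G)" for G
  define \<T> where "\<T> = {G. \<exists>p\<in>pieces. {x \<in> topspace X. \<phi> x \<in> G} \<subseteq> P p}"
  define \<pi> where "\<pi> G = (SOME p. p \<in> pieces \<and> {x \<in> topspace X. \<phi> x \<in> G} \<subseteq> P p)" for G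
  have \<pi>: "\<pi> G \<in> pieces \<and> {x \<in> topspace X. \<phi> x \<in> G} \<subseteq> P (\<pi> G)" if "G \<in> \<T>" for G
  proof -
    have "\<exists>p. p \<in> pieces \<and> {x \<in> topspace X. \<phi> x \<in> G} \<subseteq> P p" using that by (auto simp: \<T>_def)
    then show ?thesis unfolding \<pi>_def by (rule someI_ex)
  qed
  have C: "closedin Y (C G)" "C G \<subseteq> G" if "G \<in> \<G>" for G
    using q that by (auto simp: C_def)
  show ?thesis
  proof (rule extension_of_weights[OF _ C(2) G_open X Y(2) \<phi> A V(2,1) V0sub(2) closedin_closure_of])
    show "CW_weights K E d \<Phi> Y \<G> C \<mu> \<T> \<pi>"
    proof unfold_locales
      show "closedin Y (C G)" if "G \<in> \<G>" for G by (rule C(1)[OF that])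
      show "\<exists>O'. openin Y O' \<and> y \<in> O' \<and> finite {G \<in> \<G>. C G \<inter> O' \<noteq> {}}" if y: "y \<in> topspace Y" for y
      proof -
        obtain Q where Q: "openin Y Q" "y \<in> Q" "finite {G \<in> \<G>. G \<inter> Q \<noteq> {}}" using lf[OF y] by blast
        have "{G \<in> \<G>. C G \<inter> Q \<noteq> {}} \<subseteq> {G \<in> \<G>. G \<inter> Q \<noteq> {}}" using C(2) by blast
        from finite_subset[OF this Q(3)] show ?thesis using Q by blast
      qed
      show "continuous_map Y euclideanreal (\<mu> G)" if "G \<in> \<G>" for G using q that by (simp add: \<mu>_def)
      show "0 \<le> \<mu> G y" if "G \<in> \<G>" "y \<in> topspace Y" for G y using q that by (simp add: \<mu>_def)
      show "\<mu> G y = 0" if "G \<in> \<G>" "y \<in> topspace Y" "y \<notin> C G" for G y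
        using q that by (simp add: \<mu>_def C_def)
      show "\<exists>G\<in>\<G>. \<mu> G y = 1" if y: "y \<in> topspace Y" for y
      proof -
        obtain G where G: "G \<in> \<G>" "y \<in> S G" using S(3) y by blast
        then have "\<mu> G y = 1" using q by (simp add: \<mu>_def)
        then show ?thesis using G(1) by blast
      qed
      show "\<pi> G \<in> pieces" if "G \<in> \<T>" for G using \<pi>[OF that] by blast
    qed
    show "continuous_map (subtopology X ?N) K g"
      by (rule continuous_map_from_subtopology_mono[OF g]) (use V(3) V0sub(1) V0(3) in blast)
    fix G x assume G: "G \<in> \<G>" and x: "x \<in> ?N" "\<phi> x \<in> G"
    have xX: "x \<in> topspace X" using x(1) by (simp add: in_closure_of)
    obtain G' where G': "G' \<in> \<gamma>" "G \<subseteq> G'" using \<G>(2) G unfolding refines_def by blast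
    obtain Z where Z: "Z \<in> \<omega>" "{x \<in> topspace X. \<phi> x \<in> G'} \<subseteq> Z"
      using \<gamma>(2) G'(1) unfolding refines_def by blast
    \<comment> \<open>Since \<open>x\<close> lies in \<open>?N\<close>, the member \<open>Z\<close>
      of the cover cannot be the complement of \<open>?N\<close> and must be a pulled-back
      piece.\<close>
    have "x \<in> Z" using Z(2) xX x(2) G'(2) by blast
    then obtain p where p: "p \<in> pieces" "Z = P p"
      using Z(1) x(1) by (auto simp: \<omega>_def)
    have "{x \<in> topspace X. \<phi> x \<in> G} \<subseteq> P p" using Z(2) G'(2) p(2) by blast
    then have T: "G \<in> \<T>" using p(1) by (auto simp: \<T>_def)
    then show "G \<in> \<T> \<and> (\<forall>x'\<in>topspace X. \<phi> x' \<in> G \<longrightarrow> x' \<in> ?N \<longrightarrow> g x' \<in> piece (\<pi> G))"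
      using \<pi>[OF T] by (auto simp: P_def)
  qed
qed

end

theorem theorem2p4:
  fixes X :: "'a topology" and K :: "'k topology"
  assumes "normal_space X"
    and "CW_complex K"
    and "\<And>\<omega>. open_cover X \<omega> \<Longrightarrow> locally_finite_in X \<omega> \<Longrightarrow>
           \<exists>(Y :: 'b topology) f. paracompact_space Y \<and> Y \<in> alpha K \<and> omega_map \<omega> X Y f"
  shows "X \<in> alpha K"
proof -
  obtain E d \<Phi> where "CW_structure K E d \<Phi>"
    using assms(2) unfolding CW_complex_def by blast
  then interpret CW K E d \<Phi> by unfold_locales
  have "\<exists>h. continuous_map X K h \<and> (\<forall>x\<in>A. h x = f x)"
    if A: "closedin X A" and U: "U \<subseteq> topspace X" "A \<subseteq> X interior_of U"
      and g: "continuous_map (subtopology X U) K g" "\<forall>x\<in>A. g x = f x" for A f U g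
  proof -
    have "continuous_map (subtopology X (X interior_of U)) K g"
      by (rule continuous_map_from_subtopology_mono[OF g(1) interior_of_subset])
    from extension_from_omega_map[OF assms(1,3) A openin_interior_of U(2) this]
    obtain h where "continuous_map X K h" "\<forall>x\<in>A. h x = g x" by blast
    then show ?thesis using g(2) by (intro exI[of _ h]) simp
  qed
  then show ?thesis
    unfolding alpha_def using assms(1) by blast
qed

end
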